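(* Let $f:\mathbb{B}^n\to\mathbb{B}^N$ be a proper holomorphic map. (1) If $\Gamma_f$ contains the maximal $n$-torus $\mathbf{U}(1)\oplus\cdots\oplus\mathbf{U}(1)$ ($n$ summands; the diagonal unitary matrices) of $\mathrm{Aut}(\mathbb{B}^n)$, then $f$ is spherically equivalent to a monomial map. (2) If $\Gamma_f$ contains $\mathbf{U}(n)$, then $f$ is spherically equivalent to an orthogonal sum of tensor products. (3) If $\Gamma_f$ contains the center of $\mathbf{U}(n)$ and $\Gamma_f$ is noncompact, then $f$ is a linear fractional transformation.
   Context: $\mathbb{B}^k$ is the open unit ball in $\mathbb{C}^k$, $\mathrm{Aut}(\mathbb{B}^k)$ is its group of holomorphic automorphisms (with its usual Lie group topology), and $\mathbf{U}(n)\subseteq \mathrm{Aut}(\mathbb{B}^n)$ is the unitary group, whose center consists of the maps $z\mapsto e^{i\theta}z$. For holomorphic $f:\mathbb{B}^n\to\mathbb{B}^N$, $\Gamma_f=\{\gamma\in\mathrm{Aut}(\mathbb{B}^n): \exists\,\psi\in\mathrm{Aut}(\mathbb{B}^N),\ f\circ\gamma=\psi\circ f\}$. Holomorphic maps $f,g:\mathbb{B}^n\to\mathbb{B}^N$ are spherically equivalent if there are $\gamma\in\mathrm{Aut}(\mathbb{B}^n)$ and $\psi\in\mathrm{Aut}(\mathbb{B}^N)$ with $\psi\circ g=f\circ\gamma$. A monomial map is one each of whose components is a constant (possibly zero) multiple of a monomial $z^\alpha$. Let $z^{\otimes j}$ denote the $j$-fold (symmetric) tensor product map, whose components are $\sqrt{\tfrac{j!}{\alpha!}}\,z^\alpha$,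 $|\alpha|=j$, so that $\|z^{\otimes j}\|^2=\|z\|^{2j}$ (with $z^{\otimes 0}=1$). An orthogonal sum of tensor products is a map to $\mathbb{C}^N$ of the form $\lambda_1 z^{\otimes j_1}\oplus\cdots\oplus\lambda_s z^{\otimes j_s}$, with finitely many distinct nonnegative integers $j_1,\dots,j_s$ and constants $\lambda_i$, where zero components may be included so that the target is $\mathbb{C}^N$. A linear fractional transformation is a map of the form $z\mapsto \frac{Az+b}{\langle z,c\rangle+d}$ with $A$ an $N\times n$ complex matrix, $b\in\mathbb{C}^N$, $c\in\mathbb{C}^n$, $d\in\mathbb{C}$. *)

theory Defs
  imports "HOL-Analysis.Analysis"
begin

(* The type complex ^ 'n carries the Euclidean norm, so ball 0 1 is the unit ball of C^n with
   n = CARD('n). On an open set, being holomorphic means having a complex Jacobian matrix. *)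

definition holomorphic_map_on :: "(complex ^ 'n \<Rightarrow> complex ^ 'm) \<Rightarrow> (complex ^ 'n) set \<Rightarrow> bool"
  where "holomorphic_map_on f S \<longleftrightarrow>
    (\<forall>z\<in>S. \<exists>A :: complex ^ 'n ^ 'm. (f has_derivative (\<lambda>v. A *v v)) (at z))"

definition holomorphic_ball_map :: "(complex ^ 'n \<Rightarrow> complex ^ 'm) \<Rightarrow> bool"
  where "holomorphic_ball_map f \<longleftrightarrow> holomorphic_map_on f (ball 0 1) \<and> f ` ball 0 1 \<subseteq> ball 0 1"

definition proper_holomorphic_ball_map :: "(complex ^ 'n \<Rightarrow> complex ^ 'm) \<Rightarrow> bool"
  where "proper_holomorphic_ball_map f \<longleftrightarrow>
    holomorphic_ball_map f \<and> proper_map (top_of_set (ball 0 1)) (top_of_set (ball 0 1)) f"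

(* Automorphisms are normalised to be undefined outside the ball, so that equality of elements of
   this set is equality of maps on the ball. *)

definition ball_aut :: "(complex ^ 'n \<Rightarrow> complex ^ 'n) set"
  where "ball_aut = {\<gamma> \<in> extensional (ball 0 1).
    bij_betw \<gamma> (ball 0 1) (ball 0 1) \<and>
    holomorphic_map_on \<gamma> (ball 0 1) \<and>
    holomorphic_map_on (inv_into (ball 0 1) \<gamma>) (ball 0 1)}"

(* The Lie group topology of the automorphism group is the compact-open topology. *)

definition ball_aut_topology :: "(complex ^ 'n \<Rightarrow> complex ^ 'n) topology"
  where "ball_aut_topology = topology_generated_by
    {{\<gamma> \<in> ball_aut. \<gamma> ` K \<subseteq> U} | K U. compact K \<and> K \<subseteq> ball 0 1 \<and> open U}"

definition Gamma_of :: "(complex ^ 'n \<Rightarrow> complex ^ 'm) \<Rightarrow> (complex ^ 'n \<Rightarrow> complex ^ 'n) set"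
  where "Gamma_of f = {\<gamma> \<in> ball_aut. \<exists>\<psi>\<in>ball_aut. \<forall>z\<in>ball 0 1. f (\<gamma> z) = \<psi> (f z)}"

definition spherically_equivalent ::
    "(complex ^ 'n \<Rightarrow> complex ^ 'm) \<Rightarrow> (complex ^ 'n \<Rightarrow> complex ^ 'm) \<Rightarrow> bool"
  where "spherically_equivalent f g \<longleftrightarrow>
    holomorphic_ball_map f \<and> holomorphic_ball_map g \<and>
    (\<exists>\<gamma>\<in>ball_aut. \<exists>\<psi>\<in>ball_aut. \<forall>z\<in>ball 0 1. \<psi> (g z) = f (\<gamma> z))"

definition unitary_matrix :: "complex ^ 'n ^ 'n \<Rightarrow> bool"
  where "unitary_matrix A \<longleftrightarrow>
    (\<chi> i j. cnj (A $ j $ i)) ** A = mat 1 \<and> A ** (\<chi> i j. cnj (A $ j $ i)) = mat 1"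

definition linear_ball_map :: "complex ^ 'n ^ 'n \<Rightarrow> complex ^ 'n \<Rightarrow> complex ^ 'n"
  where "linear_ball_map A = restrict (\<lambda>z. A *v z) (ball 0 1)"

definition unitary_group :: "(complex ^ 'n \<Rightarrow> complex ^ 'n) set"
  where "unitary_group = {linear_ball_map A | A. unitary_matrix A}"

definition diagonal_torus :: "(complex ^ 'n \<Rightarrow> complex ^ 'n) set"
  where "diagonal_torus =
    {linear_ball_map A | A. unitary_matrix A \<and> (\<forall>i j. i \<noteq> j \<longrightarrow> A $ i $ j = 0)}"

definition unitary_center :: "(complex ^ 'n \<Rightarrow> complex ^ 'n) set"
  where "unitary_center = {restrict (\<lambda>z. cis \<theta> *s z) (ball 0 1) | \<theta>. True}"

definition monomial :: "('n \<Rightarrow> nat) \<Rightarrow> complex ^ 'n \<Rightarrow> complex"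
  where "monomial \<alpha> z = (\<Prod>i\<in>UNIV. (z $ i) ^ \<alpha> i)"

definition monomial_map :: "(complex ^ 'n \<Rightarrow> complex ^ 'm) \<Rightarrow> bool"
  where "monomial_map g \<longleftrightarrow>
    (\<forall>k. \<exists>c \<alpha>. \<forall>z\<in>ball 0 1. g z $ k = c * monomial \<alpha> z)"

definition multi_degree :: "('n::finite \<Rightarrow> nat) \<Rightarrow> nat"
  where "multi_degree \<alpha> = (\<Sum>i\<in>UNIV. \<alpha> i)"

(* The component with index \<alpha> of the symmetric tensor power of z of order multi_degree \<alpha>. *)

definition tensor_component :: "('n \<Rightarrow> nat) \<Rightarrow> complex ^ 'n \<Rightarrow> complex"
  where "tensor_component \<alpha> z =
    of_real (sqrt (fact (multi_degree \<alpha>) / (\<Prod>i\<in>UNIV. fact (\<alpha> i)))) * monomial \<alpha> z"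

(* J is the set of tensor orders and lam j the coefficient of the summand of order j. The index
   type 'm has no order, so the concatenation of the summands is given by an injection e, which
   places each component in its own coordinate; the coordinates not in its image are the added
   zero components. *)

definition orthogonal_sum_of_tensor_products :: "(complex ^ 'n \<Rightarrow> complex ^ 'm) \<Rightarrow> bool"
  where "orthogonal_sum_of_tensor_products g \<longleftrightarrow>
    (\<exists>(J :: nat set) (lam :: nat \<Rightarrow> complex) (e :: ('n \<Rightarrow> nat) \<Rightarrow> 'm).
      finite J \<and> inj_on e {\<alpha>. multi_degree \<alpha> \<in> J} \<and>
      (\<forall>z\<in>ball 0 1.
        (\<forall>\<alpha>. multi_degree \<alpha> \<in> J \<longrightarrow> g z $ e \<alpha> = lam (multi_degree \<alpha>) * tensor_component \<alpha> z) \<and>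
        (\<forall>k. k \<notin> e ` {\<alpha>. multi_degree \<alpha> \<in> J} \<longrightarrow> g z $ k = 0)))"

(* The denominator must not vanish on the ball: division by zero is total in HOL. *)

definition linear_fractional :: "(complex ^ 'n \<Rightarrow> complex ^ 'm) \<Rightarrow> bool"
  where "linear_fractional f \<longleftrightarrow>
    (\<exists>(A :: complex ^ 'n ^ 'm) (b :: complex ^ 'm) (c :: complex ^ 'n) (d :: complex).
      \<forall>z\<in>ball 0 1.
        (\<Sum>i\<in>UNIV. z $ i * cnj (c $ i)) + d \<noteq> 0 \<and>
        f z = inverse ((\<Sum>i\<in>UNIV. z $ i * cnj (c $ i)) + d) *s (A *v z + b))"

end

theory Submission
  imports Defs "HOL-Complex_Analysis.Conformal_Mappings"
    "HOL-Computational_Algebra.Fundamental_Theorem_Algebra"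
begin

text \<open>
  All three parts rest on one observation. A unitary map in the symmetry group fixes the origin, so
  the automorphism of the target ball that matches it fixes \<open>f 0\<close>. After conjugation with the
  involution of the target ball that exchanges \<open>f 0\<close> and the origin, it fixes the origin, and by
  the Schwarz lemma it is then a unitary map
  (\<open>ball_aut_fixing_0_unitary\<close>, \<open>unitary_Gamma_of\<close>). Call the normalised map \<open>F\<close>.

  If the rotations by scalars are symmetries, the values of the part of \<open>F\<close> of degree \<open>k\<close> are
  eigenvectors of the corresponding unitary maps of the target, with an eigenvalue that determines
  \<open>k\<close>. Parts of different degrees are therefore orthogonal, and since the target has finite
  dimension only finitely many of them occur (\<open>rotation_equivariant_expansion\<close>). Each part is
  entire with polynomial growth, so \<open>F\<close> is a polynomial (\<open>normalised_polynomial\<close>).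

  If the whole diagonal torus consists of symmetries, the same eigenvector argument separates
  monomials: their coefficient vectors are orthogonal, and in an orthonormal basis that extends the
  normalised coefficient vectors the map is monomial (\<open>torus_invariant_normal_form\<close>). If moreover
  all unitary maps are symmetries, the squared norm of \<open>F\<close> is a polynomial in the squared norm of
  the argument, and comparison with the multinomial theorem determines the norms of the
  coefficient vectors (\<open>unitary_invariant_tensor_sum\<close>).

  For the third part, suppose first that every symmetry fixes the origin. Then the symmetries are
  unitary and form a compact group (\<open>compactin_Gamma_of_fixing_0\<close>). So in the noncompact case
  there is a symmetry that maps a point \<open>p\<close> different from the origin to the origin. It is a
  unitary map \<open>U\<close> after the involution \<open>ball_invol p\<close>, and \<open>F (U (ball_invol p z))\<close> is a unitary
  image of \<open>ball_invol b (F z)\<close> with \<open>b = F p\<close>. On the disc through \<open>p\<close>, with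
  \<open>F (t p) = \<Sum>k. t ^ k a k p\<close>, the invariance of the Hermitian form of the ball shows that the
  polynomial \<open>1 - (\<Sum>k. norm (a k p) ^ 2 * t ^ k)\<close> has no root other than \<open>1 / norm p ^ 2\<close>. It is
  therefore a power of \<open>1 - norm p ^ 2 * t\<close>, and since its coefficient of \<open>t ^ 2\<close> is nonpositive
  the exponent is at most one. Properness excludes the exponent zero, because it would make \<open>f\<close>
  constant on that disc. Hence \<open>a k p = 0\<close> for \<open>k \<noteq> 1\<close> and \<open>norm (a 1 p) = norm p\<close>
  (\<open>a_at_p\<close>). So the symmetry equation has the denominator
  \<open>1 - hinner z p\<close> to the power one on the right, while a nonzero part of degree \<open>m \<ge> 2\<close> would
  produce its power \<open>m\<close> on the left; continuing along complex lines to the hyperplane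
  \<open>hinner z p = 1\<close> shows that such a part vanishes (\<open>higher_parts_vanish\<close>). Thus \<open>F\<close> is linear,
  and \<open>f\<close>, the involution applied to a linear map, is linear fractional.
\<close>

section \<open>The Hermitian inner product and unitary matrices\<close>

definition hinner :: "complex ^ 'n \<Rightarrow> complex ^ 'n \<Rightarrow> complex"
  where "hinner z w = (\<Sum>i\<in>UNIV. z $ i * cnj (w $ i))"

lemma hinner_linear [simp]:
  "hinner (x + y) z = hinner x z + hinner y z"
  "hinner z (x + y) = hinner z x + hinner z y"
  "hinner (x - y) z = hinner x z - hinner y z"
  "hinner z (x - y) = hinner z x - hinner z y"
  "hinner (- x) z = - hinner x z"
  "hinner z (- x) = - hinner z x"
  "hinner (c *s x) z = c * hinner x z"
  "hinner z (c *s x) = cnj c * hinner z x"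
  "hinner 0 z = 0"
  "hinner z 0 = 0"
  unfolding hinner_def
  by (simp_all add: algebra_simps sum.distrib sum_subtractf sum_negf sum_distrib_left)

lemma hinner_sum_left: "hinner (\<Sum>i\<in>A. x i) z = (\<Sum>i\<in>A. hinner (x i) z)"
  by (induction A rule: infinite_finite_induct) auto

lemma hinner_sum_right: "hinner z (\<Sum>i\<in>A. x i) = (\<Sum>i\<in>A. hinner z (x i))"
  by (induction A rule: infinite_finite_induct) auto

lemma cnj_hinner: "cnj (hinner z w) = hinner w z"
  unfolding hinner_def by (simp add: mult.commute)

lemma Re_hinner: "Re (hinner z w) = z \<bullet> w"
  unfolding hinner_def inner_vec_def by (simp add: inner_complex_def)

lemma hinner_self: "hinner z z = of_real ((norm z)\<^sup>2)"
proof -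
  have "hinner z z = of_real (\<Sum>i\<in>UNIV. (norm (z $ i))\<^sup>2)"
    unfolding hinner_def of_real_sum by (simp only: complex_norm_square)
  also have "(\<Sum>i\<in>UNIV. (norm (z $ i))\<^sup>2) = (norm z)\<^sup>2"
    unfolding norm_vec_def L2_set_def by (simp add: sum_nonneg)
  finally show ?thesis .
qed

lemma norm_scalar_mult [simp]: "norm (c *s (z :: complex ^ 'n)) = norm c * norm z"
  unfolding norm_vec_def by (simp add: norm_mult L2_set_right_distrib)

lemma scaleR_eq_scalar_mult: "h *\<^sub>R (z :: complex ^ 'n) = of_real h *s z"
  by (simp add: vec_eq_iff scaleR_conv_of_real[where 'a = complex])

lemma norm_hinner_le: "norm (hinner z w) \<le> norm z * norm w"
proof (cases "hinner z w = 0")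
  case False
  define c where "c = cnj (hinner z w) / norm (hinner z w)"
  have "norm c = 1" using False by (simp add: c_def norm_divide)
  have "hinner (c *s z) w = norm (hinner z w)"
    using False unfolding c_def hinner_linear
    by (simp add: mult.commute complex_norm_square[symmetric] power2_eq_square)
  then have "norm (hinner z w) = (c *s z) \<bullet> w" by (metis Re_hinner Re_complex_of_real)
  also have "\<dots> \<le> norm (c *s z) * norm w" by (rule norm_cauchy_schwarz)
  finally show ?thesis using \<open>norm c = 1\<close> by simp
qed simp

text \<open>The equality case of the Cauchy--Schwarz inequality.\<close>

lemma hinner_eq_imp_eq:
  assumes "norm x \<le> norm c" "norm u = 1" "hinner x u = c"
  shows "x = c *s u"
proof -
  have "hinner u x = cnj c" using assms(3) cnj_hinner by metis
  have "hinner (x - c *s u) (x - c *s u) =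
      hinner x x - cnj c * hinner x u - c * hinner u x + c * cnj c * hinner u u"
    by (simp add: algebra_simps)
  then have "hinner (x - c *s u) (x - c *s u) = hinner x x - c * cnj c"
    using assms(2,3) \<open>hinner u x = cnj c\<close> hinner_self[of u] by (simp add: mult.commute)
  then have "hinner (x - c *s u) (x - c *s u) = of_real ((norm x)\<^sup>2 - (norm c)\<^sup>2)"
    using hinner_self[of x] complex_norm_square[of c] by simp
  then have "(norm (x - c *s u))\<^sup>2 = (norm x)\<^sup>2 - (norm c)\<^sup>2"
    unfolding hinner_self using of_real_eq_iff by blast
  moreover have "(norm x)\<^sup>2 \<le> (norm c)\<^sup>2" using assms(1) by (simp add: power_mono)
  ultimately have "(norm (x - c *s u))\<^sup>2 \<le> 0" by linarith
  then show ?thesis by simp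
qed

definition adj :: "complex ^ 'n ^ 'm \<Rightarrow> complex ^ 'm ^ 'n"
  where "adj A = (\<chi> i j. cnj (A $ j $ i))"

lemma hinner_adj: "hinner (A *v z) w = hinner z (adj A *v w)"
proof -
  have "hinner (A *v z) w = (\<Sum>i\<in>UNIV. \<Sum>j\<in>UNIV. A $ i $ j * z $ j * cnj (w $ i))"
    unfolding hinner_def matrix_vector_mult_def by (simp add: sum_distrib_right)
  also have "\<dots> = (\<Sum>j\<in>UNIV. \<Sum>i\<in>UNIV. A $ i $ j * z $ j * cnj (w $ i))" by (rule sum.swap)
  also have "\<dots> = hinner z (adj A *v w)"
    unfolding hinner_def matrix_vector_mult_def adj_def
    by (simp add: sum_distrib_left algebra_simps)
  finally show ?thesis .
qed

lemma unitary_matrix_iff_adj: "unitary_matrix A \<longleftrightarrow> adj A ** A = mat 1 \<and> A ** adj A = mat 1"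
  unfolding unitary_matrix_def adj_def by simp

lemma adj_adj [simp]: "adj (adj A) = A"
  unfolding adj_def by (simp add: vec_eq_iff)

lemma unitary_matrix_adj: "unitary_matrix A \<Longrightarrow> unitary_matrix (adj A)"
  unfolding unitary_matrix_iff_adj by simp

lemma unitary_adj_cancel:
  assumes "unitary_matrix A"
  shows "adj A *v (A *v z) = z" "A *v (adj A *v z) = z"
  using assms unfolding unitary_matrix_iff_adj by (simp_all add: matrix_vector_mul_assoc)

lemma unitary_hinner:
  assumes "unitary_matrix A" shows "hinner (A *v z) (A *v w) = hinner z w"
  by (simp add: hinner_adj unitary_adj_cancel assms)

lemma norm_eq_of_hinner: "hinner z z = hinner w w \<Longrightarrow> norm z = norm w"
  unfolding hinner_self of_real_eq_iff by simp

lemma unitary_norm: "unitary_matrix A \<Longrightarrow> norm (A *v z) = norm z"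
  by (rule norm_eq_of_hinner) (rule unitary_hinner)

lemma hinner_axis [simp]: "hinner z (axis i 1) = z $ i"
  unfolding hinner_def axis_def by (simp add: if_distrib cong: if_cong)

lemma unitaryI_hinner:
  fixes A :: "complex ^ 'n ^ 'n"
  assumes "\<And>z w. hinner (A *v z) (A *v w) = hinner z w"
  shows "unitary_matrix A"
proof -
  have "adj A *v (A *v z) = z" for z
  proof -
    have "hinner (adj A *v (A *v z)) (axis i 1) = hinner z (axis i 1)" for i
      by (subst hinner_adj) (simp add: assms del: hinner_axis)
    then show ?thesis by (simp add: vec_eq_iff)
  qed
  then have "adj A ** A = mat 1"
    by (simp add: matrix_eq matrix_vector_mul_assoc[symmetric])
  then show ?thesis unfolding unitary_matrix_iff_adj using matrix_left_right_inverse by blast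
qed

text \<open>Polarisation: the real part of the inner product is a combination of squared norms, and
  the imaginary part is the real part with one argument multiplied by the imaginary unit.\<close>

lemma unitaryI_norm:
  fixes A :: "complex ^ 'n ^ 'n"
  assumes n: "\<And>z. norm (A *v z) = norm z"
  shows "unitary_matrix A"
proof (rule unitaryI_hinner)
  have Re: "Re (hinner (A *v z) (A *v w)) = Re (hinner z w)" for z w
    unfolding Re_hinner using n[of "z + w"] n[of z] n[of w]
    by (simp add: matrix_vector_right_distrib norm_eq_sqrt_inner inner_add inner_commute)
  have Im: "Im (hinner z w) = Re (hinner z (\<i> *s w))" for z w :: "complex ^ 'n" by simp
  show "hinner (A *v z) (A *v w) = hinner z w" for z w
    by (rule complex_eqI) (use Re Im in \<open>auto simp: vector_scalar_commute[symmetric] simp del: hinner_linear\<close>)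
qed

lemma unitary_matrix_mult: "unitary_matrix A \<Longrightarrow> unitary_matrix B \<Longrightarrow> unitary_matrix (A ** B)"
  by (rule unitaryI_norm) (simp add: matrix_vector_mul_assoc[symmetric] unitary_norm)

lemma unitary_matrix_one: "unitary_matrix (mat 1)"
  by (rule unitaryI_norm) simp

definition diagonal_matrix :: "complex ^ 'n \<Rightarrow> complex ^ 'n ^ 'n"
  where "diagonal_matrix w = (\<chi> i j. if i = j then w $ i else 0)"

lemma diagonal_matrix_mult: "diagonal_matrix w *v z = (\<chi> i. w $ i * z $ i)"
  unfolding diagonal_matrix_def matrix_vector_mult_def
  by (simp add: vec_eq_iff if_distrib if_distribR cong: if_cong)

lemma unitary_diagonal_matrix:
  assumes "\<And>i. norm (w $ i) = 1" shows "unitary_matrix (diagonal_matrix w)"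
  by (rule unitaryI_norm)
     (simp add: diagonal_matrix_mult norm_vec_def norm_mult assms)

section \<open>Extending orthonormal families to unitary matrices\<close>

text \<open>Pairing with the vectors indexed by \<open>T\<close> is given by a square matrix with a zero row, and
  such a matrix has a nontrivial kernel.\<close>

lemma exists_unit_orthogonal:
  fixes u :: "'m::finite \<Rightarrow> complex ^ 'm"
  assumes "k \<notin> T"
  shows "\<exists>x. norm x = 1 \<and> (\<forall>i\<in>T. hinner x (u i) = 0)"
proof -
  define A :: "complex ^ 'm ^ 'm" where "A = (\<chi> i j. if i \<in> T then cnj (u i $ j) else 0)"
  have "\<not> (\<exists>B. B ** A = mat 1)"
  proof
    assume "\<exists>B. B ** A = mat 1"
    then obtain B where "A ** B = mat 1" using matrix_left_right_inverse by blast
    then have "(A ** B) $ k $ k = 1" by (simp add: mat_def)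
    moreover have "(A ** B) $ k $ k = 0" using assms by (simp add: A_def matrix_matrix_mult_def)
    ultimately show False by simp
  qed
  then obtain y where y: "A *v y = 0" "y \<noteq> 0" unfolding matrix_left_invertible_ker by blast
  have "hinner y (u i) = 0" if "i \<in> T" for i
  proof -
    have "(A *v y) $ i = hinner y (u i)"
      using that by (simp add: A_def matrix_vector_mult_def hinner_def mult.commute)
    then show ?thesis using y by simp
  qed
  moreover have "norm (of_real (1 / norm y) *s y) = 1" using y by (simp add: norm_divide)
  ultimately show ?thesis by (metis hinner_linear(7) mult_zero_right)
qed

lemma orthonormal_extend:
  fixes u :: "'m::finite \<Rightarrow> complex ^ 'm"
  assumes "\<And>i j. i \<in> T \<Longrightarrow> j \<in> T \<Longrightarrow> hinner (u i) (u j) = (if i = j then 1 else 0)"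
  shows "\<exists>v. (\<forall>i\<in>T. v i = u i) \<and> (\<forall>i j. hinner (v i) (v j) = (if i = j then 1 else 0))"
  using assms
proof (induction "card (- T)" arbitrary: T u)
  case 0
  then have "T = UNIV" by (metis Compl_eq_Diff_UNIV Diff_eq_empty_iff card_0_eq finite top.extremum_uniqueI)
  then show ?case using 0 by auto
next
  case (Suc n)
  then obtain k where k: "k \<notin> T" by (metis ComplD card_eq_0_iff ex_in_conv nat.distinct(1))
  obtain x where x: "norm x = 1" "\<forall>i\<in>T. hinner x (u i) = 0"
    using exists_unit_orthogonal[OF k, of u] by blast
  have x': "hinner x x = 1" using x by (simp add: hinner_self)
  have x'': "hinner (u i) x = 0" if "i \<in> T" for i
    using x(2) that cnj_hinner[of x "u i"] by simp
  define u' where "u' = u(k := x)"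
  have "n = card (- insert k T)" using Suc(2) k
    by (metis Compl_insert Suc_inject card_Suc_Diff1 ComplI finite)
  moreover have "hinner (u' i) (u' j) = (if i = j then 1 else 0)"
    if "i \<in> insert k T" "j \<in> insert k T" for i j
    using that k x x' x'' Suc(3) unfolding u'_def by auto
  ultimately obtain v where v: "\<forall>i\<in>insert k T. v i = u' i"
    "\<forall>i j. hinner (v i) (v j) = (if i = j then 1 else 0)"
    using Suc(1)[of "insert k T" u'] by blast
  then have "\<forall>i\<in>T. v i = u i" using k unfolding u'_def by auto
  with v show ?case by blast
qed

lemma orthonormal_unitary:
  fixes v :: "'m::finite \<Rightarrow> complex ^ 'm"
  assumes "\<And>i j. hinner (v i) (v j) = (if i = j then 1 else 0)"
  shows "\<exists>V. unitary_matrix V \<and> (\<forall>i. V *v axis i 1 = v i)"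
proof -
  define V :: "complex ^ 'm ^ 'm" where "V = (\<chi> i j. v j $ i)"
  have "(adj V ** V) $ i $ j = hinner (v j) (v i)" for i j
    unfolding V_def adj_def matrix_matrix_mult_def hinner_def by (simp add: mult.commute)
  then have "adj V ** V = mat 1" using assms by (auto simp: vec_eq_iff mat_def)
  then have "unitary_matrix V"
    unfolding unitary_matrix_iff_adj using matrix_left_right_inverse by blast
  moreover have "V *v axis i 1 = v i" for i
    unfolding V_def matrix_vector_mult_def axis_def
    by (simp add: vec_eq_iff if_distrib cong: if_cong)
  ultimately show ?thesis by blast
qed

lemma orthonormal_family_unitary:
  fixes u :: "'a \<Rightarrow> complex ^ 'm"
  assumes "finite S" "\<And>a b. a \<in> S \<Longrightarrow> b \<in> S \<Longrightarrow> hinner (u a) (u b) = (if a = b then 1 else 0)"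
  shows "\<exists>e V. inj_on e S \<and> unitary_matrix V \<and> (\<forall>a\<in>S. V *v axis (e a :: 'm) 1 = u a)"
  using assms
proof (induction S)
  case empty
  then show ?case using unitary_matrix_one by auto
next
  case (insert b S)
  then obtain e V where eV: "inj_on e S" "unitary_matrix V" "\<And>a. a \<in> S \<Longrightarrow> V *v axis (e a :: 'm) 1 = u a"
    by auto
  have "hinner (adj V *v u b) (axis (e a) 1) = 0" if "a \<in> S" for a
    by (subst hinner_adj) (use eV(3)[OF that] insert(2) insert(4)[of b a] that in \<open>auto simp del: hinner_axis\<close>)
  then have z: "(adj V *v u b) $ e a = 0" if "a \<in> S" for a using that by simp
  \<comment> \<open>in the basis given by the columns of V, the new vector lives in the unused coordinates\<close>
  have "hinner (u b) (u b) = 1" using insert(4) by simp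
  then have "u b \<noteq> 0" by auto
  then have "adj V *v u b \<noteq> 0" using unitary_adj_cancel[OF eV(2), of "u b"] by auto
  then obtain k where k: "(adj V *v u b) $ k \<noteq> 0" by (auto simp: vec_eq_iff)
  then have kn: "k \<notin> e ` S" using z by auto
  define e' where "e' = e(b := k)"
  have inj: "inj_on e' (insert b S)"
    using eV(1) kn insert(2) unfolding e'_def by (auto simp: inj_on_def)
  define w where "w = (\<lambda>i. u (inv_into (insert b S) e' i))"
  have w: "w (e' a) = u a" if "a \<in> insert b S" for a
    unfolding w_def using inv_into_f_f[OF inj that] by simp
  have "hinner (w i) (w j) = (if i = j then 1 else 0)"
    if "i \<in> e' ` insert b S" "j \<in> e' ` insert b S" for i j
  proof -
    from that obtain a c where ac: "i = e' a" "j = e' c" "a \<in> insert b S" "c \<in> insert b S"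
      by blast
    then have "i = j \<longleftrightarrow> a = c" using inj by (metis inj_onD)
    then show ?thesis using w[OF ac(3)] w[OF ac(4)] insert(4)[OF ac(3,4)] ac(1,2) by simp
  qed
  from orthonormal_extend[of "e' ` insert b S" w, OF this] obtain v where
    v: "\<forall>i\<in>e' ` insert b S. v i = w i" "\<forall>i j. hinner (v i) (v j) = (if i = j then 1 else 0)" by blast
  obtain V' where "unitary_matrix V'" "\<forall>i. V' *v axis i 1 = v i"
    using orthonormal_unitary[of v] v(2) by blast
  then have "\<forall>a\<in>insert b S. V' *v axis (e' a) 1 = u a" using v(1) w by auto
  then show ?case using inj \<open>unitary_matrix V'\<close> by blast
qed

lemma unitary_transitive:
  fixes x y :: "complex ^ 'n"
  assumes "norm x = norm y"
  shows "\<exists>U. unitary_matrix U \<and> U *v x = y"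
proof (cases "x = 0")
  case True
  then show ?thesis using assms unitary_matrix_one by (intro exI[of _ "mat 1"]) auto
next
  case False
  have to_axis: "\<exists>V. unitary_matrix V \<and> V *v (of_real (norm z) *s axis undefined 1) = z"
    if "z \<noteq> 0" for z :: "complex ^ 'n"
  proof -
    let ?u = "of_real (1 / norm z) *s z"
    have "norm ?u = 1" using that by (simp add: norm_divide)
    then have e: "hinner ?u ?u = 1" by (simp only: hinner_self) simp
    have "\<exists>v :: 'n \<Rightarrow> complex ^ 'n. (\<forall>i\<in>{undefined}. v i = ?u) \<and> (\<forall>i j. hinner (v i) (v j) = (if i = j then 1 else 0))"
      by (rule orthonormal_extend[where u = "\<lambda>_. ?u"]) (use e in \<open>simp del: hinner_linear\<close>)
    then obtain v :: "'n \<Rightarrow> complex ^ 'n" where v: "v undefined = ?u" "\<forall>i j. hinner (v i) (v j) = (if i = j then 1 else 0)"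
      by auto
    then obtain V where V: "unitary_matrix V" "\<forall>i. V *v axis i 1 = v i"
      using orthonormal_unitary[of v] by blast
    then have "V *v (of_real (norm z) *s axis undefined 1) = of_real (norm z) *s ?u"
      by (simp add: vector_scalar_commute v)
    also have "\<dots> = z" using that by (simp add: vec_eq_iff)
    finally show ?thesis using V by blast
  qed
  have "y \<noteq> 0" using assms False by auto
  obtain V W where VW: "unitary_matrix V" "V *v (of_real (norm x) *s axis undefined 1) = x"
    "unitary_matrix W" "W *v (of_real (norm y) *s axis undefined 1) = y"
    using to_axis[OF False] to_axis[OF \<open>y \<noteq> 0\<close>] by auto
  have "adj V *v x = of_real (norm x) *s axis undefined 1"
    using unitary_adj_cancel(1)[OF VW(1)] VW(2) by metis
  then have "(W ** adj V) *v x = y"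
    using VW(4) assms by (simp add: matrix_vector_mul_assoc[symmetric])
  then show ?thesis using unitary_matrix_mult VW unitary_matrix_adj by blast
qed

section \<open>Holomorphic maps of several variables\<close>

lemma bounded_bilinear_scalar_mult:
  "bounded_bilinear ((*s) :: complex \<Rightarrow> complex ^ 'n \<Rightarrow> complex ^ 'n)"
proof
  show "\<exists>K. \<forall>a b :: complex ^ 'n. norm (a *s b) \<le> norm a * norm b * K" for K :: real
    by (intro exI[of _ 1]) simp
qed (auto simp: vec_eq_iff algebra_simps scaleR_conv_of_real[where 'a = complex])

lemma bounded_linear_hinner_left: "bounded_linear (\<lambda>z. hinner z a)"
proof
  show "\<exists>K. \<forall>x. norm (hinner x a) \<le> norm x * K"
    by (intro exI[of _ "norm a"]) (simp add: norm_hinner_le)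
qed (auto simp: scaleR_eq_scalar_mult scaleR_conv_of_real)

lemma bounded_linear_matrix: "bounded_linear (\<lambda>z. (A :: complex ^ 'n ^ 'm) *v z)"
proof (rule linear_conv_bounded_linear[THEN iffD1], rule linearI)
  show "A *v (r *\<^sub>R b) = r *\<^sub>R (A *v b)" for r b
    by (simp add: scaleR_eq_scalar_mult vector_scalar_commute)
qed (simp add: matrix_vector_right_distrib)

text \<open>This allows derivatives to be computed by the rules for real Frechet derivatives, without
  exhibiting Jacobian matrices.\<close>

lemma complex_linear_matrix:
  fixes D :: "complex ^ 'n \<Rightarrow> complex ^ 'm"
  assumes "bounded_linear D" "\<And>c v. D (c *s v) = c *s D v"
  shows "\<exists>A. \<forall>v. D v = A *v v"
proof -
  interpret bounded_linear D by fact
  have "Vector_Spaces.linear (*s) (*s) D"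
    by unfold_locales (auto simp: add assms algebra_simps vec_eq_iff)
  then show ?thesis using matrix_works by metis
qed

lemma holomorphic_map_onI:
  assumes "\<And>z. z \<in> S \<Longrightarrow> \<exists>D. (f has_derivative D) (at z) \<and> (\<forall>c v. D (c *s v) = c *s D v)"
  shows "holomorphic_map_on f S"
  unfolding holomorphic_map_on_def
proof
  fix z assume "z \<in> S"
  then obtain D where D: "(f has_derivative D) (at z)" "\<forall>c v. D (c *s v) = c *s D v"
    using assms by blast
  then obtain A where "\<forall>v. D v = A *v v"
    using complex_linear_matrix has_derivative_bounded_linear by blast
  then have "D = (\<lambda>v. A *v v)" by blast
  then show "\<exists>A. (f has_derivative (\<lambda>v. A *v v)) (at z)" using D by blast
qed

lemma holomorphic_map_on_cong:
  assumes "holomorphic_map_on f S" "open S" "\<And>z. z \<in> S \<Longrightarrow> f z = g z"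
  shows "holomorphic_map_on g S"
  using assms unfolding holomorphic_map_on_def
  by (meson has_derivative_transform_within_open)

lemma holomorphic_map_on_compose:
  assumes "holomorphic_map_on f S" "holomorphic_map_on g T" "\<And>z. z \<in> S \<Longrightarrow> f z \<in> T"
  shows "holomorphic_map_on (\<lambda>z. g (f z)) S"
  unfolding holomorphic_map_on_def
proof
  fix z assume z: "z \<in> S"
  then obtain A B where "(f has_derivative (\<lambda>v. A *v v)) (at z)"
      "(g has_derivative (\<lambda>v. B *v v)) (at (f z))"
    using assms unfolding holomorphic_map_on_def by blast
  then have "((\<lambda>z. g (f z)) has_derivative (\<lambda>v. B *v (A *v v))) (at z)"
    by (rule has_derivative_compose)
  then show "\<exists>A. ((\<lambda>z. g (f z)) has_derivative (\<lambda>v. A *v v)) (at z)"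
    by (auto simp: matrix_vector_mul_assoc)
qed

lemma holomorphic_map_on_matrix: "holomorphic_map_on (\<lambda>z. A *v z) S"
  unfolding holomorphic_map_on_def
  using bounded_linear_imp_has_derivative[OF bounded_linear_matrix] by blast

lemma holomorphic_map_on_continuous: "holomorphic_map_on f S \<Longrightarrow> continuous_on S f"
  unfolding holomorphic_map_on_def
  by (meson continuous_at_imp_continuous_on has_derivative_continuous)

lemma holomorphic_map_on_sum:
  assumes "\<And>i. i \<in> I \<Longrightarrow> holomorphic_map_on (f i) S"
  shows "holomorphic_map_on (\<lambda>z. \<Sum>i\<in>I. c i *s f i z) S"
proof (rule holomorphic_map_onI)
  fix z assume "z \<in> S"
  then have "\<forall>i\<in>I. \<exists>A. (f i has_derivative (\<lambda>v. A *v v)) (at z)"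
    using assms unfolding holomorphic_map_on_def by blast
  then obtain A where A: "\<And>i. i \<in> I \<Longrightarrow> (f i has_derivative (\<lambda>v. A i *v v)) (at z)" by metis
  have "((\<lambda>z. \<Sum>i\<in>I. c i *s f i z) has_derivative (\<lambda>v. \<Sum>i\<in>I. c i *s (A i *v v))) (at z)"
    by (intro has_derivative_sum bounded_linear.has_derivative[OF
          bounded_bilinear.bounded_linear_right[OF bounded_bilinear_scalar_mult]] A)
  moreover have "(\<Sum>i\<in>I. c i *s (A i *v (d *s v))) = d *s (\<Sum>i\<in>I. c i *s (A i *v v))" for d v
    by (simp add: vector_scalar_commute vec_eq_iff sum_distrib_left algebra_simps)
  ultimately show "\<exists>D. ((\<lambda>z. \<Sum>i\<in>I. c i *s f i z) has_derivative D) (at z) \<and>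
      (\<forall>c v. D (c *s v) = c *s D v)" by blast
qed

text \<open>Restriction to complex lines reduces the function theory needed to one variable.\<close>

lemma holomorphic_slice:
  assumes "holomorphic_map_on f S" "open T" "\<And>t. t \<in> T \<Longrightarrow> z + t *s w \<in> S"
  shows "(\<lambda>t. hinner (f (z + t *s w)) u) holomorphic_on T"
  unfolding holomorphic_on_open[OF assms(2)]
proof (intro ballI)
  fix t assume "t \<in> T"
  then obtain A where A: "(f has_derivative (\<lambda>v. A *v v)) (at (z + t *s w))"
    using assms unfolding holomorphic_map_on_def by blast
  have "((\<lambda>t. z + t *s w) has_derivative (\<lambda>h. h *s w)) (at t)"
    using has_derivative_add[OF has_derivative_const[of z] bounded_linear_imp_has_derivative[OF
          bounded_bilinear.bounded_linear_left[OF bounded_bilinear_scalar_mult, of w]]]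
    by simp
  from has_derivative_compose[OF this A]
  have "((\<lambda>t. f (z + t *s w)) has_derivative (\<lambda>h. A *v (h *s w))) (at t)" .
  from bounded_linear.has_derivative[OF bounded_linear_hinner_left this]
  have "((\<lambda>t. hinner (f (z + t *s w)) u) has_derivative (\<lambda>h. hinner (A *v (h *s w)) u)) (at t)" .
  then have "((\<lambda>t. hinner (f (z + t *s w)) u) has_field_derivative hinner (A *v w) u) (at t)"
    unfolding has_field_derivative_def by (simp add: vector_scalar_commute mult.commute[of _ "hinner (A *v w) u"])
  then show "\<exists>D. ((\<lambda>t. hinner (f (z + t *s w)) u) has_field_derivative D) (at t)" by blast
qed

lemma holomorphic_slice_0:
  assumes "holomorphic_map_on f S" "open T" "\<And>t. t \<in> T \<Longrightarrow> t *s w \<in> S"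
  shows "(\<lambda>t. hinner (f (t *s w)) u) holomorphic_on T"
  using holomorphic_slice[of f S T 0 w u] assms by simp

section \<open>The Schwarz lemma and the isotropy group of the origin\<close>

lemma scalar_mult_in_ball:
  fixes z :: "complex ^ 'n"
  assumes "z \<in> ball 0 1" "norm t \<le> 1" shows "t *s z \<in> ball 0 1"
  using assms mult_left_le_one_le[of "norm z" "norm t"] by simp

text \<open>Both parts come from the Schwarz lemma in one variable, applied on the disc through
  \<open>z\<close> to the component of the map in the direction of \<open>F z\<close>. If the norm at \<open>z\<close> is
  preserved, that component is the full vector by the equality case of Cauchy--Schwarz.\<close>

lemma
  assumes F: "holomorphic_map_on F (ball 0 1)" "\<And>z. z \<in> ball 0 1 \<Longrightarrow> F z \<in> ball 0 1" "F 0 = 0"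
    and z: "z \<in> ball 0 1"
  shows ball_Schwarz: "norm (F z) \<le> norm z"
    and ball_Schwarz_eq: "norm (F z) = norm z \<Longrightarrow> norm t \<le> 1 \<Longrightarrow> F (t *s z) = t *s F z"
proof -
  have main: "norm (F z) \<le> norm z \<and>
      (norm (F z) = norm z \<longrightarrow> (\<forall>t. norm t < 1 \<longrightarrow> hinner (F (t *s (of_real (1 / norm z) *s z)))
         (of_real (1 / norm (F z)) *s F z) = t))"
    if "z \<in> ball 0 1" "F z \<noteq> 0" for z
  proof -
    have z0: "z \<noteq> 0" using that F(3) by auto
    define v where "v = of_real (1 / norm z) *s z"
    define u where "u = of_real (1 / norm (F z)) *s F z"
    have v: "norm v = 1" "of_real (norm z) *s v = z" and u: "norm u = 1"
      using z0 that unfolding v_def u_def by (auto simp: norm_divide)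
    have Fz: "hinner (F z) u = norm (F z)"
      using that unfolding u_def by (simp add: hinner_self power2_eq_square)
    define g where "g t = hinner (F (t *s v)) u" for t
    have holg: "g holomorphic_on ball 0 1"
      unfolding g_def by (rule holomorphic_slice_0[OF F(1)]) (auto simp: v)
    have g0: "g 0 = 0" by (simp add: g_def F)
    have g1: "norm (g t) < 1" if "norm t < 1" for t
      using norm_hinner_le[of "F (t *s v)" u] F(2)[of "t *s v"] that
      by (simp add: v u g_def)
    have gz: "g (norm z) = norm (F z)" by (simp add: g_def v Fz)
    have "norm (complex_of_real (norm z)) < 1" using that by simp
    note S = Schwarz_Lemma[OF holg g0 g1 this]
    have "norm (F z) \<le> norm z" using S(1) gz by simp
    moreover have "g t = t" if "norm t < 1" "norm (F z) = norm z" for t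
    proof -
      have "\<exists>z. norm z < 1 \<and> z \<noteq> 0 \<and> norm (g z) = norm z"
        using gz \<open>z \<in> ball 0 1\<close> z0 that by (intro exI[of _ "complex_of_real (norm z)"]) simp
      then obtain \<alpha> where \<alpha>: "\<forall>z. norm z < 1 \<longrightarrow> g z = \<alpha> * z" using S(3) by blast
      then have "complex_of_real (norm z) = \<alpha> * norm z"
        using gz that \<open>z \<in> ball 0 1\<close> by (metis S(1) \<open>norm (complex_of_real (norm z)) < 1\<close>)
      then have "\<alpha> = 1" using z0 by simp
      then show ?thesis using \<alpha> that by simp
    qed
    ultimately show ?thesis unfolding g_def u_def v_def by blast
  qed
  have le: "norm (F z) \<le> norm z" if "z \<in> ball 0 1" for z
    using main[OF that] by (cases "F z = 0") auto
  then show "norm (F z) \<le> norm z" using z by blast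
  show "F (t *s z) = t *s F z" if eq: "norm (F z) = norm z" and t: "norm t \<le> 1"
  proof (cases "F z = 0")
    case True
    then show ?thesis using eq F(3) by simp
  next
    case False
    let ?u = "of_real (1 / norm (F z)) *s F z"
    let ?s = "t * of_real (norm z)"
    have z0: "z \<noteq> 0" using False eq by auto
    have 1: "?s *s (of_real (1 / norm z) *s z) = t *s z" using z0 by simp
    have 2: "?s *s ?u = t *s F z" using z0 eq by simp
    have "norm ?s < 1"
      using scalar_mult_in_ball[OF z t] by (simp add: norm_mult)
    then have 3: "hinner (F (t *s z)) ?u = ?s" using main[OF z False] eq 1 by metis
    have "norm (F (t *s z)) \<le> norm ?s"
      using le[OF scalar_mult_in_ball[OF z t]] by (simp add: norm_mult)
    moreover have "norm ?u = 1" using False by (simp add: norm_divide)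
    ultimately have "F (t *s z) = ?s *s ?u" using 3 by (rule hinner_eq_imp_eq)
    then show ?thesis using 2 by simp
  qed
qed

lemma homogeneous_degree_1_linear:
  fixes F :: "complex ^ 'n \<Rightarrow> complex ^ 'm"
  assumes A: "(F has_derivative (\<lambda>v. A *v v)) (at 0)"
    and h: "\<And>t::real. 0 \<le> t \<Longrightarrow> t \<le> 1 \<Longrightarrow> F (t *\<^sub>R z) = t *\<^sub>R F z"
  shows "F z = A *v z"
proof -
  have F0: "F 0 = 0" using h[of 0] by simp
  have "((\<lambda>t. t *\<^sub>R z) has_derivative (\<lambda>t. t *\<^sub>R z)) (at 0 within {0..1::real})"
    by (intro bounded_linear_imp_has_derivative bounded_linear_scaleR_left)
  moreover have "(F has_derivative (\<lambda>v. A *v v)) (at (0 *\<^sub>R z))" using A by simp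
  ultimately have "((\<lambda>t. F (t *\<^sub>R z)) has_derivative (\<lambda>t. A *v (t *\<^sub>R z))) (at 0 within {0..1::real})"
    by (rule has_derivative_compose)
  then have "((\<lambda>t. F (t *\<^sub>R z)) has_vector_derivative A *v z) (at 0 within {0..1::real})"
    unfolding has_vector_derivative_def
    by (simp add: linear_cmul[OF bounded_linear.linear[OF bounded_linear_matrix]])
  moreover have "((\<lambda>t. t *\<^sub>R F z) has_vector_derivative F z) (at 0 within {0..1::real})"
    unfolding has_vector_derivative_def
    by (intro bounded_linear_imp_has_derivative bounded_linear_scaleR_left)
  then have "((\<lambda>t. F (t *\<^sub>R z)) has_vector_derivative F z) (at 0 within {0..1::real})"
    by (rule has_vector_derivative_transform[rotated 2]) (use h in auto)
  ultimately show ?thesis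
    by (intro vector_derivative_unique_within_closed_interval[of 0 1 0]) auto
qed

section \<open>Automorphisms of the ball\<close>

lemma ball_autD:
  assumes "\<gamma> \<in> ball_aut"
  shows "holomorphic_map_on \<gamma> (ball 0 1)" "z \<in> ball 0 1 \<Longrightarrow> \<gamma> z \<in> ball 0 1"
    "\<exists>\<delta>. holomorphic_map_on \<delta> (ball 0 1) \<and> (\<forall>z\<in>ball 0 1. \<delta> z \<in> ball 0 1 \<and> \<gamma> (\<delta> z) = z \<and> \<delta> (\<gamma> z) = z)"
proof -
  have b: "bij_betw \<gamma> (ball 0 1) (ball 0 1)" and h: "holomorphic_map_on \<gamma> (ball 0 1)"
    "holomorphic_map_on (inv_into (ball 0 1) \<gamma>) (ball 0 1)"
    using assms unfolding ball_aut_def by auto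
  then show "holomorphic_map_on \<gamma> (ball 0 1)" "z \<in> ball 0 1 \<Longrightarrow> \<gamma> z \<in> ball 0 1"
    by (auto dest: bij_betwE)
  show "\<exists>\<delta>. holomorphic_map_on \<delta> (ball 0 1) \<and> (\<forall>z\<in>ball 0 1. \<delta> z \<in> ball 0 1 \<and> \<gamma> (\<delta> z) = z \<and> \<delta> (\<gamma> z) = z)"
    using h(2) bij_betw_inv_into_left[OF b] bij_betw_inv_into_right[OF b]
      bij_betwE[OF bij_betw_inv_into[OF b]] by blast
qed

lemma ball_autI:
  assumes "holomorphic_map_on \<gamma> (ball 0 1)" "holomorphic_map_on \<delta> (ball 0 1)"
    and m: "\<And>z. z \<in> ball 0 1 \<Longrightarrow> \<gamma> z \<in> ball 0 1" "\<And>z. z \<in> ball 0 1 \<Longrightarrow> \<delta> z \<in> ball 0 1"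
    and i: "\<And>z. z \<in> ball 0 1 \<Longrightarrow> \<gamma> (\<delta> z) = z" "\<And>z. z \<in> ball 0 1 \<Longrightarrow> \<delta> (\<gamma> z) = z"
  shows "restrict \<gamma> (ball 0 1) \<in> ball_aut"
proof -
  let ?g = "restrict \<gamma> (ball 0 1)"
  have b: "bij_betw ?g (ball 0 1) (ball 0 1)"
    by (rule bij_betw_byWitness[where f' = \<delta>]) (use m i in auto)
  have "inv_into (ball 0 1) ?g z = \<delta> z" if "z \<in> ball 0 1" for z
    using inv_into_f_f[OF bij_betw_imp_inj_on[OF b], of "\<delta> z"] m i that by auto
  then have "holomorphic_map_on (inv_into (ball 0 1) ?g) (ball 0 1)"
    by (intro holomorphic_map_on_cong[OF assms(2)]) auto
  moreover have "holomorphic_map_on ?g (ball 0 1)"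
    by (intro holomorphic_map_on_cong[OF assms(1)]) auto
  ultimately show ?thesis using b unfolding ball_aut_def by auto
qed

lemma ball_aut_compose:
  assumes "\<gamma> \<in> ball_aut" "\<psi> \<in> ball_aut"
  shows "restrict (\<lambda>z. \<psi> (\<gamma> z)) (ball 0 1) \<in> ball_aut"
proof -
  obtain \<delta> where \<delta>: "holomorphic_map_on \<delta> (ball 0 1)"
    "\<forall>z\<in>ball 0 1. \<delta> z \<in> ball 0 1 \<and> \<gamma> (\<delta> z) = z \<and> \<delta> (\<gamma> z) = z" using ball_autD(3)[OF assms(1)] by blast
  obtain \<eta> where \<eta>: "holomorphic_map_on \<eta> (ball 0 1)"
    "\<forall>z\<in>ball 0 1. \<eta> z \<in> ball 0 1 \<and> \<psi> (\<eta> z) = z \<and> \<eta> (\<psi> z) = z" using ball_autD(3)[OF assms(2)] by blast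
  note g = ball_autD(2)[OF assms(1)] and p = ball_autD(2)[OF assms(2)]
  have "holomorphic_map_on (\<lambda>z. \<psi> (\<gamma> z)) (ball 0 1)"
    using ball_autD(1)[OF assms(1)] ball_autD(1)[OF assms(2)] g by (rule holomorphic_map_on_compose)
  moreover have "holomorphic_map_on (\<lambda>z. \<delta> (\<eta> z)) (ball 0 1)"
    using \<eta>(1) \<delta>(1) by (rule holomorphic_map_on_compose) (use \<eta>(2) in blast)
  ultimately show ?thesis
  proof (rule ball_autI)
    fix z :: "complex ^ 'a" assume z: "z \<in> ball 0 1"
    show "\<psi> (\<gamma> z) \<in> ball 0 1" using z g p by blast
    show "\<delta> (\<eta> z) \<in> ball 0 1" using z \<delta>(2) \<eta>(2) by blast
    show "\<psi> (\<gamma> (\<delta> (\<eta> z))) = z" using z \<delta>(2) \<eta>(2) by metis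
    show "\<delta> (\<eta> (\<psi> (\<gamma> z))) = z" using z \<delta>(2) \<eta>(2) g by metis
  qed
qed

lemma unitary_ball_aut:
  assumes "unitary_matrix U" shows "linear_ball_map U \<in> ball_aut"
  unfolding linear_ball_map_def
  by (rule ball_autI[where \<delta> = "\<lambda>z. adj U *v z"])
     (use assms in \<open>auto simp: unitary_norm unitary_adj_cancel unitary_matrix_adj holomorphic_map_on_matrix\<close>)

text \<open>By the Schwarz lemma for the automorphism and for its inverse, an automorphism that fixes
  the origin preserves norms. Hence it is homogeneous of degree one, so it equals its derivative at
  the origin.\<close>

lemma ball_aut_fixing_0_unitary:
  assumes "\<gamma> \<in> ball_aut" "\<gamma> 0 = 0"
  shows "\<exists>U. unitary_matrix U \<and> (\<forall>z\<in>ball 0 1. \<gamma> z = U *v z)"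
proof -
  obtain \<delta> where \<delta>: "holomorphic_map_on \<delta> (ball 0 1)"
    "\<And>z. z \<in> ball 0 1 \<Longrightarrow> \<delta> z \<in> ball 0 1" "\<And>z. z \<in> ball 0 1 \<Longrightarrow> \<delta> (\<gamma> z) = z"
    using ball_autD(3)[OF assms(1)] by blast
  note \<gamma> = ball_autD(1,2)[OF assms(1)]
  have \<delta>0: "\<delta> 0 = 0" using \<delta>(3)[of 0] assms(2) by simp
  have n: "norm (\<gamma> z) = norm z" if "z \<in> ball 0 1" for z
    using ball_Schwarz[OF \<gamma> assms(2) that] ball_Schwarz[OF \<delta>(1,2) \<delta>0 \<gamma>(2)[OF that]] \<delta>(3)[OF that]
    by simp
  obtain A where A: "(\<gamma> has_derivative (\<lambda>v. A *v v)) (at 0)"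
    using \<gamma>(1) unfolding holomorphic_map_on_def by force
  have lin: "\<gamma> z = A *v z" if "z \<in> ball 0 1" for z
    by (rule homogeneous_degree_1_linear[OF A])
       (use ball_Schwarz_eq[OF \<gamma> assms(2) that n[OF that]] in \<open>simp add: scaleR_eq_scalar_mult\<close>)
  have "norm (A *v z) = norm z" for z
  proof -
    define s where "s = 1 / (1 + norm z)"
    have s: "s > 0" unfolding s_def by (simp add: add_pos_nonneg)
    have "norm (s *\<^sub>R z) < 1" unfolding s_def by (simp add: divide_less_eq add_pos_nonneg)
    then have "norm (A *v (s *\<^sub>R z)) = norm (s *\<^sub>R z)" using n[of "s *\<^sub>R z"] lin[of "s *\<^sub>R z"] by simp
    then show ?thesis
      using s by (simp add: linear_cmul[OF bounded_linear.linear[OF bounded_linear_matrix]])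
  qed
  then show ?thesis using lin unitaryI_norm by blast
qed

section \<open>The involutions of the ball\<close>

definition defect :: "complex ^ 'n \<Rightarrow> real"
  where "defect a = sqrt (1 - (norm a)\<^sup>2)"

text \<open>This is the usual involution exchanging the origin and the point \<open>a\<close>. On the line through
  \<open>a\<close> it is a Moebius transformation and on the orthogonal complement a multiple of
  the identity. Writing the projection onto that line with the factor \<open>1 / (1 + defect a)\<close>
  avoids a division by the norm of \<open>a\<close>, so that \<open>a = 0\<close> is not exceptional.\<close>

definition ball_invol_num :: "complex ^ 'n \<Rightarrow> complex ^ 'n \<Rightarrow> complex ^ 'n"
  where "ball_invol_num a z = a - of_real (defect a) *s z - (hinner z a / of_real (1 + defect a)) *s a"

definition ball_invol :: "complex ^ 'n \<Rightarrow> complex ^ 'n \<Rightarrow> complex ^ 'n"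
  where "ball_invol a z = inverse (1 - hinner z a) *s ball_invol_num a z"

lemma
  assumes "a \<in> ball 0 1"
  shows defect_pos: "defect a > 0"
    and defect_square: "(of_real (defect a))\<^sup>2 = 1 - hinner a a"
    and one_plus_defect_neq_0: "1 + complex_of_real (defect a) \<noteq> 0"
proof -
  have l: "(norm a)\<^sup>2 < 1" using assms by (simp add: abs_square_less_1)
  then show p: "defect a > 0" unfolding defect_def by simp
  have "(defect a)\<^sup>2 = 1 - (norm a)\<^sup>2" unfolding defect_def using l by simp
  then show "(of_real (defect a))\<^sup>2 = 1 - hinner a a"
    unfolding hinner_self by (metis of_real_1 of_real_diff of_real_power)
  have "complex_of_real (1 + defect a) \<noteq> 0" using p unfolding of_real_eq_0_iff by linarith
  then show "1 + complex_of_real (defect a) \<noteq> 0" by simp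
qed

lemma one_minus_hinner_neq_0:
  assumes "z \<in> ball 0 1" "a \<in> ball 0 1"
  shows "1 - hinner z a \<noteq> 0"
proof -
  have "norm (hinner z a) \<le> norm z * norm a" by (rule norm_hinner_le)
  also have "\<dots> \<le> norm z" using assms by (simp add: mult_left_le)
  also have "\<dots> < 1" using assms by simp
  finally show ?thesis by auto
qed

text \<open>The invariance of the Hermitian form \<open>1 - hinner z w\<close>, before division by the denominators.\<close>

lemma hinner_ball_invol_num:
  assumes "a \<in> ball 0 1"
  shows "(1 - hinner z a) * (1 - hinner a w) - hinner (ball_invol_num a z) (ball_invol_num a w) =
    (1 - hinner a a) * (1 - hinner z w)"
proof -
  define s where "s = complex_of_real (defect a)"
  define x where "x = hinner z a / (1 + s)"
  define y where "y = hinner a w / (1 + s)"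
  have s: "1 + s \<noteq> 0" "hinner a a = 1 - s\<^sup>2" "cnj s = s"
    using one_plus_defect_neq_0[OF assms] defect_square[OF assms] unfolding s_def by auto
  have xy: "hinner z a = (1 + s) * x" "hinner a w = (1 + s) * y" "cnj (hinner w a / (1 + s)) = y"
    using s unfolding x_def y_def by (auto simp: cnj_hinner)
  have "hinner (ball_invol_num a z) (ball_invol_num a w) =
      hinner a a - s * hinner a w - y * hinner a a
      - s * (hinner z a - s * hinner z w - y * hinner z a)
      - x * (hinner a a - s * hinner a w - y * hinner a a)"
    unfolding ball_invol_num_def using s(3) xy(3)
    by (simp add: s_def[symmetric] x_def[symmetric] algebra_simps)
  then show ?thesis unfolding s(2) xy(1,2) by (simp add: algebra_simps power2_eq_square)
qed

lemma hinner_ball_invol: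
  assumes "a \<in> ball 0 1" "z \<in> ball 0 1" "w \<in> ball 0 1"
  shows "1 - hinner (ball_invol a z) (ball_invol a w) =
    (1 - hinner a a) * (1 - hinner z w) / ((1 - hinner z a) * (1 - hinner a w))"
proof -
  note nz = one_minus_hinner_neq_0[OF assms(2,1)] one_minus_hinner_neq_0[OF assms(1,3)]
  have "hinner (ball_invol a z) (ball_invol a w) =
      hinner (ball_invol_num a z) (ball_invol_num a w) / ((1 - hinner z a) * (1 - hinner a w))"
    unfolding ball_invol_def by (simp add: field_simps cnj_hinner)
  then show ?thesis
    unfolding hinner_ball_invol_num[OF assms(1), of z w, symmetric] using nz
    by (simp add: diff_divide_distrib)
qed

lemma ball_invol_num_0 [simp]: "ball_invol_num a 0 = a"
  and ball_invol_0 [simp]: "ball_invol a 0 = a"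
  unfolding ball_invol_num_def ball_invol_def by simp_all

lemma ball_invol_in_ball:
  assumes a: "a \<in> ball 0 1" and z: "z \<in> ball 0 1"
  shows "ball_invol a z \<in> ball 0 1"
proof -
  have "(1 - hinner z a) * (1 - hinner a z) = of_real ((norm (1 - hinner z a))\<^sup>2)"
    by (simp only: complex_norm_square complex_cnj_diff complex_cnj_one cnj_hinner)
  then have "complex_of_real (1 - (norm (ball_invol a z))\<^sup>2) =
      of_real ((1 - (norm a)\<^sup>2) * (1 - (norm z)\<^sup>2) / (norm (1 - hinner z a))\<^sup>2)"
    using hinner_ball_invol[OF a z z] by (simp add: hinner_self)
  then have "1 - (norm (ball_invol a z))\<^sup>2 =
      (1 - (norm a)\<^sup>2) * (1 - (norm z)\<^sup>2) / (norm (1 - hinner z a))\<^sup>2"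
    unfolding of_real_eq_iff .
  also have "\<dots> > 0"
    using one_minus_hinner_neq_0[OF z a] a z by (simp add: abs_square_less_1)
  finally show ?thesis by (simp add: abs_square_less_1)
qed

lemma ball_invol_ball_invol:
  assumes a: "a \<in> ball 0 1" and z: "z \<in> ball 0 1"
  shows "ball_invol a (ball_invol a z) = z"
proof -
  define s where "s = complex_of_real (defect a)"
  define q where "q = 1 - hinner z a"
  have s: "1 + s \<noteq> 0" "s \<noteq> 0" "s\<^sup>2 = 1 - hinner a a"
    using one_plus_defect_neq_0[OF a] defect_square[OF a] defect_pos[OF a] unfolding s_def by auto
  have q: "q \<noteq> 0" using one_minus_hinner_neq_0[OF z a] unfolding q_def .
  have "1 - hinner (ball_invol a z) a = s\<^sup>2 / q"
    using hinner_ball_invol[OF a z, of 0] q s by (simp add: q_def)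
  then have h: "hinner (ball_invol a z) a = 1 - s\<^sup>2 / q" by (simp add: algebra_simps)
  have m: "ball_invol a z = inverse q *s ((1 - (1 - q) / (1 + s)) *s a - s *s z)"
    unfolding ball_invol_def ball_invol_num_def s_def q_def by (simp add: vec_eq_iff algebra_simps)
  have "ball_invol_num a (ball_invol a z) = (1 - (1 - s\<^sup>2 / q) / (1 + s)) *s a - s *s ball_invol a z"
    unfolding ball_invol_num_def h by (simp add: s_def vec_eq_iff algebra_simps)
  also have "\<dots> = (1 - (1 - s\<^sup>2 / q) / (1 + s) - s * inverse q * (1 - (1 - q) / (1 + s))) *s a
      + (s\<^sup>2 / q) *s z"
    unfolding m by (simp add: vec_eq_iff algebra_simps power2_eq_square divide_inverse)
  also have "1 - (1 - s\<^sup>2 / q) / (1 + s) - s * inverse q * (1 - (1 - q) / (1 + s)) = 0"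
    using s(1) q by (simp add: divide_simps) (simp add: algebra_simps power2_eq_square)
  finally have "ball_invol_num a (ball_invol a z) = (s\<^sup>2 / q) *s z" by simp
  then show ?thesis
    unfolding ball_invol_def[of a "ball_invol a z"] h using s(2) q by (simp add: power2_eq_square)
qed

lemma ball_invol_self: "a \<in> ball 0 1 \<Longrightarrow> ball_invol a a = 0"
  using ball_invol_ball_invol[of a 0] by simp

lemma holomorphic_ball_invol:
  assumes a: "a \<in> ball 0 1"
  shows "holomorphic_map_on (ball_invol a) (ball 0 1)"
proof (rule holomorphic_map_onI)
  fix z :: "complex ^ 'a" assume z: "z \<in> ball 0 1"
  have h: "((\<lambda>z. hinner z a) has_derivative (\<lambda>v. hinner v a)) (at z)"
    by (rule bounded_linear_imp_has_derivative[OF bounded_linear_hinner_left])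
  let ?i = "inverse (1 - hinner z a)"
  have q: "((\<lambda>z. inverse (1 - hinner z a)) has_derivative (\<lambda>v. ?i * hinner v a * ?i)) (at z)"
    using Deriv.has_derivative_inverse[OF one_minus_hinner_neq_0[OF z a]
        has_derivative_diff[OF has_derivative_const h]] by simp
  have n: "((\<lambda>z. ball_invol_num a z) has_derivative
      (\<lambda>v. - (of_real (defect a) *s v) - (hinner v a / of_real (1 + defect a)) *s a)) (at z)"
    unfolding ball_invol_num_def divide_inverse
    by (rule has_derivative_eq_rhs)
       (rule derivative_intros bounded_bilinear.FDERIV[OF bounded_bilinear_scalar_mult] h | simp)+
  have "((\<lambda>z. ball_invol a z) has_derivative (\<lambda>v. ?i *s (- (of_real (defect a) *s v)
      - (hinner v a / of_real (1 + defect a)) *s a) + (?i * hinner v a * ?i) *s ball_invol_num a z)) (at z)"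
    unfolding ball_invol_def by (rule bounded_bilinear.FDERIV[OF bounded_bilinear_scalar_mult q n])
  then show "\<exists>D. (ball_invol a has_derivative D) (at z) \<and> (\<forall>c v. D (c *s v) = c *s D v)"
    by - (intro exI conjI, assumption, simp add: vec_eq_iff algebra_simps)
qed

lemma ball_invol_ball_aut: "a \<in> ball 0 1 \<Longrightarrow> restrict (ball_invol a) (ball 0 1) \<in> ball_aut"
  by (rule ball_autI[of _ "ball_invol a"])
     (simp_all only: holomorphic_ball_invol ball_invol_ball_invol ball_invol_in_ball)

text \<open>Composing with the involution reduces to the case of an automorphism that fixes the
  origin.\<close>

lemma ball_aut_eq_unitary_ball_invol:
  assumes \<psi>: "\<psi> \<in> ball_aut" and b: "b \<in> ball 0 1" "\<psi> b = 0"
  shows "\<exists>V. unitary_matrix V \<and> (\<forall>z\<in>ball 0 1. \<psi> z = V *v ball_invol b z)"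
proof -
  let ?\<eta> = "restrict (\<lambda>z. \<psi> (restrict (ball_invol b) (ball 0 1) z)) (ball 0 1)"
  have "?\<eta> \<in> ball_aut" using ball_aut_compose[OF ball_invol_ball_aut \<psi>] b by blast
  moreover have "?\<eta> 0 = 0" using b by simp
  ultimately obtain V where V: "unitary_matrix V" "\<And>z. z \<in> ball 0 1 \<Longrightarrow> ?\<eta> z = V *v z"
    using ball_aut_fixing_0_unitary by blast
  have "\<psi> z = V *v ball_invol b z" if "z \<in> ball 0 1" for z
    using V(2)[of "ball_invol b z"] ball_invol_ball_invol[OF b(1) that] ball_invol_in_ball[OF b(1) that] that
    by simp
  then show ?thesis using V(1) by blast
qed

section \<open>Normalising a ball map at the origin\<close>

definition normalised :: "(complex ^ 'n \<Rightarrow> complex ^ 'm) \<Rightarrow> complex ^ 'n \<Rightarrow> complex ^ 'm"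
  where "normalised f z = ball_invol (f 0) (f z)"

lemma
  assumes "holomorphic_ball_map f"
  shows holomorphic_normalised: "holomorphic_map_on (normalised f) (ball 0 1)"
    and normalised_in_ball: "z \<in> ball 0 1 \<Longrightarrow> normalised f z \<in> ball 0 1"
    and normalised_0: "normalised f 0 = 0"
    and ball_invol_normalised: "z \<in> ball 0 1 \<Longrightarrow> ball_invol (f 0) (normalised f z) = f z"
proof -
  have f: "holomorphic_map_on f (ball 0 1)" "\<And>z. z \<in> ball 0 1 \<Longrightarrow> f z \<in> ball 0 1"
    using assms unfolding holomorphic_ball_map_def by blast+
  have c: "f 0 \<in> ball 0 1" using f(2)[of 0] by simp
  show "holomorphic_map_on (normalised f) (ball 0 1)"
    unfolding normalised_def
    by (rule holomorphic_map_on_compose[OF f(1) holomorphic_ball_invol[OF c] f(2)])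
  show "z \<in> ball 0 1 \<Longrightarrow> normalised f z \<in> ball 0 1"
    "z \<in> ball 0 1 \<Longrightarrow> ball_invol (f 0) (normalised f z) = f z"
    unfolding normalised_def using f(2) ball_invol_in_ball[OF c] ball_invol_ball_invol[OF c] by blast+
  show "normalised f 0 = 0" unfolding normalised_def by (rule ball_invol_self[OF c])
qed

lemma Gamma_of_normalised:
  assumes f: "holomorphic_ball_map f" and \<gamma>: "\<gamma> \<in> Gamma_of f"
  shows "\<exists>\<psi>\<in>ball_aut. \<forall>z\<in>ball 0 1. normalised f (\<gamma> z) = \<psi> (normalised f z)"
proof -
  obtain \<psi> where \<psi>: "\<psi> \<in> ball_aut" "\<And>z. z \<in> ball 0 1 \<Longrightarrow> f (\<gamma> z) = \<psi> (f z)"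
    and g: "\<gamma> \<in> ball_aut"
    using \<gamma> unfolding Gamma_of_def by blast
  have c: "f 0 \<in> ball 0 1" using f unfolding holomorphic_ball_map_def by (simp add: image_subset_iff)
  let ?m = "restrict (ball_invol (f 0)) (ball 0 1)"
  let ?\<eta> = "restrict (\<lambda>z. ?m (restrict (\<lambda>z. \<psi> (?m z)) (ball 0 1) z)) (ball 0 1)"
  have "?\<eta> \<in> ball_aut" using ball_invol_ball_aut[OF c] \<psi>(1) ball_aut_compose by blast
  moreover have "normalised f (\<gamma> z) = ?\<eta> (normalised f z)" if z: "z \<in> ball 0 1" for z
  proof -
    note n = normalised_in_ball[OF f z] ball_invol_normalised[OF f z]
    have fz: "f z \<in> ball 0 1" using f z unfolding holomorphic_ball_map_def by blast
    then have "\<psi> (f z) \<in> ball 0 1" using ball_autD(2)[OF \<psi>(1)] by blast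
    then show ?thesis
      using n fz \<psi>(2)[OF z] by (simp add: normalised_def[of f "\<gamma> z"])
  qed
  ultimately show ?thesis by blast
qed

text \<open>Unitary maps fix the origin, so the automorphism of the target that matches one of them
  fixes the value at the origin. After the normalisation it is therefore unitary.\<close>

lemma unitary_Gamma_of:
  fixes f :: "complex ^ 'n \<Rightarrow> complex ^ 'm"
  assumes f: "holomorphic_ball_map f" and U: "linear_ball_map U \<in> Gamma_of f"
  shows "\<exists>V. unitary_matrix V \<and> (\<forall>z\<in>ball 0 1. normalised f (U *v z) = V *v normalised f z)"
proof -
  obtain \<psi> where \<psi>: "\<psi> \<in> ball_aut"
    "\<And>z. z \<in> ball 0 1 \<Longrightarrow> normalised f (linear_ball_map U z) = \<psi> (normalised f z)"
    using Gamma_of_normalised[OF f U] by blast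
  have "\<psi> 0 = 0" using \<psi>(2)[of 0] normalised_0[OF f] by (simp add: linear_ball_map_def)
  then obtain V where V: "unitary_matrix V" "\<And>z. z \<in> ball 0 1 \<Longrightarrow> \<psi> z = V *v z"
    using ball_aut_fixing_0_unitary[OF \<psi>(1)] by blast
  have "normalised f (U *v z) = V *v normalised f z" if "z \<in> ball 0 1" for z
    using \<psi>(2)[OF that] V(2)[OF normalised_in_ball[OF f that]] that by (simp add: linear_ball_map_def)
  then show ?thesis using V(1) by blast
qed

lemma rotation_Gamma_of:
  fixes f :: "complex ^ 'n \<Rightarrow> complex ^ 'm"
  assumes f: "holomorphic_ball_map f" and c: "unitary_center \<subseteq> Gamma_of f"
  shows "\<exists>V. unitary_matrix V \<and> (\<forall>z\<in>ball 0 1. normalised f (cis \<theta> *s z) = V *v normalised f z)"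
proof -
  have m: "diagonal_matrix (\<chi> i. cis \<theta>) *v z = cis \<theta> *s z" for z :: "complex ^ 'n"
    by (simp add: diagonal_matrix_mult vec_eq_iff)
  then have "linear_ball_map (diagonal_matrix (\<chi> i. cis \<theta>) :: complex ^ 'n ^ 'n) \<in> unitary_center"
    unfolding unitary_center_def linear_ball_map_def by (auto simp: m intro!: exI[of _ \<theta>])
  then show ?thesis using unitary_Gamma_of[OF f] c m by (metis subsetD)
qed

lemma spherically_equivalent_unitary_normalised:
  fixes f :: "complex ^ 'n \<Rightarrow> complex ^ 'm"
  assumes f: "holomorphic_ball_map f" and V: "unitary_matrix V"
  shows "spherically_equivalent f (\<lambda>z. adj V *v normalised f z)"
proof -
  have c: "f 0 \<in> ball 0 1" using f unfolding holomorphic_ball_map_def by (simp add: image_subset_iff)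
  let ?g = "\<lambda>z. adj V *v normalised f z"
  have "holomorphic_map_on ?g (ball 0 1)"
    by (rule holomorphic_map_on_compose[OF holomorphic_normalised[OF f] holomorphic_map_on_matrix UNIV_I])
  moreover have gb: "?g z \<in> ball 0 1" if "z \<in> ball 0 1" for z
    using normalised_in_ball[OF f that] unitary_norm[OF unitary_matrix_adj[OF V]] by simp
  ultimately have "holomorphic_ball_map ?g" unfolding holomorphic_ball_map_def by blast
  moreover have "restrict (\<lambda>z. restrict (ball_invol (f 0)) (ball 0 1) (linear_ball_map V z)) (ball 0 1) \<in> ball_aut"
    (is "?\<psi> \<in> _")
    by (rule ball_aut_compose[OF unitary_ball_aut[OF V] ball_invol_ball_aut[OF c]])
  moreover have "linear_ball_map (mat 1) \<in> ball_aut"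
    by (rule unitary_ball_aut[OF unitary_matrix_one])
  moreover have "?\<psi> (?g z) = f (linear_ball_map (mat 1) z)" if z: "z \<in> ball 0 1" for z
    using z gb[OF z] ball_invol_normalised[OF f z] normalised_in_ball[OF f z]
    by (simp add: linear_ball_map_def unitary_adj_cancel[OF V])
  ultimately show ?thesis using f unfolding spherically_equivalent_def by blast
qed

section \<open>Homogeneous expansions\<close>

lemma higher_deriv_linear_combination:
  fixes g :: "'i \<Rightarrow> complex \<Rightarrow> complex"
  assumes "finite I" "open T" "x \<in> T" "\<And>i. i \<in> I \<Longrightarrow> g i holomorphic_on T"
  shows "(deriv ^^ n) (\<lambda>t. \<Sum>i\<in>I. c i * g i t) x = (\<Sum>i\<in>I. c i * (deriv ^^ n) (g i) x)"
  using assms(1,4)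
proof (induction I)
  case empty
  then show ?case by (induction n arbitrary: x) auto
next
  case (insert j I)
  have "(deriv ^^ n) (\<lambda>t. c j * g j t + (\<Sum>i\<in>I. c i * g i t)) x =
      (deriv ^^ n) (\<lambda>t. c j * g j t) x + (deriv ^^ n) (\<lambda>t. \<Sum>i\<in>I. c i * g i t) x"
    using insert assms(2,3) by (intro higher_deriv_add[of _ T]) (auto intro!: holomorphic_intros)
  moreover have "(deriv ^^ n) (\<lambda>t. c j * g j t) x = c j * (deriv ^^ n) (g j) x"
    using insert assms(2,3) by (intro higher_deriv_cmult[of _ T]) auto
  ultimately show ?case using insert by simp
qed

text \<open>The homogeneous part of degree \<open>k\<close> is the \<open>k\<close>-th Taylor coefficient on
  complex lines through the origin. It only depends on the values of the map near the origin, so for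
  a map that is holomorphic there it is homogeneous on the whole space.\<close>

definition hom_part :: "(complex ^ 'n \<Rightarrow> complex ^ 'm) \<Rightarrow> nat \<Rightarrow> complex ^ 'n \<Rightarrow> complex ^ 'm"
  where "hom_part F k z = (\<chi> i. (deriv ^^ k) (\<lambda>t. F (t *s z) $ i) 0 / fact k)"

lemma inverse_one_plus_norm: "1 / (1 + norm (z :: complex ^ 'n)) * norm z \<le> 1"
  "1 / (1 + norm z) > 0"
  by (auto simp: divide_simps add_pos_nonneg)

context
  fixes F :: "complex ^ 'n \<Rightarrow> complex ^ 'm"
  assumes hol: "holomorphic_map_on F (ball 0 1)"
begin

lemma slice_component_holomorphic:
  assumes "r * norm z \<le> 1" shows "(\<lambda>t. F (t *s z) $ i) holomorphic_on ball 0 r"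
proof -
  have "t *s z \<in> ball 0 1" if "t \<in> ball 0 r" for t
  proof (cases "z = 0")
    case False
    then have "norm t * norm z < r * norm z" using that by simp
    then show ?thesis using assms by simp
  qed simp
  then have "(\<lambda>t. hinner (F (t *s z)) (axis i 1)) holomorphic_on ball 0 r"
    by (intro holomorphic_slice_0[OF hol]) auto
  then show ?thesis by simp
qed

lemma hom_part_sums:
  assumes "z \<in> ball 0 1" shows "(\<lambda>k. hom_part F k z $ i) sums (F z $ i)"
proof -
  define r where "r = 2 / (1 + norm z)"
  have r: "r * norm z \<le> 1" "1 < r"
    using assms unfolding r_def by (auto simp: divide_simps add_pos_nonneg)
  have "(1::complex) \<in> ball 0 r" using r by simp
  from holomorphic_power_series[OF slice_component_holomorphic[OF r(1), of i] this]
  show ?thesis unfolding hom_part_def by simp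
qed

lemma hom_part_homogeneous: "hom_part F k (c *s z) = c ^ k *s hom_part F k z"
proof -
  let ?r = "1 / (1 + norm z)" and ?s = "1 / ((1 + norm z) * (1 + norm c))"
  have s: "?s > 0" by (simp add: add_pos_nonneg)
  have "(deriv ^^ k) (\<lambda>t. F ((c * t) *s z) $ i) 0 = c ^ k * (deriv ^^ k) (\<lambda>t. F (t *s z) $ i) (c * 0)" for i
  proof (rule higher_deriv_compose_linear[where S = "ball 0 ?s" and T = "ball 0 ?r"])
    show "(\<lambda>t. F (t *s z) $ i) holomorphic_on ball 0 ?r"
      by (rule slice_component_holomorphic[OF inverse_one_plus_norm(1)])
    fix t assume t: "t \<in> ball (0::complex) ?s"
    have "norm (c * t) \<le> norm c * ?s" using mult_left_mono[of "norm t" ?s "norm c"] t by (simp add: norm_mult)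
    also have "\<dots> < (1 + norm c) * ?s" using s by (intro mult_strict_right_mono) auto
    also have "\<dots> = ?r" using add_pos_nonneg[of 1 "norm c"] by (simp add: divide_simps)
    finally show "c * t \<in> ball 0 ?r" by simp
  qed (use s in auto)
  then show ?thesis unfolding hom_part_def by (simp add: vec_eq_iff mult.commute)
qed

lemma hom_part_unitary:
  assumes V: "\<And>z. z \<in> ball 0 1 \<Longrightarrow> F (c *s z) = V *v F z"
  shows "V *v hom_part F k z = c ^ k *s hom_part F k z"
proof -
  let ?r = "1 / (1 + norm z)"
  note h = slice_component_holomorphic[OF inverse_one_plus_norm(1)]
  have "(V *v hom_part F k z) $ i = hom_part F k (c *s z) $ i" for i
  proof -
    have "(V *v hom_part F k z) $ i = (\<Sum>j\<in>UNIV. V $ i $ j * (deriv ^^ k) (\<lambda>t. F (t *s z) $ j) 0) / fact k"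
      unfolding hom_part_def matrix_vector_mult_def by (simp add: sum_divide_distrib)
    also have "(\<Sum>j\<in>UNIV. V $ i $ j * (deriv ^^ k) (\<lambda>t. F (t *s z) $ j) 0) =
        (deriv ^^ k) (\<lambda>t. \<Sum>j\<in>UNIV. V $ i $ j * F (t *s z) $ j) 0"
      by (rule higher_deriv_linear_combination[symmetric, of _ "ball 0 ?r"])
         (use h inverse_one_plus_norm(2) in auto)
    also have "\<dots> = (deriv ^^ k) (\<lambda>t. F (t *s (c *s z)) $ i) 0"
    proof (rule higher_deriv_transform_within_open[of _ "ball 0 ?r"])
      show "(\<lambda>t. \<Sum>j\<in>UNIV. V $ i $ j * F (t *s z) $ j) holomorphic_on ball 0 ?r"
        by (intro holomorphic_intros h)
      have e: "(\<Sum>j\<in>UNIV. V $ i $ j * F (t *s z) $ j) = F (t *s (c *s z)) $ i" if "t \<in> ball 0 ?r" for t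
      proof -
        have "norm t * norm z \<le> norm t * (1 + norm z)" by (simp add: mult_left_mono)
        also have "\<dots> < 1" using that by (simp add: pos_less_divide_eq add_pos_nonneg)
        finally have "F (c *s (t *s z)) = V *v F (t *s z)" by (intro V) simp
        moreover have "c *s (t *s z) = t *s (c *s z)" by (simp add: mult.commute)
        ultimately show ?thesis by (simp add: matrix_vector_mult_def mult.commute[of t c])
      qed
      show "\<And>t. t \<in> ball 0 ?r \<Longrightarrow> (\<Sum>j\<in>UNIV. V $ i $ j * F (t *s z) $ j) = F (t *s (c *s z)) $ i"
        by (rule e)
      have "(\<lambda>t. F (t *s (c *s z)) $ i) holomorphic_on ball 0 ?r"
        by (rule holomorphic_transform[OF _ e]) (intro holomorphic_intros h)
      then show "(\<lambda>t. F (t *s (c *s z)) $ i) holomorphic_on ball 0 ?r" .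
    qed (use inverse_one_plus_norm(2) in auto)
    finally show ?thesis unfolding hom_part_def by simp
  qed
  then show ?thesis by (simp add: vec_eq_iff[of "V *v _"] hom_part_homogeneous)
qed

end

text \<open>Dilating by one half separates the degrees, so the summands of a holomorphic finite sum of
  homogeneous maps are holomorphic.\<close>

lemma homogeneous_summands_holomorphic:
  fixes a :: "nat \<Rightarrow> complex ^ 'n \<Rightarrow> complex ^ 'm"
  assumes "finite J" "holomorphic_map_on (\<lambda>z. \<Sum>j\<in>J. a j z) (ball 0 1)"
    "\<And>j c z. j \<in> J \<Longrightarrow> a j (c *s z) = c ^ j *s a j z" "k \<in> J"
  shows "holomorphic_map_on (a k) (ball 0 1)"
  using assms
proof (induction J arbitrary: a k)
  case empty
  then show ?case by simp
next
  case (insert m J)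
  let ?G = "\<lambda>z. \<Sum>j\<in>insert m J. a j z"
  let ?h = "1 / 2 :: complex"
  have "holomorphic_map_on (\<lambda>z. mat ?h *v z :: complex ^ 'n) (ball 0 1)" by (rule holomorphic_map_on_matrix)
  moreover have m: "mat ?h *v z = ?h *s z" for z :: "complex ^ 'n"
    by (simp add: vec_eq_iff matrix_vector_mult_def mat_def if_distrib if_distribR cong: if_cong)
  ultimately have "holomorphic_map_on (\<lambda>z. ?h *s z :: complex ^ 'n) (ball 0 1)" by simp
  from holomorphic_map_on_compose[OF this insert(4)]
  have "holomorphic_map_on (\<lambda>z. ?G (?h *s z)) (ball 0 1)" using scalar_mult_in_ball by force
  from holomorphic_map_on_sum[of "UNIV :: bool set" "\<lambda>b. if b then (\<lambda>z. ?G (?h *s z)) else ?G" "ball 0 1"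
      "\<lambda>b. if b then 1 else - (?h ^ m)"] this insert(4)
  have "holomorphic_map_on (\<lambda>z. ?G (?h *s z) - ?h ^ m *s ?G z) (ball 0 1)"
    by (simp add: UNIV_bool add.commute)
  moreover have "?G (?h *s z) - ?h ^ m *s ?G z = (\<Sum>j\<in>J. (?h ^ j - ?h ^ m) *s a j z)" for z
  proof -
    have "?G (?h *s z) = (\<Sum>j\<in>insert m J. ?h ^ j *s a j z)"
      by (intro sum.cong refl insert(5))
    moreover have "?h ^ m *s ?G z = (\<Sum>j\<in>insert m J. ?h ^ m *s a j z)"
      by (simp add: vec_eq_iff sum_distrib_left)
    ultimately have "?G (?h *s z) - ?h ^ m *s ?G z = (\<Sum>j\<in>insert m J. (?h ^ j - ?h ^ m) *s a j z)"
      by (simp add: vec_eq_iff sum_subtractf[symmetric] left_diff_distrib)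
    then show ?thesis using insert(1,2) by simp
  qed
  ultimately have hJ: "holomorphic_map_on (\<lambda>z. \<Sum>j\<in>J. (?h ^ j - ?h ^ m) *s a j z) (ball 0 1)" by simp
  have rest: "holomorphic_map_on (a j) (ball 0 1)" if j: "j \<in> J" for j
  proof -
    have "j \<noteq> m" using j insert(2) by blast
    define e where "e = ?h ^ j - ?h ^ m"
    have "e \<noteq> 0"
    proof
      assume "e = 0"
      then have "norm (?h ^ j) = norm (?h ^ m)" unfolding e_def by simp
      then have "(1/2::real) ^ j = (1/2) ^ m" by (simp add: norm_power)
      then show False using \<open>j \<noteq> m\<close> power_inject_exp'[of "1/2::real" j m] by simp
    qed
    have "holomorphic_map_on (\<lambda>z. e *s a j z) (ball 0 1)"
      unfolding e_def by (rule insert(3)[OF hJ _ j]) (simp add: insert(5) vec_eq_iff algebra_simps)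
    from holomorphic_map_on_sum[of "{()}" "\<lambda>_. \<lambda>z. e *s a j z" _ "\<lambda>_. inverse e", OF this]
    show ?thesis using \<open>e \<noteq> 0\<close> by simp
  qed
  show ?case
  proof (cases "k = m")
    case True
    let ?f = "\<lambda>j. if j = m then ?G else a j"
    have "holomorphic_map_on (\<lambda>z. \<Sum>j\<in>insert m J. (if j = m then 1 else -1) *s ?f j z) (ball 0 1)"
      by (rule holomorphic_map_on_sum) (use insert(4) rest in auto)
    moreover have "(\<Sum>j\<in>insert m J. (if j = m then 1 else -1) *s ?f j z) = a m z" for z
    proof -
      have "(\<Sum>j\<in>J. (if j = m then 1 else -1) *s ?f j z) = (\<Sum>j\<in>J. - a j z)"
        by (rule sum.cong) (use insert(2) in auto)
      then show ?thesis using insert(1,2) by (simp add: sum_negf)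
    qed
    ultimately show ?thesis using True by simp
  next
    case False
    then show ?thesis using rest insert(6) by blast
  qed
qed

text \<open>If rotations of the source act through unitary maps of the target, then the values of the
  homogeneous part of degree \<open>k\<close> are eigenvectors of each of these unitary maps, with
  eigenvalue \<open>cis \<theta> ^ k\<close>. Parts of different degrees are therefore orthogonal, so only
  finitely many of them do not vanish.\<close>

theorem rotation_equivariant_expansion:
  fixes F :: "complex ^ 'n \<Rightarrow> complex ^ 'm"
  assumes hol: "holomorphic_map_on F (ball 0 1)" and ball: "\<And>z. z \<in> ball 0 1 \<Longrightarrow> F z \<in> ball 0 1"
    and rot: "\<And>\<theta>. \<exists>V. unitary_matrix V \<and> (\<forall>z\<in>ball 0 1. F (cis \<theta> *s z) = V *v F z)"
  obtains d a where
    "\<And>k c z. a k (c *s z) = c ^ k *s a k z"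
    "\<And>k. holomorphic_map_on (a k) UNIV"
    "\<And>k z. norm (a k z) \<le> (1 + norm z) ^ k"
    "\<And>k z. z \<in> ball 0 1 \<Longrightarrow> a k z \<in> ball 0 1"
    "\<And>j k z w. j \<noteq> k \<Longrightarrow> hinner (a j z) (a k w) = 0"
    "\<And>z. z \<in> ball 0 1 \<Longrightarrow> F z = (\<Sum>k\<le>d. a k z)"
proof -
  define a where "a = hom_part F"
  have hom: "a k (c *s z) = c ^ k *s a k z" for k c z
    unfolding a_def by (rule hom_part_homogeneous[OF hol])
  have orth: "hinner (a j z) (a k w) = 0" if "j \<noteq> k" for j k z w
  proof -
    \<comment> \<open>the angle for which the eigenvalues in the two degrees are negatives of each other\<close>
    define \<theta> where "\<theta> = pi / (real j - real k)"
    obtain V where V: "unitary_matrix V" "\<And>z. z \<in> ball 0 1 \<Longrightarrow> F (cis \<theta> *s z) = V *v F z"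
      using rot by blast
    have "hinner (a j z) (a k w) = hinner (V *v a j z) (V *v a k w)"
      by (simp add: unitary_hinner[OF V(1)])
    also have "\<dots> = cis \<theta> ^ j * cnj (cis \<theta> ^ k) * hinner (a j z) (a k w)"
      unfolding a_def by (simp only: hom_part_unitary[OF hol V(2)] hinner_linear) (simp only: mult_ac)
    also have "cis \<theta> ^ j * cnj (cis \<theta> ^ k) = cis (real j * \<theta> - real k * \<theta>)"
      by (simp add: Complex.DeMoivre cis_cnj cis_mult)
    also have "real j * \<theta> - real k * \<theta> = pi"
      using that unfolding left_diff_distrib[symmetric] \<theta>_def by simp
    finally show ?thesis by simp
  qed
  have "finite {k. \<exists>z. a k z \<noteq> 0}" (is "finite ?K")
  proof -
    have "\<forall>k\<in>?K. \<exists>z. a k z \<noteq> 0" by blast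
    then obtain y where y: "\<And>k. k \<in> ?K \<Longrightarrow> a k (y k) \<noteq> 0" by metis
    define b where "b k = a k (y k)" for k
    have b: "b j \<bullet> b k = 0" if "j \<noteq> k" for j k
      using orth[OF that, of "y j" "y k"] unfolding b_def by (metis Re_hinner zero_complex.simps(1))
    then have "pairwise orthogonal (b ` ?K)"
      by (auto simp: pairwise_def orthogonal_def) (metis b)
    moreover have "inj_on b ?K"
    proof (rule inj_onI)
      fix j k assume jk: "j \<in> ?K" "k \<in> ?K" "b j = b k"
      show "j = k"
      proof (rule ccontr)
        assume "j \<noteq> k"
        then have "b j = 0" using b[of j k] jk(3) by simp
        then show False using y[OF jk(1)] unfolding b_def by simp
      qed
    qed
    ultimately show ?thesis using pairwise_orthogonal_imp_finite finite_imageD by blast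
  qed
  then obtain d where "\<forall>k\<in>?K. k \<le> d" using finite_nat_set_iff_bounded_le by blast
  then have d: "a k z = 0" if "k > d" for k z using that by fastforce
  have sum: "F z = (\<Sum>k\<le>d. a k z)" if z: "z \<in> ball 0 1" for z
  proof -
    have "F z $ i = (\<Sum>k\<le>d. a k z $ i)" for i
    proof (rule sums_unique2)
      show "(\<lambda>k. a k z $ i) sums (F z $ i)" unfolding a_def by (rule hom_part_sums[OF hol z])
      show "(\<lambda>k. a k z $ i) sums (\<Sum>k\<le>d. a k z $ i)"
        by (rule sums_finite) (use d in auto)
    qed
    then show ?thesis by (simp add: vec_eq_iff)
  qed
  have one: "of_real (1 / (1 + norm z)) *s z \<in> ball 0 1" for z :: "complex ^ 'n"
  proof -
    have "norm z < 1 + norm z" by simp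
    then have "1 / (1 + norm z) * norm z < 1" by (simp add: divide_less_eq_1 add_pos_nonneg)
    moreover have "norm (complex_of_real (1 / (1 + norm z))) = 1 / (1 + norm z)"
      unfolding norm_of_real using inverse_one_plus_norm(2)[of z] by (simp only: abs_of_pos)
    ultimately show ?thesis by (simp only: mem_ball dist_0_norm norm_scalar_mult)
  qed
  have rescale: "a k z = of_real (1 + norm z) ^ k *s a k (of_real (1 / (1 + norm z)) *s z)" for k z
  proof -
    have "complex_of_real (1 + norm z) \<noteq> 0" unfolding of_real_eq_0_iff using add_pos_nonneg[of 1 "norm z"] by simp
    then show ?thesis by (simp add: hom power_divide)
  qed
  have hball: "holomorphic_map_on (a k) (ball 0 1)" for k
  proof (cases "k \<le> d")
    case True
    have "holomorphic_map_on (\<lambda>z. \<Sum>j\<in>{..d}. a j z) (ball 0 1)"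
      by (rule holomorphic_map_on_cong[OF hol]) (use sum in auto)
    then show ?thesis
      by (rule homogeneous_summands_holomorphic[rotated]) (use hom True in auto)
  next
    case False
    have "holomorphic_map_on (\<lambda>z. (0 :: complex ^ 'n ^ 'm) *v z) (ball 0 1)" by (rule holomorphic_map_on_matrix)
    then show ?thesis by (rule holomorphic_map_on_cong) (use d False in auto)
  qed
  have hUNIV: "holomorphic_map_on (a k) UNIV" for k
    unfolding holomorphic_map_on_def
  proof
    fix z :: "complex ^ 'n"
    define c where "c = complex_of_real (1 / (1 + norm z))"
    have "holomorphic_map_on (\<lambda>z. mat (inverse c ^ k) *v a k (mat c *v z)) {z}"
      by (intro holomorphic_map_on_compose[OF _ holomorphic_map_on_matrix UNIV_I]
          holomorphic_map_on_compose[OF holomorphic_map_on_matrix hball])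
         (use one[of z] in \<open>simp add: c_def mat_def matrix_vector_mult_def if_distrib if_distribR
            vector_scalar_mult_def cong: if_cong\<close>)
    moreover have "mat (inverse c ^ k) *v a k (mat c *v w) = a k w" for w
    proof -
      have m: "mat e *v v = e *s v" for e :: complex and v :: "complex ^ 'r"
        by (simp add: vec_eq_iff matrix_vector_mult_def mat_def if_distrib if_distribR cong: if_cong)
      have "c \<noteq> 0" unfolding c_def of_real_eq_0_iff using inverse_one_plus_norm(2)[of z] by simp
      then show ?thesis unfolding m hom by (simp add: power_inverse)
    qed
    ultimately show "\<exists>A. (a k has_derivative (\<lambda>v. A *v v)) (at z)"
      unfolding holomorphic_map_on_def by simp
  qed
  have small: "norm (a k z) < 1" if z: "z \<in> ball 0 1" for k z
  proof (cases "k \<le> d")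
    case True
    have "hinner (F z) (a k z) = hinner (a k z) (a k z)"
      unfolding sum[OF z] hinner_sum_left using True
      by (subst sum.remove[of _ k]) (auto simp: orth intro!: sum.neutral)
    then have "norm (a k z) * norm (a k z) = norm (hinner (F z) (a k z))"
      by (simp add: hinner_self norm_mult power2_eq_square)
    also have "\<dots> \<le> norm (F z) * norm (a k z)" by (rule norm_hinner_le)
    finally have "norm (a k z) \<le> norm (F z)" by (cases "a k z = 0") (auto simp: mult_le_cancel_right)
    then show ?thesis using ball[OF z] by simp
  qed (simp add: d)
  have bound: "norm (a k z) \<le> (1 + norm z) ^ k" for k z
  proof -
    have "norm (a k z) = norm (complex_of_real (1 + norm z)) ^ k * norm (a k (of_real (1 / (1 + norm z)) *s z))"
      by (subst rescale) (simp only: norm_scalar_mult norm_power)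
    also have "norm (complex_of_real (1 + norm z)) = 1 + norm z" by (simp only: norm_of_real abs_of_nonneg add_nonneg_nonneg norm_ge_zero zero_le_one)
    also have "(1 + norm z) ^ k * norm (a k (of_real (1 / (1 + norm z)) *s z)) \<le> (1 + norm z) ^ k"
      using less_imp_le[OF small[OF one[of z], of k]] by (intro mult_left_le) auto
    finally show ?thesis .
  qed
  show thesis by (rule that[OF hom hUNIV bound _ orth sum]) (use small in auto)
qed

section \<open>Polynomials in several variables\<close>

lemma monomial_mult: "monomial \<alpha> z * monomial \<beta> z = monomial (\<lambda>i. \<alpha> i + \<beta> i) z"
  unfolding monomial_def by (simp add: prod.distrib power_add)

lemma monomial_zero [simp]: "monomial (\<lambda>_. 0) z = 1"
  unfolding monomial_def by simp

lemma monomial_coordinate: "monomial (\<lambda>j. if j = i then 1 else 0) z = z $ i"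
proof -
  have "monomial (\<lambda>j. if j = i then 1 else 0) z = (\<Prod>j\<in>UNIV. if j = i then z $ j else 1)"
    unfolding monomial_def by (intro prod.cong) auto
  then show ?thesis by simp
qed

lemma monomial_componentwise_mult: "monomial \<alpha> (\<chi> i. w $ i * z $ i) = monomial \<alpha> w * monomial \<alpha> z"
  unfolding monomial_def by (simp add: prod.distrib power_mult_distrib)

definition multi_poly_function :: "(complex ^ 'n \<Rightarrow> complex) \<Rightarrow> bool"
  where "multi_poly_function g \<longleftrightarrow>
    (\<exists>A c. finite A \<and> (\<forall>z. g z = (\<Sum>\<alpha>\<in>A. c \<alpha> * monomial \<alpha> z)))"

lemma multi_poly_function_monomial_mult:
  assumes "multi_poly_function g"
  shows "multi_poly_function (\<lambda>z. k * monomial \<beta> z * g z)"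
proof -
  obtain A c where A: "finite A" "\<And>z. g z = (\<Sum>\<alpha>\<in>A. c \<alpha> * monomial \<alpha> z)"
    using assms unfolding multi_poly_function_def by blast
  let ?s = "\<lambda>\<alpha> i. \<beta> i + \<alpha> i" and ?c = "\<lambda>\<gamma>. k * c (\<lambda>i. \<gamma> i - \<beta> i)"
  have inj: "inj_on ?s A" by (auto simp: inj_on_def fun_eq_iff)
  have "k * monomial \<beta> z * g z = (\<Sum>\<gamma>\<in>?s ` A. ?c \<gamma> * monomial \<gamma> z)" for z
    unfolding sum.reindex[OF inj] A(2) sum_distrib_left
    by (intro sum.cong refl) (simp add: monomial_mult[symmetric])
  then show ?thesis using A(1) unfolding multi_poly_function_def
    by (intro exI[of _ "?s ` A"] exI[of _ ?c]) auto
qed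

lemma multi_poly_function_add:
  assumes "multi_poly_function f" "multi_poly_function g"
  shows "multi_poly_function (\<lambda>z. f z + g z)"
proof -
  obtain A c where A: "finite A" "\<And>z. f z = (\<Sum>\<alpha>\<in>A. c \<alpha> * monomial \<alpha> z)"
    using assms(1) unfolding multi_poly_function_def by blast
  obtain B d where B: "finite B" "\<And>z. g z = (\<Sum>\<alpha>\<in>B. d \<alpha> * monomial \<alpha> z)"
    using assms(2) unfolding multi_poly_function_def by blast
  let ?e = "\<lambda>\<alpha>. (if \<alpha> \<in> A then c \<alpha> else 0) + (if \<alpha> \<in> B then d \<alpha> else 0)"
  have "f z + g z = (\<Sum>\<alpha>\<in>A \<union> B. ?e \<alpha> * monomial \<alpha> z)" for z
  proof -
    have "f z = (\<Sum>\<alpha>\<in>A \<union> B. (if \<alpha> \<in> A then c \<alpha> else 0) * monomial \<alpha> z)"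
      unfolding A(2) using A(1) B(1) by (intro sum.mono_neutral_cong_left) auto
    moreover have "g z = (\<Sum>\<alpha>\<in>A \<union> B. (if \<alpha> \<in> B then d \<alpha> else 0) * monomial \<alpha> z)"
      unfolding B(2) using A(1) B(1) by (intro sum.mono_neutral_cong_left) auto
    ultimately show ?thesis by (simp add: sum.distrib distrib_right)
  qed
  then show ?thesis using A(1) B(1) unfolding multi_poly_function_def
    by (intro exI[of _ "A \<union> B"] exI[of _ ?e]) simp
qed

lemma multi_poly_function_const: "multi_poly_function (\<lambda>_. k)"
  unfolding multi_poly_function_def
  by (intro exI[of _ "{\<lambda>_. 0}"] exI[of _ "\<lambda>_. k"]) simp

lemma multi_poly_function_sum:
  assumes "\<And>i. i \<in> I \<Longrightarrow> multi_poly_function (g i)"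
  shows "multi_poly_function (\<lambda>z. \<Sum>i\<in>I. g i z)"
  using assms
  by (induction I rule: infinite_finite_induct)
     (auto intro: multi_poly_function_const multi_poly_function_add)

lemma multi_poly_function_mult:
  assumes "multi_poly_function f" "multi_poly_function g"
  shows "multi_poly_function (\<lambda>z. f z * g z)"
proof -
  obtain A c where A: "\<And>z. f z = (\<Sum>\<alpha>\<in>A. c \<alpha> * monomial \<alpha> z)"
    using assms(1) unfolding multi_poly_function_def by blast
  have "multi_poly_function (\<lambda>z. \<Sum>\<alpha>\<in>A. c \<alpha> * monomial \<alpha> z * g z)"
    by (intro multi_poly_function_sum multi_poly_function_monomial_mult assms(2))
  then show ?thesis by (simp add: A sum_distrib_right)
qed

lemma multi_poly_function_coordinate: "multi_poly_function (\<lambda>z. z $ i)"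
  using multi_poly_function_monomial_mult[OF multi_poly_function_const[of 1], of 1 "\<lambda>j. if j = i then 1 else 0"]
  unfolding monomial_coordinate by simp

lemma multi_poly_function_prod:
  assumes "\<And>i. i \<in> I \<Longrightarrow> multi_poly_function (g i)"
  shows "multi_poly_function (\<lambda>z. \<Prod>i\<in>I. g i z)"
  using assms
  by (induction I rule: infinite_finite_induct)
     (auto intro: multi_poly_function_const multi_poly_function_mult)

definition lagrange_basis :: "nat \<Rightarrow> nat \<Rightarrow> complex \<Rightarrow> complex"
  where "lagrange_basis d l x = (\<Prod>m\<in>{..d} - {l}. (x - of_nat m) / (of_nat l - of_nat m))"

lemma lagrange_interpolation:
  fixes p :: "complex poly"
  assumes "degree p \<le> d"
  shows "poly p x = (\<Sum>l\<le>d. poly p (of_nat l) * lagrange_basis d l x)"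
proof -
  define L where "L l = (\<Prod>m\<in>{..d} - {l}. smult (1 / (of_nat l - of_nat m)) [:- of_nat m, 1:] :: complex poly)" for l
  have L: "poly (L l) x = lagrange_basis d l x" for l x
    unfolding L_def lagrange_basis_def by (simp add: poly_prod diff_divide_distrib)
  have dL: "degree (L l) \<le> d" if "l \<le> d" for l
  proof -
    have "degree (L l) \<le> (\<Sum>m\<in>{..d} - {l}. degree (smult (1 / (of_nat l - of_nat m)) [:- of_nat m, 1:] :: complex poly))"
      unfolding L_def by (rule order.trans[OF degree_prod_sum_le]) auto
    also have "\<dots> \<le> (\<Sum>m\<in>{..d} - {l}. 1)" by (intro sum_mono) (simp add: degree_smult_eq)
    also have "\<dots> = d" using that by simp
    finally show ?thesis .
  qed
  define q where "q = p - (\<Sum>l\<le>d. smult (poly p (of_nat l)) (L l))"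
  have "degree q \<le> d" unfolding q_def
    using assms dL by (intro degree_diff_le degree_sum_le) (auto intro: order.trans[OF degree_smult_le])
  have q0: "poly q (of_nat k) = 0" if k: "k \<le> d" for k
  proof -
    have "poly (L l) (of_nat k) = (if l = k then 1 else 0)" if l: "l \<le> d" for l
    proof (cases "l = k")
      case False
      then have "\<exists>m\<in>{..d} - {l}. (of_nat k - of_nat m) / (of_nat l - of_nat m) = (0::complex)"
        using k by (intro bexI[of _ k]) auto
      then show ?thesis unfolding L lagrange_basis_def using False by (simp add: prod_zero_iff)
    next
      case True
      then show ?thesis unfolding L lagrange_basis_def by (auto intro!: prod.neutral)
    qed
    then have "(\<Sum>l\<le>d. poly p (of_nat l) * poly (L l) (of_nat k)) = (\<Sum>l\<le>d. if l = k then poly p (of_nat l) else 0)"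
      by (intro sum.cong) auto
    then show ?thesis using k unfolding q_def by (simp add: poly_sum)
  qed
  have "q = 0"
  proof (rule ccontr)
    assume "q \<noteq> 0"
    have "of_nat ` {..d} \<subseteq> {x::complex. poly q x = 0}" using q0 by auto
    then have "card (of_nat ` {..d} :: complex set) \<le> card {x. poly q x = 0}"
      using poly_roots_finite[OF \<open>q \<noteq> 0\<close>] card_mono by blast
    also have "\<dots> \<le> degree q" using card_poly_roots_bound[OF \<open>q \<noteq> 0\<close>] .
    finally show False using \<open>degree q \<le> d\<close> by (simp add: card_image inj_on_def)
  qed
  then have "p = (\<Sum>l\<le>d. smult (poly p (of_nat l)) (L l))" unfolding q_def by simp
  then have "poly p x = poly (\<Sum>l\<le>d. smult (poly p (of_nat l)) (L l)) x" by simp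
  then show ?thesis by (simp add: poly_sum L)
qed

lemma norm_axis_le: "norm (z + t *s axis i 1 :: complex ^ 'n) \<le> norm z + norm t"
  using norm_triangle_ineq[of z "t *s axis i 1"] by (simp add: norm_axis_1)

text \<open>Liouville: an entire function of polynomial growth is a polynomial in each variable
  separately. Lagrange interpolation at the same nodes in every variable then writes it as a
  combination of products of one-variable polynomials, with values of the function as
  coefficients.\<close>

theorem polynomial_growth_imp_polynomial:
  fixes g :: "complex ^ 'n \<Rightarrow> complex"
  assumes hol: "\<And>z i. (\<lambda>t. g (z + t *s axis i 1)) holomorphic_on UNIV"
    and growth: "\<And>z. norm (g z) \<le> C * (1 + norm z) ^ d"
  shows "multi_poly_function g"
proof -
  have slice: "g (\<chi> j. if j = i then x else z $ j) =
      (\<Sum>l\<le>d. g (\<chi> j. if j = i then of_nat l else z $ j) * lagrange_basis d l x)" for z i x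
  proof -
    define z0 where "z0 = (\<chi> j. if j = i then 0 else z $ j)"
    have z0: "z0 + t *s axis i 1 = (\<chi> j. if j = i then t else z $ j)" for t
      unfolding z0_def by (simp add: vec_eq_iff axis_def)
    have "C \<ge> 0" using order.trans[OF norm_ge_zero growth[of 0]] by simp
    have "norm (g (z0 + t *s axis i 1)) \<le> (C * (2 + norm z0) ^ d) * norm t ^ d" if "1 \<le> norm t" for t
    proof -
      have "1 + norm (z0 + t *s axis i 1) \<le> 1 + norm z0 + norm t" using norm_axis_le[of z0 t i] by simp
      also have "\<dots> \<le> (2 + norm z0) * norm t"
        using that mult_left_mono[OF that, of "1 + norm z0"] by (simp add: algebra_simps)
      finally have "(1 + norm (z0 + t *s axis i 1)) ^ d \<le> ((2 + norm z0) * norm t) ^ d"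
        by (intro power_mono) auto
      then have "C * (1 + norm (z0 + t *s axis i 1)) ^ d \<le> C * ((2 + norm z0) * norm t) ^ d"
        using \<open>C \<ge> 0\<close> by (intro mult_left_mono) auto
      then show ?thesis using growth[of "z0 + t *s axis i 1"] by (simp add: power_mult_distrib mult.assoc)
    qed
    note Liouville_polynomial[OF hol[of z0 i] this]
    then have L: "g (z0 + t *s axis i 1) =
        (\<Sum>k\<le>d. (deriv ^^ k) (\<lambda>t. g (z0 + t *s axis i 1)) 0 / fact k * t ^ k)" for t .
    define p where "p = (\<Sum>k\<le>d. monom ((deriv ^^ k) (\<lambda>t. g (z0 + t *s axis i 1)) 0 / fact k) k)"
    have p: "poly p t = g (z0 + t *s axis i 1)" for t
      unfolding p_def L[of t] by (simp add: poly_sum poly_monom)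
    have "degree p \<le> d" unfolding p_def
      by (intro degree_sum_le) (auto intro: order.trans[OF degree_monom_le])
    from lagrange_interpolation[OF this, of x] show ?thesis unfolding p z0 .
  qed
  have "multi_poly_function (\<lambda>z. g (\<chi> j. if j \<in> S then z $ j else w $ j))" for S w
    using finite[of S]
  proof (induction S arbitrary: w)
    case empty
    then show ?case by (simp add: multi_poly_function_const)
  next
    case (insert i S)
    have "(\<lambda>z. g (\<chi> j. if j \<in> insert i S then z $ j else w $ j)) =
      (\<lambda>z. \<Sum>l\<le>d. g (\<chi> j. if j \<in> S then z $ j else (\<chi> j. if j = i then of_nat l else w $ j) $ j) *
         lagrange_basis d l (z $ i))"
    proof
      fix z :: "complex ^ 'n"
      define y where "y = (\<chi> j. if j \<in> S then z $ j else w $ j)"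
      have "(\<chi> j. if j \<in> insert i S then z $ j else w $ j) = (\<chi> j. if j = i then z $ i else y $ j)"
        unfolding y_def by (auto simp: vec_eq_iff)
      moreover have "(\<chi> j. if j \<in> S then z $ j else (\<chi> j. if j = i then of_nat l else w $ j) $ j) =
          (\<chi> j. if j = i then of_nat l else y $ j)" for l
        unfolding y_def using insert(2) by (auto simp: vec_eq_iff)
      ultimately show "g (\<chi> j. if j \<in> insert i S then z $ j else w $ j) =
        (\<Sum>l\<le>d. g (\<chi> j. if j \<in> S then z $ j else (\<chi> j. if j = i then of_nat l else w $ j) $ j) *
         lagrange_basis d l (z $ i))"
        using slice[of i "z $ i" y] by simp
    qed
    moreover have "multi_poly_function (\<lambda>z. lagrange_basis d l (z $ i))" for l
      unfolding lagrange_basis_def divide_inverse diff_conv_add_uminus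
      by (intro multi_poly_function_prod multi_poly_function_mult multi_poly_function_add
          multi_poly_function_const multi_poly_function_coordinate)
    ultimately show ?case
      by (auto intro!: multi_poly_function_sum multi_poly_function_mult insert(3))
  qed
  from this[of UNIV 0] show ?thesis by simp
qed

text \<open>Monomials are multiplicative characters, and distinct characters are linearly independent by
  Dedekind's argument: translating a relation by a point that separates two monomials and
  subtracting gives a shorter relation. The translating points have coordinates 1 and 1/2, so the
  domain need not be the whole space.\<close>

lemma monomials_linearly_independent:
  assumes "finite A" and rel: "\<And>z. z \<in> D \<Longrightarrow> (\<Sum>\<alpha>\<in>A. c \<alpha> * monomial \<alpha> z) = 0"
    and D: "\<And>z i. z \<in> D \<Longrightarrow> (\<chi> j. if j = i then z $ j / 2 else z $ j) \<in> D"
    and z0: "z0 \<in> D" "\<And>i. z0 $ i \<noteq> 0"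
    and "\<alpha> \<in> A"
  shows "c \<alpha> = 0"
  using assms(1,2,6)
proof (induction A arbitrary: c \<alpha>)
  case empty
  then show ?case by simp
next
  case (insert \<beta> A)
  have shift: "c \<alpha> = 0" if \<alpha>: "\<alpha> \<in> A" for \<alpha>
  proof -
    have "\<alpha> \<noteq> \<beta>" using \<alpha> insert(2) by blast
    then obtain i where i: "\<alpha> i \<noteq> \<beta> i" by auto
    define w :: "complex ^ 'a" where "w = (\<chi> j. if j = i then 1/2 else 1)"
    have w: "(\<chi> j. if j = i then z $ j / 2 else z $ j) = (\<chi> j. w $ j * z $ j)" for z
      unfolding w_def by (auto simp: vec_eq_iff)
    have mw: "monomial \<gamma> w = (1/2) ^ \<gamma> i" for \<gamma>
    proof -
      have "monomial \<gamma> w = (\<Prod>j\<in>UNIV. if j = i then (1/2) ^ \<gamma> j else 1)"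
        unfolding monomial_def w_def by (intro prod.cong) auto
      then show ?thesis by simp
    qed
    have "c \<alpha> * (monomial \<alpha> w - monomial \<beta> w) = 0"
    proof (rule insert(3)[OF _ \<alpha>])
      fix z assume z: "z \<in> D"
      have "(\<Sum>\<gamma>\<in>insert \<beta> A. c \<gamma> * (monomial \<gamma> w * monomial \<gamma> z)) = 0"
        using insert(4)[OF D[OF z, of i]] unfolding w monomial_componentwise_mult .
      moreover have "monomial \<beta> w * (\<Sum>\<gamma>\<in>insert \<beta> A. c \<gamma> * monomial \<gamma> z) = 0"
        using insert(4)[OF z] by simp
      ultimately have "(\<Sum>\<gamma>\<in>insert \<beta> A. c \<gamma> * (monomial \<gamma> w * monomial \<gamma> z)) -
          (\<Sum>\<gamma>\<in>insert \<beta> A. monomial \<beta> w * (c \<gamma> * monomial \<gamma> z)) = 0"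
        unfolding sum_distrib_left by simp
      then have "(\<Sum>\<gamma>\<in>insert \<beta> A. c \<gamma> * (monomial \<gamma> w - monomial \<beta> w) * monomial \<gamma> z) = 0"
        unfolding sum_subtractf[symmetric] by (simp add: algebra_simps)
      then show "(\<Sum>\<gamma>\<in>A. c \<gamma> * (monomial \<gamma> w - monomial \<beta> w) * monomial \<gamma> z) = 0"
        using insert(1,2) by simp
    qed
    moreover have "monomial \<alpha> w \<noteq> monomial \<beta> w"
    proof
      assume "monomial \<alpha> w = monomial \<beta> w"
      then have "norm (monomial \<alpha> w) = norm (monomial \<beta> w)" by simp
      then have "(1/2::real) ^ \<alpha> i = (1/2) ^ \<beta> i" unfolding mw by (simp add: norm_power)
      then show False using i power_inject_exp'[of "1/2::real" "\<alpha> i" "\<beta> i"] by simp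
    qed
    ultimately show ?thesis by simp
  qed
  have "c \<beta> * monomial \<beta> z0 = 0" using insert(4)[OF z0(1)] insert(1,2) shift by simp
  moreover have "monomial \<beta> z0 \<noteq> 0" using z0(2) unfolding monomial_def by simp
  ultimately have "c \<beta> = 0" by simp
  then show ?case using shift insert(5) by blast
qed

section \<open>Monomial expansions of maps with a large symmetry group\<close>

lemma unitary_center_subset_diagonal_torus: "unitary_center \<subseteq> (diagonal_torus :: (complex ^ 'n \<Rightarrow> _) set)"
proof
  fix \<gamma> :: "complex ^ 'n \<Rightarrow> complex ^ 'n" assume "\<gamma> \<in> unitary_center"
  then obtain \<theta> where g: "\<gamma> = restrict (\<lambda>z. cis \<theta> *s z) (ball 0 1)" unfolding unitary_center_def by blast
  let ?D = "diagonal_matrix (\<chi> i. cis \<theta>) :: complex ^ 'n ^ 'n"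
  have "?D *v z = cis \<theta> *s z" for z by (simp add: diagonal_matrix_mult vec_eq_iff)
  then have "\<gamma> = linear_ball_map ?D" unfolding g linear_ball_map_def by (simp add: fun_eq_iff restrict_def)
  moreover have "unitary_matrix ?D" by (rule unitary_diagonal_matrix) simp
  ultimately show "\<gamma> \<in> diagonal_torus" unfolding diagonal_torus_def by (auto simp: diagonal_matrix_def)
qed

lemma diagonal_torus_subset_unitary_group: "diagonal_torus \<subseteq> unitary_group"
  unfolding diagonal_torus_def unitary_group_def by blast

text \<open>The homogeneous parts are entire, only finitely many of them do not vanish, and they have
  polynomial growth.\<close>

lemma normalised_polynomial:
  fixes f :: "complex ^ 'n \<Rightarrow> complex ^ 'm"
  assumes f: "holomorphic_ball_map f" and c: "unitary_center \<subseteq> Gamma_of f"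
  obtains A c where "finite A" "\<And>z. z \<in> ball 0 1 \<Longrightarrow> normalised f z = (\<Sum>\<alpha>\<in>A. monomial \<alpha> z *s c \<alpha>)"
proof -
  obtain d a where a: "\<And>k. holomorphic_map_on (a k) UNIV" "\<And>k z. norm (a k z) \<le> (1 + norm z) ^ k"
    "\<And>z. z \<in> ball 0 1 \<Longrightarrow> normalised f z = (\<Sum>k\<le>d. a k z)"
    using rotation_equivariant_expansion[OF holomorphic_normalised[OF f] normalised_in_ball[OF f]
        rotation_Gamma_of[OF f c]] by metis
  define G where "G z = (\<Sum>k\<le>d. a k z)" for z
  have holG: "holomorphic_map_on G UNIV"
    using holomorphic_map_on_sum[of "{..d}" a UNIV "\<lambda>_. 1"] a(1) unfolding G_def by simp
  have growth: "norm (G z) \<le> real (Suc d) * (1 + norm z) ^ d" for z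
  proof -
    have "norm (G z) \<le> (\<Sum>k\<le>d. norm (a k z))" unfolding G_def by (rule norm_sum)
    also have "\<dots> \<le> (\<Sum>k\<le>d. (1 + norm z) ^ d)"
      by (intro sum_mono order.trans[OF a(2)] power_increasing) auto
    finally show ?thesis by simp
  qed
  have "multi_poly_function (\<lambda>z. G z $ i)" for i
  proof (rule polynomial_growth_imp_polynomial)
    fix z and j :: 'n
    show "(\<lambda>t. G (z + t *s axis j 1) $ i) holomorphic_on UNIV"
      using holomorphic_slice[OF holG open_UNIV, of z "axis j 1" "axis i 1"] by simp
    show "norm (G z $ i) \<le> real (Suc d) * (1 + norm z) ^ d"
      by (rule order.trans[OF Finite_Cartesian_Product.norm_nth_le growth])
  qed
  then obtain A c where Ac: "\<And>i. finite (A i)" "\<And>i z. G z $ i = (\<Sum>\<alpha>\<in>A i. c i \<alpha> * monomial \<alpha> z)"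
    unfolding multi_poly_function_def by metis
  let ?A = "\<Union>i. A i" and ?c = "\<lambda>\<alpha>. \<chi> i. if \<alpha> \<in> A i then c i \<alpha> else 0"
  have fin: "finite ?A" using Ac(1) by simp
  have "G z = (\<Sum>\<alpha>\<in>?A. monomial \<alpha> z *s ?c \<alpha>)" for z
  proof -
    have "G z $ i = (\<Sum>\<alpha>\<in>?A. (if \<alpha> \<in> A i then c i \<alpha> else 0) * monomial \<alpha> z)" for i
      unfolding Ac(2) using fin by (intro sum.mono_neutral_cong_left) auto
    then show ?thesis by (simp add: vec_eq_iff mult.commute)
  qed
  then show thesis using that[OF fin, of ?c] a(3) unfolding G_def by simp
qed

lemma ball_point_nonzero_coordinates: "\<exists>z \<in> ball (0 :: complex ^ 'n) 1. \<forall>i. z $ i \<noteq> 0"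
proof -
  let ?v = "(\<chi> i. 1) :: complex ^ 'n"
  have "of_real (1 / (1 + norm ?v)) *s ?v \<in> ball 0 1"
  proof -
    have "norm (complex_of_real (1 / (1 + norm ?v))) = 1 / (1 + norm ?v)"
      unfolding norm_of_real using inverse_one_plus_norm(2)[of ?v] by (simp only: abs_of_pos)
    moreover have "1 / (1 + norm ?v) * norm ?v < 1" by (simp add: divide_less_eq_1 add_pos_nonneg)
    ultimately show ?thesis by (simp only: mem_ball dist_0_norm norm_scalar_mult)
  qed
  moreover have "(complex_of_real (1 / (1 + norm ?v)) *s ?v) $ i \<noteq> 0" for i
    using inverse_one_plus_norm(2)[of ?v] by (simp del: of_real_divide)
  ultimately show ?thesis by blast
qed

lemma monomial_sum_eq_0_on_ball:
  fixes c :: "('n::finite \<Rightarrow> nat) \<Rightarrow> complex ^ 'm"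
  assumes "finite A" "\<And>z. z \<in> ball 0 1 \<Longrightarrow> (\<Sum>\<alpha>\<in>A. monomial \<alpha> z *s c \<alpha>) = 0" "\<alpha> \<in> A"
  shows "c \<alpha> = 0"
proof -
  obtain z0 where z0: "z0 \<in> ball (0 :: complex ^ 'n) 1" "\<And>i. z0 $ i \<noteq> 0"
    using ball_point_nonzero_coordinates by blast
  have "c \<alpha> $ k = 0" for k
  proof (rule monomials_linearly_independent[OF assms(1) _ _ z0 assms(3), where c = "\<lambda>\<alpha>. c \<alpha> $ k"])
    fix z :: "complex ^ 'n" assume z: "z \<in> ball 0 1"
    show "(\<Sum>\<alpha>\<in>A. c \<alpha> $ k * monomial \<alpha> z) = 0"
      using arg_cong[OF assms(2)[OF z], of "\<lambda>v. v $ k"] by (simp add: mult.commute)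
    fix i :: 'n
    have "norm (\<chi> j. if j = i then z $ j / 2 else z $ j) \<le> norm z"
      unfolding norm_vec_def by (rule L2_set_mono) (auto simp: norm_divide)
    then show "(\<chi> j. if j = i then z $ j / 2 else z $ j) \<in> ball 0 1" using z by simp
  qed
  then show ?thesis by (simp add: vec_eq_iff)
qed

text \<open>Each coefficient vector is an eigenvector of the unitary maps that correspond to the torus,
  and its eigenvalue is the value of the monomial at the torus element. Distinct exponents give
  distinct characters of the torus, so the coefficient vectors are orthogonal.\<close>

lemma torus_coefficients_orthogonal:
  fixes f :: "complex ^ 'n \<Rightarrow> complex ^ 'm"
  assumes f: "holomorphic_ball_map f" and t: "diagonal_torus \<subseteq> Gamma_of f"
    and A: "finite A" "\<And>z. z \<in> ball 0 1 \<Longrightarrow> normalised f z = (\<Sum>\<alpha>\<in>A. monomial \<alpha> z *s c \<alpha>)"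
    and "\<alpha> \<in> A" "\<beta> \<in> A" "\<alpha> \<noteq> \<beta>"
  shows "hinner (c \<alpha>) (c \<beta>) = 0"
proof -
  obtain i where i: "\<alpha> i \<noteq> \<beta> i" using \<open>\<alpha> \<noteq> \<beta>\<close> by auto
  define \<theta> where "\<theta> = pi / (real (\<alpha> i) - real (\<beta> i))"
  define w :: "complex ^ 'n" where "w = (\<chi> j. if j = i then cis \<theta> else 1)"
  have mw: "monomial \<gamma> w = cis \<theta> ^ \<gamma> i" for \<gamma>
  proof -
    have "monomial \<gamma> w = (\<Prod>j\<in>UNIV. if j = i then cis \<theta> ^ \<gamma> j else 1)"
      unfolding monomial_def w_def by (intro prod.cong) auto
    then show ?thesis by simp
  qed
  have uD: "unitary_matrix (diagonal_matrix w)" by (rule unitary_diagonal_matrix) (simp add: w_def)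
  then have "linear_ball_map (diagonal_matrix w) \<in> diagonal_torus"
    unfolding diagonal_torus_def by (auto simp: diagonal_matrix_def)
  then obtain V where V: "unitary_matrix V"
    "\<And>z. z \<in> ball 0 1 \<Longrightarrow> normalised f (diagonal_matrix w *v z) = V *v normalised f z"
    using unitary_Gamma_of[OF f] t by blast
  have eig: "V *v c \<gamma> = monomial \<gamma> w *s c \<gamma>" if \<gamma>: "\<gamma> \<in> A" for \<gamma>
  proof -
    have "V *v c \<gamma> - monomial \<gamma> w *s c \<gamma> = 0"
    proof (rule monomial_sum_eq_0_on_ball[OF A(1) _ \<gamma>])
      fix z :: "complex ^ 'n" assume z: "z \<in> ball 0 1"
      then have wz: "diagonal_matrix w *v z \<in> ball 0 1" using unitary_norm[OF uD] by simp
      have "V *v normalised f z = (\<Sum>\<alpha>\<in>A. monomial \<alpha> z *s (V *v c \<alpha>))"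
        unfolding A(2)[OF z] by (simp add: linear_sum[OF bounded_linear.linear[OF bounded_linear_matrix]] vector_scalar_commute)
      moreover have "normalised f (diagonal_matrix w *v z) = (\<Sum>\<alpha>\<in>A. monomial \<alpha> z *s (monomial \<alpha> w *s c \<alpha>))"
        unfolding A(2)[OF wz] unfolding diagonal_matrix_mult monomial_componentwise_mult by (simp add: mult.commute)
      ultimately have "(\<Sum>\<alpha>\<in>A. monomial \<alpha> z *s (V *v c \<alpha>)) = (\<Sum>\<alpha>\<in>A. monomial \<alpha> z *s (monomial \<alpha> w *s c \<alpha>))"
        using V(2)[OF z] by simp
      then show "(\<Sum>\<alpha>\<in>A. monomial \<alpha> z *s (V *v c \<alpha> - monomial \<alpha> w *s c \<alpha>)) = 0"
        by (simp add: vec_eq_iff sum_subtractf right_diff_distrib)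
    qed
    then show ?thesis by simp
  qed
  have "hinner (c \<alpha>) (c \<beta>) = hinner (V *v c \<alpha>) (V *v c \<beta>)" by (simp add: unitary_hinner[OF V(1)])
  also have "\<dots> = cis \<theta> ^ \<alpha> i * cnj (cis \<theta> ^ \<beta> i) * hinner (c \<alpha>) (c \<beta>)"
    unfolding eig[OF \<open>\<alpha> \<in> A\<close>] eig[OF \<open>\<beta> \<in> A\<close>] mw by (simp only: hinner_linear) (simp only: mult_ac)
  also have "cis \<theta> ^ \<alpha> i * cnj (cis \<theta> ^ \<beta> i) = cis (real (\<alpha> i) * \<theta> - real (\<beta> i) * \<theta>)"
    by (simp add: Complex.DeMoivre cis_cnj cis_mult)
  also have "real (\<alpha> i) * \<theta> - real (\<beta> i) * \<theta> = pi"
    using i unfolding left_diff_distrib[symmetric] \<theta>_def by simp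
  finally show ?thesis by simp
qed

text \<open>The orthogonal coefficient vectors, scaled to unit length, are columns of a unitary matrix
  \<open>V\<close>. In the coordinates given by \<open>V\<close> each monomial occupies a component of its own.\<close>

theorem torus_invariant_normal_form:
  fixes f :: "complex ^ 'n \<Rightarrow> complex ^ 'm"
  assumes f: "holomorphic_ball_map f" and t: "diagonal_torus \<subseteq> Gamma_of f"
  obtains S r V and e :: "('n \<Rightarrow> nat) \<Rightarrow> 'm" where
    "finite S" "\<And>\<alpha>. \<alpha> \<in> S \<Longrightarrow> r \<alpha> > 0" "inj_on e S" "unitary_matrix V"
    "\<And>z \<alpha>. z \<in> ball 0 1 \<Longrightarrow> \<alpha> \<in> S \<Longrightarrow> (adj V *v normalised f z) $ e \<alpha> = of_real (r \<alpha>) * monomial \<alpha> z"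
    "\<And>z k. z \<in> ball 0 1 \<Longrightarrow> k \<notin> e ` S \<Longrightarrow> (adj V *v normalised f z) $ k = 0"
proof -
  have c: "unitary_center \<subseteq> Gamma_of f" using unitary_center_subset_diagonal_torus t by blast
  obtain A c where A: "finite A" "\<And>z. z \<in> ball 0 1 \<Longrightarrow> normalised f z = (\<Sum>\<alpha>\<in>A. monomial \<alpha> z *s c \<alpha>)"
    using normalised_polynomial[OF f c] by metis
  define S where "S = {\<alpha>\<in>A. c \<alpha> \<noteq> 0}"
  define u where "u \<alpha> = of_real (1 / norm (c \<alpha>)) *s c \<alpha>" for \<alpha>
  have S: "finite S" unfolding S_def using A by simp
  have "hinner (u \<alpha>) (u \<beta>) = (if \<alpha> = \<beta> then 1 else 0)" if "\<alpha> \<in> S" "\<beta> \<in> S" for \<alpha> \<beta>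
  proof (cases "\<alpha> = \<beta>")
    case True
    have "norm (u \<beta>) = 1" using that unfolding u_def S_def by (simp add: norm_divide)
    then show ?thesis using True by (simp add: hinner_self)
  next
    case False
    then show ?thesis
      using that torus_coefficients_orthogonal[OF f t A, of \<alpha> \<beta>] unfolding u_def S_def by simp
  qed
  from orthonormal_family_unitary[OF S this] obtain V and e :: "('n \<Rightarrow> nat) \<Rightarrow> 'm" where
    e: "inj_on e S" "unitary_matrix V" "\<And>\<alpha>. \<alpha> \<in> S \<Longrightarrow> V *v axis (e \<alpha>) 1 = u \<alpha>" by metis
  have ac: "adj V *v c \<alpha> = of_real (norm (c \<alpha>)) *s axis (e \<alpha>) 1" if \<alpha>: "\<alpha> \<in> S" for \<alpha>
  proof -
    have "c \<alpha> = of_real (norm (c \<alpha>)) *s (V *v axis (e \<alpha>) 1)"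
      unfolding e(3)[OF \<alpha>] u_def using \<alpha> by (simp add: S_def)
    then show ?thesis
      by (metis vector_scalar_commute unitary_adj_cancel(1)[OF e(2)])
  qed
  have g: "(adj V *v normalised f z) $ k =
      (\<Sum>\<alpha>\<in>S. if e \<alpha> = k then of_real (norm (c \<alpha>)) * monomial \<alpha> z else 0)"
    if z: "z \<in> ball 0 1" for z k
  proof -
    have "normalised f z = (\<Sum>\<alpha>\<in>S. monomial \<alpha> z *s c \<alpha>)"
      unfolding A(2)[OF z] S_def using A(1) by (intro sum.mono_neutral_right) auto
    then have "adj V *v normalised f z = (\<Sum>\<alpha>\<in>S. monomial \<alpha> z *s (of_real (norm (c \<alpha>)) *s axis (e \<alpha>) 1))"
      by (simp add: linear_sum[OF bounded_linear.linear[OF bounded_linear_matrix]] vector_scalar_commute ac)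
    then show ?thesis by (auto simp: axis_def intro!: sum.cong)
  qed
  show thesis
  proof (rule that[of S "\<lambda>\<alpha>. norm (c \<alpha>)" e V])
    show "norm (c \<alpha>) > 0" if "\<alpha> \<in> S" for \<alpha> using that unfolding S_def by simp
    show "(adj V *v normalised f z) $ e \<alpha> = of_real (norm (c \<alpha>)) * monomial \<alpha> z"
      if "z \<in> ball 0 1" "\<alpha> \<in> S" for z \<alpha>
    proof -
      have "(\<Sum>\<beta>\<in>S. if e \<beta> = e \<alpha> then of_real (norm (c \<beta>)) * monomial \<beta> z else 0) =
        (\<Sum>\<beta>\<in>S. if \<beta> = \<alpha> then of_real (norm (c \<beta>)) * monomial \<beta> z else 0)"
        using e(1) that(2) by (intro sum.cong refl) (auto dest: inj_onD)
      then show ?thesis unfolding g[OF that(1)] using S that(2) by simp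
    qed
    show "(adj V *v normalised f z) $ k = 0" if "z \<in> ball 0 1" "k \<notin> e ` S" for z k
      unfolding g[OF that(1)] using that(2) by (intro sum.neutral) auto
  qed (use S e in auto)
qed

lemma torus_invariant_monomial:
  fixes f :: "complex ^ 'n \<Rightarrow> complex ^ 'm"
  assumes f: "holomorphic_ball_map f" and t: "diagonal_torus \<subseteq> Gamma_of f"
  shows "\<exists>g :: complex ^ 'n \<Rightarrow> complex ^ 'm. monomial_map g \<and> spherically_equivalent f g"
proof -
  obtain S r V and e :: "('n \<Rightarrow> nat) \<Rightarrow> 'm" where n: "unitary_matrix V"
    "\<And>z \<alpha>. z \<in> ball 0 1 \<Longrightarrow> \<alpha> \<in> S \<Longrightarrow> (adj V *v normalised f z) $ e \<alpha> = of_real (r \<alpha>) * monomial \<alpha> z"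
    "\<And>z k. z \<in> ball 0 1 \<Longrightarrow> k \<notin> e ` S \<Longrightarrow> (adj V *v normalised f z) $ k = 0"
    using torus_invariant_normal_form[OF f t] by metis
  have "monomial_map (\<lambda>z. adj V *v normalised f z)"
    unfolding monomial_map_def
  proof
    fix k
    show "\<exists>c \<alpha>. \<forall>z\<in>ball 0 1. (adj V *v normalised f z) $ k = c * monomial \<alpha> z"
    proof (cases "k \<in> e ` S")
      case True
      then show ?thesis using n(2) by blast
    next
      case False
      then show ?thesis using n(3) by (intro exI[of _ 0]) simp
    qed
  qed
  then show ?thesis using spherically_equivalent_unitary_normalised[OF f n(1)] by blast
qed

section \<open>Unitary symmetry\<close>

definition multinomial :: "('n::finite \<Rightarrow> nat) \<Rightarrow> real"
  where "multinomial \<alpha> = fact (multi_degree \<alpha>) / (\<Prod>i\<in>UNIV. fact (\<alpha> i))"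

lemma multinomial_pos: "multinomial \<alpha> > 0"
  unfolding multinomial_def by (simp add: prod_pos)

lemma finite_multi_degree: "finite {\<alpha> :: 'n::finite \<Rightarrow> nat. multi_degree \<alpha> = j}"
proof (rule finite_subset)
  show "{\<alpha> :: 'n \<Rightarrow> nat. multi_degree \<alpha> = j} \<subseteq> (\<Pi>\<^sub>E i\<in>UNIV. {..j})"
    unfolding multi_degree_def by (auto simp: member_le_sum)
qed (simp add: finite_PiE)

lemma prod_fun_upd_Suc:
  fixes \<alpha> :: "'n::finite \<Rightarrow> nat" and h :: "'n \<Rightarrow> nat \<Rightarrow> complex"
  assumes "h i (Suc (\<alpha> i)) = k * h i (\<alpha> i)"
  shows "(\<Prod>j\<in>UNIV. h j ((\<alpha>(i := Suc (\<alpha> i))) j)) = k * (\<Prod>j\<in>UNIV. h j (\<alpha> j))"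
  using assms by (simp add: prod.remove[of UNIV i] mult.assoc)

lemma multi_degree_fun_upd_Suc: "multi_degree (\<alpha>(i := Suc (\<alpha> i))) = Suc (multi_degree \<alpha>)"
  unfolding multi_degree_def by (simp add: sum.remove[of UNIV i])

text \<open>The multinomial theorem, by induction on the degree. The factor \<open>j + 1\<close> of the multinomial
  coefficient of an exponent of degree \<open>j + 1\<close> is the sum of the entries of the exponent, and the
  term of the sum with index \<open>i\<close> matches the product with the variable of index \<open>i\<close>.\<close>

lemma multinomial_theorem:
  fixes x :: "complex ^ 'n"
  shows "(\<Sum>i\<in>UNIV. x $ i) ^ j = (\<Sum>\<alpha> | multi_degree \<alpha> = j. of_real (multinomial \<alpha>) * monomial \<alpha> x)"
proof -
  let ?P = "\<lambda>\<alpha> :: 'n \<Rightarrow> nat. \<Prod>i\<in>UNIV. fact (\<alpha> i) :: complex"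
  have m: "(\<Sum>i\<in>UNIV. x $ i) ^ j = (\<Sum>\<alpha> | multi_degree \<alpha> = j. fact j / ?P \<alpha> * monomial \<alpha> x)"
  proof (induction j)
    case 0
    have "{\<alpha> :: 'n \<Rightarrow> nat. multi_degree \<alpha> = 0} = {\<lambda>_. 0}" unfolding multi_degree_def by auto
    then show ?case by simp
  next
    case (Suc j)
    have P: "?P (\<alpha>(i := Suc (\<alpha> i))) = of_nat (Suc (\<alpha> i)) * ?P \<alpha>" for \<alpha> i
      by (rule prod_fun_upd_Suc) simp
    have M: "monomial (\<alpha>(i := Suc (\<alpha> i))) x = x $ i * monomial \<alpha> x" for \<alpha> i
      unfolding monomial_def by (rule prod_fun_upd_Suc[where h = "\<lambda>j m. (x $ j) ^ m"]) simp
    have nz: "?P \<alpha> \<noteq> 0" for \<alpha> by simp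
    have step: "(\<Sum>\<beta> | multi_degree \<beta> = Suc j. of_nat (\<beta> i) * fact j / ?P \<beta> * monomial \<beta> x) =
        (\<Sum>\<alpha> | multi_degree \<alpha> = j. x $ i * (fact j / ?P \<alpha> * monomial \<alpha> x))" for i
    proof -
      have "(\<Sum>\<beta> | multi_degree \<beta> = Suc j. of_nat (\<beta> i) * fact j / ?P \<beta> * monomial \<beta> x) =
          (\<Sum>\<beta> | multi_degree \<beta> = Suc j \<and> \<beta> i \<noteq> 0. of_nat (\<beta> i) * fact j / ?P \<beta> * monomial \<beta> x)"
        using finite_multi_degree[of "Suc j"] by (intro sum.mono_neutral_right) auto
      also have "\<dots> = (\<Sum>\<alpha> | multi_degree \<alpha> = j. x $ i * (fact j / ?P \<alpha> * monomial \<alpha> x))"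
      proof (rule sum.reindex_bij_witness[of _ "\<lambda>\<alpha>. \<alpha>(i := Suc (\<alpha> i))" "\<lambda>\<beta>. \<beta>(i := \<beta> i - 1)"])
        fix \<beta> :: "'n \<Rightarrow> nat" assume b: "\<beta> \<in> {\<beta>. multi_degree \<beta> = Suc j \<and> \<beta> i \<noteq> 0}"
        let ?\<alpha> = "\<beta>(i := \<beta> i - 1)"
        show eq: "?\<alpha>(i := Suc (?\<alpha> i)) = \<beta>" using b by auto
        show "?\<alpha> \<in> {\<alpha>. multi_degree \<alpha> = j}" using multi_degree_fun_upd_Suc[of ?\<alpha> i] b unfolding eq by simp
        have "?P \<beta> = of_nat (\<beta> i) * ?P ?\<alpha>" using P[of ?\<alpha> i] b unfolding eq by simp
        moreover have "monomial \<beta> x = x $ i * monomial ?\<alpha> x" using M[of ?\<alpha> i] unfolding eq .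
        moreover have "of_nat (\<beta> i) \<noteq> (0::complex)" using b by simp
        ultimately show "x $ i * (fact j / ?P ?\<alpha> * monomial ?\<alpha> x) = of_nat (\<beta> i) * fact j / ?P \<beta> * monomial \<beta> x"
          by simp
      qed (auto simp: multi_degree_fun_upd_Suc)
      finally show ?thesis .
    qed
    have "(\<Sum>i\<in>UNIV. x $ i) ^ Suc j = (\<Sum>i\<in>UNIV. \<Sum>\<alpha> | multi_degree \<alpha> = j. x $ i * (fact j / ?P \<alpha> * monomial \<alpha> x))"
      unfolding power_Suc Suc by (rule sum_product)
    also have "\<dots> = (\<Sum>i\<in>UNIV. \<Sum>\<beta> | multi_degree \<beta> = Suc j. of_nat (\<beta> i) * fact j / ?P \<beta> * monomial \<beta> x)"
      by (simp only: step)
    also have "\<dots> = (\<Sum>\<beta> | multi_degree \<beta> = Suc j. \<Sum>i\<in>UNIV. of_nat (\<beta> i) * fact j / ?P \<beta> * monomial \<beta> x)"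
      by (rule sum.swap)
    also have "\<dots> = (\<Sum>\<beta> | multi_degree \<beta> = Suc j. fact (Suc j) / ?P \<beta> * monomial \<beta> x)"
    proof (intro sum.cong refl)
      fix \<beta> :: "'n \<Rightarrow> nat" assume "\<beta> \<in> {\<beta>. multi_degree \<beta> = Suc j}"
      then have "(\<Sum>i\<in>UNIV. of_nat (\<beta> i)) = (of_nat (Suc j) :: complex)"
        unfolding multi_degree_def of_nat_sum[symmetric] by simp
      then show "(\<Sum>i\<in>UNIV. of_nat (\<beta> i) * fact j / ?P \<beta> * monomial \<beta> x) = fact (Suc j) / ?P \<beta> * monomial \<beta> x"
        unfolding fact_Suc by (simp only: sum_distrib_right[symmetric] sum_divide_distrib[symmetric])
    qed
    finally show ?case .
  qed
  show ?thesis unfolding m multinomial_def by (intro sum.cong) auto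
qed

text \<open>Unitary symmetry makes the squared norm of the normalised map a function of the norm of the
  argument. Evaluated on one coordinate axis, this function is a polynomial in the squared norm;
  expanding it with the multinomial theorem and comparing coefficients on the points with real
  coordinates determines all coefficients.\<close>

lemma unitary_invariant_tensor_sum:
  fixes f :: "complex ^ 'n \<Rightarrow> complex ^ 'm"
  assumes f: "holomorphic_ball_map f" and u: "unitary_group \<subseteq> Gamma_of f"
  shows "\<exists>g :: complex ^ 'n \<Rightarrow> complex ^ 'm. orthogonal_sum_of_tensor_products g \<and> spherically_equivalent f g"
proof -
  have t: "diagonal_torus \<subseteq> Gamma_of f" using diagonal_torus_subset_unitary_group u by blast
  obtain S r V and e :: "('n \<Rightarrow> nat) \<Rightarrow> 'm" where S: "finite S" and r: "\<And>\<alpha>. \<alpha> \<in> S \<Longrightarrow> r \<alpha> > 0"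
    and e: "inj_on e S" and V: "unitary_matrix V"
    and on: "\<And>z \<alpha>. z \<in> ball 0 1 \<Longrightarrow> \<alpha> \<in> S \<Longrightarrow> (adj V *v normalised f z) $ e \<alpha> = of_real (r \<alpha>) * monomial \<alpha> z"
    and off: "\<And>z k. z \<in> ball 0 1 \<Longrightarrow> k \<notin> e ` S \<Longrightarrow> (adj V *v normalised f z) $ k = 0"
    using torus_invariant_normal_form[OF f t] by metis
  define G where "G z = adj V *v normalised f z" for z
  have nG: "norm (G z) = norm (normalised f z)" for z
    unfolding G_def by (rule unitary_norm[OF unitary_matrix_adj[OF V]])
  have radial: "norm (G z) = norm (G w)" if "norm z = norm w" "z \<in> ball 0 1" for z w
  proof -
    from unitary_transitive[OF that(1)] obtain U where U: "unitary_matrix U" "U *v z = w" by blast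
    then have "linear_ball_map U \<in> Gamma_of f" using u unfolding unitary_group_def by blast
    with unitary_Gamma_of[OF f] that(2) obtain W
      where "unitary_matrix W" "normalised f (U *v z) = W *v normalised f z" by blast
    then show ?thesis unfolding nG U(2) using unitary_norm by metis
  qed
  have hG: "hinner (G z) (G z) = (\<Sum>\<alpha>\<in>S. of_real ((r \<alpha>)\<^sup>2) * (monomial \<alpha> z * cnj (monomial \<alpha> z)))"
    if z: "z \<in> ball 0 1" for z
  proof -
    have "hinner (G z) (G z) = (\<Sum>k\<in>e ` S. G z $ k * cnj (G z $ k))"
      unfolding hinner_def using off[OF z] unfolding G_def[symmetric]
      by (intro sum.mono_neutral_right) auto
    also have "\<dots> = (\<Sum>\<alpha>\<in>S. of_real ((r \<alpha>)\<^sup>2) * (monomial \<alpha> z * cnj (monomial \<alpha> z)))"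
      unfolding sum.reindex[OF e] using on[OF z] unfolding G_def[symmetric]
      by (intro sum.cong) (auto simp: power2_eq_square)
    finally show ?thesis .
  qed
  define i0 :: 'n where "i0 = undefined"
  \<comment> \<open>the exponents of the monomials that do not vanish on the chosen axis\<close>
  define \<delta> where "\<delta> j = (\<lambda>i. if i = i0 then j else 0)" for j :: nat
  define J where "J = {j. \<delta> j \<in> S}"
  define lam where "lam j = r (\<delta> j)" for j
  have inj\<delta>: "inj \<delta>" by (rule injI) (auto simp: \<delta>_def fun_eq_iff split: if_splits)
  have J: "finite J" unfolding J_def using finite_vimageI[OF S inj\<delta>] by (simp add: vimage_def)
  have axis: "hinner (G (t *s axis i0 1)) (G (t *s axis i0 1)) = (\<Sum>j\<in>J. of_real ((lam j)\<^sup>2) * (t * cnj t) ^ j)"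
    if t: "t *s axis i0 1 \<in> ball (0 :: complex ^ 'n) 1" for t
  proof -
    have m: "monomial (\<delta> j) (t *s axis i0 1) = t ^ j" for j
    proof -
      have "monomial (\<delta> j) (t *s axis i0 1) = (\<Prod>i\<in>UNIV. if i = i0 then t ^ j else 1)"
        unfolding monomial_def \<delta>_def by (intro prod.cong) (auto simp: axis_def)
      then show ?thesis by simp
    qed
    have m0: "monomial \<alpha> (t *s axis i0 1) = 0" if "\<alpha> \<notin> range \<delta>" for \<alpha>
    proof -
      have "\<alpha> \<noteq> \<delta> (\<alpha> i0)" using that by blast
      then obtain i where "i \<noteq> i0" "\<alpha> i \<noteq> 0" unfolding \<delta>_def by (auto simp: fun_eq_iff split: if_splits)
      then have "\<exists>i\<in>UNIV. ((t *s axis i0 1) $ i) ^ \<alpha> i = 0" by (intro bexI[of _ i]) (auto simp: axis_def)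
      then show ?thesis unfolding monomial_def by (simp add: prod_zero_iff)
    qed
    have "hinner (G (t *s axis i0 1)) (G (t *s axis i0 1)) =
        (\<Sum>\<alpha>\<in>\<delta> ` J. of_real ((r \<alpha>)\<^sup>2) * (monomial \<alpha> (t *s axis i0 1) * cnj (monomial \<alpha> (t *s axis i0 1))))"
      unfolding hG[OF t]
    proof (rule sum.mono_neutral_right[OF S])
      show "\<delta> ` J \<subseteq> S" unfolding J_def by blast
      have "\<alpha> \<notin> range \<delta>" if "\<alpha> \<in> S - \<delta> ` J" for \<alpha> using that unfolding J_def by blast
      then show "\<forall>\<alpha>\<in>S - \<delta> ` J. of_real ((r \<alpha>)\<^sup>2) * (monomial \<alpha> (t *s axis i0 1) * cnj (monomial \<alpha> (t *s axis i0 1))) = 0"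
        using m0 by simp
    qed
    then show ?thesis
      unfolding sum.reindex[OF inj_on_subset[OF inj\<delta> subset_UNIV]] lam_def
      by (simp add: m power_mult_distrib)
  qed
  define T where "T = {\<alpha> :: 'n \<Rightarrow> nat. multi_degree \<alpha> \<in> J}"
  have T1: "T = (\<Union>j\<in>J. {\<alpha>. multi_degree \<alpha> = j})" unfolding T_def by blast
  have T: "T = (\<Union>j\<in>J. {\<alpha>. multi_degree \<alpha> = j})" "finite T"
    using J finite_multi_degree unfolding T1 by auto
  \<comment> \<open>at points with real coordinates, squared moduli of monomials are monomials in the squares\<close>
  define sq :: "complex ^ 'n \<Rightarrow> complex ^ 'n" where "sq z = (\<chi> i. (z $ i)\<^sup>2)" for z
  define D where "D = sq ` {z \<in> ball 0 1. \<forall>i. z $ i \<in> \<real>}"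
  let ?p = "\<lambda>\<alpha>. if \<alpha> \<in> S then complex_of_real ((r \<alpha>)\<^sup>2) else 0"
  let ?q = "\<lambda>\<alpha>. if \<alpha> \<in> T then complex_of_real ((lam (multi_degree \<alpha>))\<^sup>2 * multinomial \<alpha>) else 0"
  have rel: "(\<Sum>\<alpha>\<in>S \<union> T. (?p \<alpha> - ?q \<alpha>) * monomial \<alpha> x) = 0" if x: "x \<in> D" for x
  proof -
    obtain z where z: "z \<in> ball 0 1" "\<And>i. z $ i \<in> \<real>" "x = sq z" using x unfolding D_def by blast
    have cz: "cnj (z $ i) = z $ i" for i using z(2)[of i] by (simp add: Reals_cnj_iff)
    have mm: "monomial \<alpha> z * cnj (monomial \<alpha> z) = monomial \<alpha> x" for \<alpha>
      unfolding monomial_def z(3) sq_def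
      by (simp add: cz prod.distrib[symmetric] power_mult[symmetric] power_mult_distrib[symmetric] power2_eq_square)
    let ?t = "of_real (norm z) :: complex"
    have n: "norm z = norm (?t *s axis i0 1 :: complex ^ 'n)" by (simp add: norm_axis_1)
    have tb: "?t *s axis i0 1 \<in> ball (0 :: complex ^ 'n) 1" using z(1) n by simp
    have sx: "?t * cnj ?t = (\<Sum>i\<in>UNIV. x $ i)"
      using hinner_self[of z] unfolding hinner_def cz z(3) sq_def by (simp add: power2_eq_square)
    have "(\<Sum>\<alpha>\<in>S. of_real ((r \<alpha>)\<^sup>2) * monomial \<alpha> x) = hinner (G z) (G z)"
      unfolding hG[OF z(1)] mm ..
    also have "\<dots> = hinner (G (?t *s axis i0 1)) (G (?t *s axis i0 1))"
      unfolding hinner_self radial[OF n z(1)] ..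
    also have "\<dots> = (\<Sum>j\<in>J. of_real ((lam j)\<^sup>2) * (\<Sum>i\<in>UNIV. x $ i) ^ j)" unfolding axis[OF tb] sx ..
    also have "\<dots> = (\<Sum>j\<in>J. \<Sum>\<alpha> | multi_degree \<alpha> = j.
        of_real ((lam (multi_degree \<alpha>))\<^sup>2 * multinomial \<alpha>) * monomial \<alpha> x)"
      unfolding multinomial_theorem sum_distrib_left by (intro sum.cong) auto
    also have "\<dots> = (\<Sum>\<alpha>\<in>T. of_real ((lam (multi_degree \<alpha>))\<^sup>2 * multinomial \<alpha>) * monomial \<alpha> x)"
      unfolding T(1) using J finite_multi_degree by (intro sum.UNION_disjoint[symmetric]) auto
    finally have eq: "(\<Sum>\<alpha>\<in>S. of_real ((r \<alpha>)\<^sup>2) * monomial \<alpha> x) =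
        (\<Sum>\<alpha>\<in>T. of_real ((lam (multi_degree \<alpha>))\<^sup>2 * multinomial \<alpha>) * monomial \<alpha> x)" .
    have "(\<Sum>\<alpha>\<in>S \<union> T. ?p \<alpha> * monomial \<alpha> x) = (\<Sum>\<alpha>\<in>S. of_real ((r \<alpha>)\<^sup>2) * monomial \<alpha> x)"
      using S T(2) by (intro sum.mono_neutral_cong_right) auto
    moreover have "(\<Sum>\<alpha>\<in>S \<union> T. ?q \<alpha> * monomial \<alpha> x) =
        (\<Sum>\<alpha>\<in>T. of_real ((lam (multi_degree \<alpha>))\<^sup>2 * multinomial \<alpha>) * monomial \<alpha> x)"
      using S T(2) by (intro sum.mono_neutral_cong_right) auto
    ultimately show ?thesis unfolding left_diff_distrib sum_subtractf eq by simp
  qed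
  have pq: "?p \<alpha> = ?q \<alpha>" if \<alpha>: "\<alpha> \<in> S \<union> T" for \<alpha>
  proof -
    obtain z0 where z0: "z0 \<in> ball (0 :: complex ^ 'n) 1" "\<And>i. z0 $ i \<noteq> 0"
      using ball_point_nonzero_coordinates by blast
    define z1 :: "complex ^ 'n" where "z1 = (\<chi> i. of_real (norm (z0 $ i)))"
    have "norm z1 = norm z0" unfolding z1_def norm_vec_def by simp
    then have z1: "sq z1 \<in> D" "\<And>i. sq z1 $ i \<noteq> 0"
      unfolding D_def sq_def using z0 by (auto simp: z1_def intro!: image_eqI[of _ _ z1])
    have "?p \<alpha> - ?q \<alpha> = 0"
    proof (rule monomials_linearly_independent[OF _ rel _ z1 \<alpha>])
      show "finite (S \<union> T)" using S T(2) by simp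
      fix x :: "complex ^ 'n" and i assume "x \<in> D"
      then obtain z where z: "z \<in> ball 0 1" "\<And>i. z $ i \<in> \<real>" "x = sq z" unfolding D_def by blast
      define h :: real where "h = sqrt (1 / 2)"
      have h: "0 \<le> h" "h \<le> 1" "h\<^sup>2 = 1 / 2" unfolding h_def by (auto simp: real_sqrt_le_1_iff simp del: real_sqrt_divide)
      have h2: "(complex_of_real h)\<^sup>2 = 1 / 2" using arg_cong[OF h(3), of complex_of_real] by simp
      define y where "y = (\<chi> j. if j = i then z $ j * of_real h else z $ j)"
      have "norm y \<le> norm z" unfolding norm_vec_def y_def
        by (rule L2_set_mono) (use h in \<open>auto simp: norm_mult mult_left_le\<close>)
      moreover have "sq y = (\<chi> j. if j = i then x $ j / 2 else x $ j)"
        unfolding z(3) sq_def y_def by (auto simp: vec_eq_iff power_mult_distrib h2)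
      moreover have "y $ j \<in> \<real>" for j unfolding y_def using z(2)[of j] by auto
      ultimately show "(\<chi> j. if j = i then x $ j / 2 else x $ j) \<in> D"
        using z(1) unfolding D_def by (intro image_eqI[of _ _ y]) auto
    qed
    then show ?thesis by simp
  qed
  have lam: "lam j > 0" if "j \<in> J" for j using that r unfolding J_def lam_def by blast
  have ST: "S = T"
  proof (intro equalityI subsetI)
    fix \<alpha> assume "\<alpha> \<in> S"
    then show "\<alpha> \<in> T" using pq[of \<alpha>] r[of \<alpha>] by (auto split: if_splits)
  next
    fix \<alpha> assume a: "\<alpha> \<in> T"
    then have "lam (multi_degree \<alpha>) > 0" using lam unfolding T_def by blast
    then have "?q \<alpha> \<noteq> 0" using a multinomial_pos[of \<alpha>] by simp
    then show "\<alpha> \<in> S" using pq[of \<alpha>] a by (auto split: if_splits)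
  qed
  have coeff: "r \<alpha> = lam (multi_degree \<alpha>) * sqrt (multinomial \<alpha>)" if a: "\<alpha> \<in> T" for \<alpha>
  proof -
    have "(r \<alpha>)\<^sup>2 = (lam (multi_degree \<alpha>))\<^sup>2 * multinomial \<alpha>"
      using pq[of \<alpha>] a ST by (simp flip: of_real_mult of_real_power)
    also have "\<dots> = (lam (multi_degree \<alpha>) * sqrt (multinomial \<alpha>))\<^sup>2"
      using multinomial_pos[of \<alpha>] by (simp add: power_mult_distrib)
    finally have sq: "(r \<alpha>)\<^sup>2 = (lam (multi_degree \<alpha>) * sqrt (multinomial \<alpha>))\<^sup>2" .
    have "0 \<le> r \<alpha>" using r[of \<alpha>] a unfolding ST by simp
    moreover have "0 \<le> lam (multi_degree \<alpha>)" using lam[of "multi_degree \<alpha>"] a unfolding T_def by simp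
    then have "0 \<le> lam (multi_degree \<alpha>) * sqrt (multinomial \<alpha>)"
      using multinomial_pos[of \<alpha>] by simp
    ultimately show ?thesis by (rule power2_eq_imp_eq[OF sq])
  qed
  have "orthogonal_sum_of_tensor_products (\<lambda>z. adj V *v normalised f z)"
    unfolding orthogonal_sum_of_tensor_products_def
  proof (intro exI[of _ J] exI[of _ "\<lambda>j. of_real (lam j)"] exI[of _ e] conjI ballI allI impI J)
    show "inj_on e {\<alpha>. multi_degree \<alpha> \<in> J}" using e unfolding ST T_def .
    fix z :: "complex ^ 'n" assume z: "z \<in> ball 0 1"
    show "(adj V *v normalised f z) $ e \<alpha> = of_real (lam (multi_degree \<alpha>)) * tensor_component \<alpha> z"
      if "multi_degree \<alpha> \<in> J" for \<alpha>
    proof -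
      have a: "\<alpha> \<in> T" using that unfolding T_def by blast
      then have "\<alpha> \<in> S" unfolding ST .
      show ?thesis
        unfolding on[OF z \<open>\<alpha> \<in> S\<close>] coeff[OF a] tensor_component_def multinomial_def by simp
    qed
    show "(adj V *v normalised f z) $ k = 0" if "k \<notin> e ` {\<alpha>. multi_degree \<alpha> \<in> J}" for k
      using off[OF z, of k] that unfolding ST T_def by blast
  qed
  then show ?thesis using spherically_equivalent_unitary_normalised[OF f V] by blast
qed

section \<open>Compactness of the stabiliser of the origin\<close>

lemma continuous_matrix_vector_mult:
  "continuous_on T (\<lambda>(A, x). (A :: complex ^ 'n ^ 'm) *v x)"
  unfolding matrix_vector_mult_def case_prod_unfold by (intro continuous_intros)

lemma compact_unitary_matrices: "compact {U :: complex ^ 'n ^ 'n. unitary_matrix U}"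
proof -
  have "{U :: complex ^ 'n ^ 'n. unitary_matrix U} = {U. \<forall>z. norm (U *v z) = norm z}"
    using unitary_norm unitaryI_norm by blast
  also have "closed \<dots>"
    by (intro closed_Collect_all closed_Collect_eq continuous_intros
        continuous_on_compose2[OF continuous_matrix_vector_mult[of UNIV], of _ "\<lambda>U. (U, _)", simplified])
  finally have "closed {U :: complex ^ 'n ^ 'n. unitary_matrix U}" .
  moreover have "norm U \<le> (\<Sum>i\<in>(UNIV :: 'n set). \<Sum>j\<in>(UNIV :: 'n set). 1)" if U: "unitary_matrix U" for U :: "complex ^ 'n ^ 'n"
  proof -
    have entry: "norm (U $ i $ j) \<le> 1" for i j
    proof -
      have "(U *v axis j 1) $ i = U $ i $ j"
        by (simp add: matrix_vector_mult_def axis_def if_distrib cong: if_cong)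
      then have "norm (U $ i $ j) \<le> norm (U *v axis j 1)" by (metis Finite_Cartesian_Product.norm_nth_le)
      then show ?thesis by (simp add: unitary_norm[OF U] norm_axis_1)
    qed
    have "norm U \<le> (\<Sum>i\<in>UNIV. norm (U $ i))" unfolding norm_vec_def[of U] by (intro L2_set_le_sum) simp
    also have "\<dots> \<le> (\<Sum>i\<in>UNIV. \<Sum>j\<in>UNIV. norm (U $ i $ j))"
      by (intro sum_mono) (auto simp: norm_vec_def[of "U $ _"] intro!: L2_set_le_sum)
    also have "\<dots> \<le> (\<Sum>i\<in>(UNIV :: 'n set). \<Sum>j\<in>(UNIV :: 'n set). 1)" by (intro sum_mono entry)
    finally show ?thesis .
  qed
  then have "bounded {U :: complex ^ 'n ^ 'n. unitary_matrix U}" unfolding bounded_iff by blast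
  ultimately show ?thesis by (simp add: compact_eq_bounded_closed)
qed

text \<open>A subbasic condition \<open>A K \<subseteq> U\<close> fails on the projection of a closed subset of \<open>S \<times> K\<close>,
  which is compact.\<close>

lemma continuous_linear_ball_map:
  assumes S: "compact S" "\<And>A. A \<in> S \<Longrightarrow> unitary_matrix A"
  shows "continuous_map (top_of_set S) ball_aut_topology (linear_ball_map :: complex ^ 'n ^ 'n \<Rightarrow> _)"
  unfolding ball_aut_topology_def
proof (rule continuous_on_generated_topo)
  let ?B = "{{\<gamma> \<in> ball_aut. \<gamma> ` K \<subseteq> U} | K U. compact K \<and> K \<subseteq> ball (0 :: complex ^ 'n) 1 \<and> open U}"
  have "linear_ball_map A \<in> \<Union> ?B" if "A \<in> S" for A
  proof -
    have "linear_ball_map A \<in> {\<gamma> \<in> ball_aut. \<gamma> ` {} \<subseteq> UNIV}" using unitary_ball_aut S(2)[OF that] by simp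
    moreover have "{\<gamma> \<in> ball_aut. \<gamma> ` {} \<subseteq> (UNIV :: (complex ^ 'n) set)} \<in> ?B"
      by (intro CollectI exI[of _ "{}"] exI[of _ UNIV] conjI refl) simp_all
    ultimately show ?thesis by (rule UnionI[rotated])
  qed
  then show "linear_ball_map ` topspace (top_of_set S) \<subseteq> \<Union> ?B" by auto
  fix W assume "W \<in> ?B"
  then obtain K U where W: "W = {\<gamma> \<in> ball_aut. \<gamma> ` K \<subseteq> U}" "compact K" "K \<subseteq> ball 0 1" "open U" by blast
  let ?C = "(S \<times> K) \<inter> (\<lambda>(A, x). A *v x) -` (- U)"
  have "closedin (top_of_set (S \<times> K)) ?C"
    using W(4) by (intro continuous_closedin_preimage continuous_matrix_vector_mult) (simp add: closed_Compl)
  then have "compact ?C" using compact_Times[OF S(1) W(2)] closedin_compact by blast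
  then have "compact (fst ` ?C)" by (intro compact_continuous_image continuous_intros)
  then have "openin (top_of_set S) (S - fst ` ?C)"
    unfolding Diff_eq by (intro openin_open_Int open_Compl compact_imp_closed)
  moreover have "linear_ball_map -` W \<inter> topspace (top_of_set S) = S - fst ` ?C"
  proof -
    have "linear_ball_map A \<in> W \<longleftrightarrow> (\<forall>x\<in>K. A *v x \<in> U)" if "A \<in> S" for A
    proof -
      have "linear_ball_map A x = A *v x" if "x \<in> K" for x
        using W(3) that unfolding linear_ball_map_def by (intro restrict_apply') blast
      then show ?thesis
        using unitary_ball_aut[OF S(2)[OF that]] unfolding W(1) image_subset_iff by simp
    qed
    moreover have "A \<in> fst ` ?C \<longleftrightarrow> A \<in> S \<and> \<not> (\<forall>x\<in>K. A *v x \<in> U)" for A by force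
    ultimately show ?thesis by auto
  qed
  ultimately show "openin (top_of_set S) (linear_ball_map -` W \<inter> topspace (top_of_set S))" by simp
qed

text \<open>The pairs of unitary matrices that intertwine the normalised map form a closed subset of a
  product of two compact groups; the stabiliser of the origin is the image of its projection.\<close>

lemma compactin_Gamma_of_fixing_0:
  fixes f :: "complex ^ 'n \<Rightarrow> complex ^ 'm"
  assumes f: "holomorphic_ball_map f" and fix0: "\<And>\<gamma>. \<gamma> \<in> Gamma_of f \<Longrightarrow> \<gamma> 0 = 0"
  shows "compactin ball_aut_topology (Gamma_of f)"
proof -
  let ?F = "normalised f"
  define UU where "UU = {U :: complex ^ 'n ^ 'n. unitary_matrix U} \<times> {V :: complex ^ 'm ^ 'm. unitary_matrix V}"
  define P where "P = {p \<in> UU. \<forall>z\<in>ball 0 1. ?F (fst p *v z) = snd p *v ?F z}"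
  have UU: "compact UU" unfolding UU_def by (intro compact_Times compact_unitary_matrices)
  have "closed (UU \<inter> (\<Inter>z\<in>ball 0 1. {p \<in> UU. ?F (fst p *v z) - snd p *v ?F z = 0}))"
  proof (intro closed_Int closed_INT ballI continuous_closed_preimage_constant)
    show "closed UU" using UU by (rule compact_imp_closed)
    then show "closed UU" .
    fix z :: "complex ^ 'n" assume z: "z \<in> ball 0 1"
    have "continuous_on UU (\<lambda>p. fst p *v z)"
      unfolding matrix_vector_mult_def by (intro continuous_intros)
    moreover have "(\<lambda>p. fst p *v z) ` UU \<subseteq> ball 0 1" using z by (auto simp: UU_def unitary_norm)
    ultimately have "continuous_on UU (\<lambda>p. ?F (fst p *v z))"
      by (rule continuous_on_compose2[OF holomorphic_map_on_continuous[OF holomorphic_normalised[OF f]]])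
    moreover have "continuous_on UU (\<lambda>p. snd p *v ?F z)"
      unfolding matrix_vector_mult_def by (intro continuous_intros)
    ultimately show "continuous_on UU (\<lambda>p. ?F (fst p *v z) - snd p *v ?F z)" by (rule continuous_on_diff)
  qed
  moreover have "P = UU \<inter> (\<Inter>z\<in>ball 0 1. {p \<in> UU. ?F (fst p *v z) - snd p *v ?F z = 0})"
    unfolding P_def by auto
  ultimately have "closed P" by simp
  then have "compact P" using UU compact_Int_closed[of UU P] unfolding P_def by (simp add: Int_def)
  then have S: "compact (fst ` P)" by (intro compact_continuous_image continuous_intros)
  have "Gamma_of f = linear_ball_map ` fst ` P"
  proof (intro equalityI subsetI)
    fix \<gamma> assume g: "\<gamma> \<in> Gamma_of f"
    then have ga: "\<gamma> \<in> ball_aut" unfolding Gamma_of_def by blast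
    obtain U where U: "unitary_matrix U" "\<And>z. z \<in> ball 0 1 \<Longrightarrow> \<gamma> z = U *v z"
      using ball_aut_fixing_0_unitary[OF ga fix0[OF g]] by blast
    have "\<gamma> \<in> extensional (ball 0 1)" using ga unfolding ball_aut_def by blast
    then have gU: "\<gamma> = linear_ball_map U"
      unfolding linear_ball_map_def by (rule extensionalityI) (use U in auto)
    then obtain V where "unitary_matrix V" "\<forall>z\<in>ball 0 1. ?F (U *v z) = V *v ?F z"
      using unitary_Gamma_of[OF f] g by blast
    then have "(U, V) \<in> P" unfolding P_def UU_def using U by simp
    then show "\<gamma> \<in> linear_ball_map ` fst ` P" unfolding gU by force
  next
    fix \<gamma> assume "\<gamma> \<in> linear_ball_map ` fst ` P"
    then obtain U V where UV: "\<gamma> = linear_ball_map U" "unitary_matrix U" "unitary_matrix V"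
      "\<And>z. z \<in> ball 0 1 \<Longrightarrow> ?F (U *v z) = V *v ?F z"
      unfolding P_def UU_def by auto
    have c: "f 0 \<in> ball 0 1" using f unfolding holomorphic_ball_map_def by (simp add: image_subset_iff)
    let ?m = "restrict (ball_invol (f 0)) (ball 0 1)"
    let ?\<psi> = "restrict (\<lambda>z. ?m (restrict (\<lambda>z. linear_ball_map V (?m z)) (ball 0 1) z)) (ball 0 1)"
    have "?\<psi> \<in> ball_aut" by (intro ball_aut_compose ball_invol_ball_aut[OF c] unitary_ball_aut[OF UV(3)])
    moreover have "f (\<gamma> z) = ?\<psi> (f z)" if z: "z \<in> ball 0 1" for z
    proof -
      have Uz: "U *v z \<in> ball 0 1" using z unitary_norm[OF UV(2)] by simp
      have fz: "f z \<in> ball 0 1" using f z unfolding holomorphic_ball_map_def by blast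
      have VF: "V *v ?F z \<in> ball 0 1" using normalised_in_ball[OF f z] unitary_norm[OF UV(3)] by simp
      have "f (U *v z) = ball_invol (f 0) (V *v ?F z)"
        using ball_invol_normalised[OF f Uz] UV(4)[OF z] by simp
      then show ?thesis
        using z Uz fz VF normalised_in_ball[OF f z]
        by (simp add: UV(1) linear_ball_map_def normalised_def[of f z])
    qed
    ultimately show "\<gamma> \<in> Gamma_of f" unfolding Gamma_of_def UV(1) using unitary_ball_aut[OF UV(2)] by blast
  qed
  moreover have "compactin (top_of_set (fst ` P)) (fst ` P)" using S by simp
  moreover have "continuous_map (top_of_set (fst ` P)) ball_aut_topology linear_ball_map"
    by (rule continuous_linear_ball_map[OF S]) (auto simp: P_def UU_def)
  ultimately show ?thesis using image_compactin by metis
qed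

section \<open>A symmetry that moves the origin\<close>

lemma linear_in_ball_imp_contraction:
  assumes "\<And>z. z \<in> ball 0 1 \<Longrightarrow> L *v z \<in> ball 0 (1::real)"
  shows "norm (L *v z) \<le> norm (z :: complex ^ 'n)"
proof -
  have "norm (L *v z) \<le> norm z" if "z \<in> ball 0 1" for z :: "complex ^ 'n"
    by (rule ball_Schwarz[OF holomorphic_map_on_matrix assms _ that]) auto
  moreover have n: "norm ((1 / (1 + norm z)) *\<^sub>R y) = 1 / (1 + norm z) * norm y" for y :: "complex ^ 'r"
    using inverse_one_plus_norm(2)[of z] by (simp only: norm_scaleR abs_of_pos)
  have "1 / (1 + norm z) * norm z < 1" by (simp add: divide_less_eq_1 add_pos_nonneg)
  then have "(1 / (1 + norm z)) *\<^sub>R z \<in> ball 0 1" by (simp only: mem_ball dist_0_norm n)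
  ultimately have "norm (L *v ((1 / (1 + norm z)) *\<^sub>R z)) \<le> norm ((1 / (1 + norm z)) *\<^sub>R z)" by blast
  then have "1 / (1 + norm z) * norm (L *v z) \<le> 1 / (1 + norm z) * norm z"
    by (simp only: linear_cmul[OF bounded_linear.linear[OF bounded_linear_matrix]] n)
  then show ?thesis using inverse_one_plus_norm(2)[of z] by (simp only: mult_le_cancel_left_pos)
qed

text \<open>If a contraction \<open>L\<close> preserves the norm of \<open>p\<close>, then its adjoint maps
  \<open>L p\<close> back to \<open>p\<close>.\<close>

lemma contraction_norm_preserved:
  assumes L: "\<And>z. norm (L *v z) \<le> norm z" and p: "norm (L *v p) = norm p"
  shows "hinner (L *v z) (L *v p) = hinner z p"
proof -
  define q where "q = adj L *v (L *v p)"
  have "(norm q)\<^sup>2 = norm (hinner q q)" by (simp add: hinner_self norm_power)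
  also have "hinner q q = hinner (L *v q) (L *v p)"
    using hinner_adj[of L q "L *v p"] by (simp add: q_def[symmetric])
  also have "norm \<dots> \<le> norm (L *v q) * norm (L *v p)" by (rule norm_hinner_le)
  also have "\<dots> \<le> norm q * norm p" using L[of q] p by (simp add: mult_right_mono)
  finally have "norm q \<le> norm p" by (cases "norm q = 0") (auto simp: power2_eq_square mult_le_cancel_left)
  then have 1: "(norm q)\<^sup>2 \<le> (norm p)\<^sup>2" by (simp add: power_mono)
  have "hinner p q = of_real ((norm p)\<^sup>2)"
    unfolding q_def hinner_adj[symmetric] hinner_self p ..
  then have "p \<bullet> q = (norm p)\<^sup>2" by (metis Re_hinner Re_complex_of_real)
  then have "(norm (q - p))\<^sup>2 \<le> 0"
    using 1 by (simp add: power2_norm_eq_inner inner_diff inner_commute)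
  then have "q = p" by simp
  then show ?thesis unfolding hinner_adj q_def by simp
qed

text \<open>A polynomial whose only root is \<open>1 / r\<close> is a multiple of a power of
  \<open>1 - r t\<close>, and from the second power on its coefficient of \<open>t\<^sup>2\<close> is positive.\<close>

lemma single_root_poly:
  fixes H :: "complex poly"
  assumes r: "r > 0" and H0: "coeff H 0 = 1"
    and roots: "\<And>t. poly H t = 0 \<Longrightarrow> of_real r * t = 1"
    and H2: "Re (coeff H 2) \<le> 0"
  shows "H = 1 \<or> H = [:1, - of_real r:]"
proof -
  let ?a = "of_real (1 / r) :: complex"
  have ra: "of_real r * ?a = 1" using r by simp
  have "H \<noteq> 0" using H0 by auto
  define k where "k = order ?a H"
  obtain q where q: "H = [:- ?a, 1:] ^ k * q" "\<not> [:- ?a, 1:] dvd q"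
    using order_decomp[OF \<open>H \<noteq> 0\<close>, of ?a] unfolding k_def by blast
  have "poly q t \<noteq> 0" for t
  proof
    assume t: "poly q t = 0"
    then have "of_real r * t = of_real r * ?a" using roots[of t] ra unfolding q(1) by simp
    then have "t = ?a" using r by (simp add: eq_divide_eq mult.commute)
    then show False using t q(2) by (simp add: poly_eq_0_iff_dvd)
  qed
  then obtain c where c: "q = [:c:]" using fundamental_theorem_of_algebra_alt[of q] by blast
  have co: "coeff H i = of_nat (k choose i) * (- ?a) ^ (k - i) * c" if "i \<le> k" for i
    unfolding q(1) c using coeff_linear_poly_power[OF that, of "- ?a" 1] by (simp add: mult.commute)
  have one: "(- ?a) ^ k * c = 1" using co[of 0] H0 by simp
  have a: "- ?a \<noteq> 0" using r by simp
  have "k \<le> 1"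
  proof (rule ccontr)
    assume k: "\<not> k \<le> 1"
    have "k - 2 + 2 = k" using k by simp
    then have pk: "(- ?a) ^ k = (- ?a) ^ (k - 2) * (- ?a)\<^sup>2" using power_add[of "- ?a" "k - 2" 2] by metis
    have "(- ?a)\<^sup>2 * of_real (r\<^sup>2) = 1" using r by (simp add: power_divide)
    then have "(- ?a) ^ (k - 2) * c = (- ?a) ^ (k - 2) * c * ((- ?a)\<^sup>2 * of_real (r\<^sup>2))"
      by (simp only: mult_1_right)
    also have "\<dots> = (- ?a) ^ k * c * of_real (r\<^sup>2)" unfolding pk by (simp only: mult_ac)
    finally have "(- ?a) ^ (k - 2) * c = of_real (r\<^sup>2)" unfolding one by simp
    then have "coeff H 2 = of_real (real (k choose 2) * r\<^sup>2)"
      using co[of 2] k by (simp add: mult.assoc)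
    then have "Re (coeff H 2) = real (k choose 2) * r\<^sup>2" by (metis Re_complex_of_real)
    moreover have "k choose 2 > 0" using k by simp
    ultimately have "Re (coeff H 2) > 0" using r by simp
    then show False using H2 by simp
  qed
  then consider "k = 0" | "k = 1" by linarith
  then show ?thesis
  proof cases
    case 1
    then show ?thesis using one unfolding q(1) c by (simp add: one_pCons)
  next
    case 2
    then have "- c = of_real r" using one r by (simp add: field_simps)
    then have "c = - of_real r" by (metis minus_minus)
    then show ?thesis using 2 r unfolding q(1) c by simp
  qed
qed

lemma poly_eq_on_unit_ball:
  fixes P Q :: "complex poly"
  assumes "\<And>t. norm t < 1 \<Longrightarrow> poly P t = poly Q t" shows "P = Q"
proof (rule ccontr)
  assume "P \<noteq> Q"
  then have "finite {t. poly (P - Q) t = 0}" by (intro poly_roots_finite) simp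
  moreover have "ball 0 1 \<subseteq> {t. poly (P - Q) t = 0}" using assms by auto
  ultimately have "finite (ball (0::complex) 1)" using finite_subset by blast
  then show False using uncountable_ball[of 1 "0::complex"] countable_finite by auto
qed

lemma hinner_orthogonal_sums:
  assumes "\<And>j k. j \<noteq> k \<Longrightarrow> hinner (x j) (y k) = 0"
  shows "hinner (\<Sum>k\<le>d. x k) (\<Sum>k\<le>d. y k) = (\<Sum>k\<le>(d::nat). hinner (x k) (y k))"
proof -
  have "(\<Sum>j\<le>d. hinner (x j) (y k)) = hinner (x k) (y k)" if "k \<le> d" for k
    using that by (subst sum.remove[of _ k]) (auto simp: assms intro!: sum.neutral)
  then show ?thesis unfolding hinner_sum_left hinner_sum_right by (intro sum.cong) auto
qed

text \<open>A finite homogeneous expansion together with one symmetry that moves the origin. Every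
  automorphism that maps \<open>p\<close> to the origin is an involution followed by a unitary map, which is
  the form that the symmetry takes here in the source and in the target.\<close>

locale moved_origin =
  fixes F :: "complex ^ 'n \<Rightarrow> complex ^ 'm" and a :: "nat \<Rightarrow> complex ^ 'n \<Rightarrow> complex ^ 'm" and d :: nat
    and U :: "complex ^ 'n ^ 'n" and V :: "complex ^ 'm ^ 'm" and p b
  assumes hom: "\<And>k c z. a k (c *s z) = c ^ k *s a k z"
    and hol: "\<And>k. holomorphic_map_on (a k) UNIV"
    and inball: "\<And>k z. z \<in> ball 0 1 \<Longrightarrow> a k z \<in> ball 0 1"
    and orth: "\<And>j k z w. j \<noteq> k \<Longrightarrow> hinner (a j z) (a k w) = 0"
    and sum: "\<And>z. z \<in> ball 0 1 \<Longrightarrow> F z = (\<Sum>k\<le>d. a k z)"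
    and F0: "F 0 = 0" and Fball: "\<And>z. z \<in> ball 0 1 \<Longrightarrow> F z \<in> ball 0 1"
    and U: "unitary_matrix U" and V: "unitary_matrix V"
    and p: "p \<in> ball 0 1" "p \<noteq> 0" and b: "b = F p"
    and eq: "\<And>z. z \<in> ball 0 1 \<Longrightarrow> F (U *v ball_invol p z) = V *v ball_invol b (F z)"
    and nonconst: "\<exists>t. norm t < 1 \<and> F (t *s p) \<noteq> 0"
begin

lemma b_ball: "b \<in> ball 0 1" unfolding b by (rule Fball[OF p(1)])

lemma a_0: "a 0 z = 0"
proof -
  have z: "a k 0 = 0" if "k > 0" for k using hom[of k 0 0] that by (simp add: zero_power)
  have "a 0 0 = (\<Sum>k\<le>d. a k 0)" using z by (subst sum.remove[of _ 0]) auto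
  then have "a 0 0 = 0" using sum[of 0] F0 by simp
  then show ?thesis using hom[of 0 0 z] by simp
qed

text \<open>The symmetry and the invariance of the Hermitian form of the ball, with one argument equal to
  the origin, relate the pairing of \<open>F (U (ball_invol p z))\<close> with \<open>F (U p)\<close> to that of \<open>F z\<close>
  with \<open>b\<close>.\<close>

lemma form_identity:
  assumes z: "z \<in> ball 0 1"
  shows "(1 - hinner (F (U *v ball_invol p z)) (F (U *v p))) * (1 - hinner (F z) b) = 1 - hinner b b"
proof -
  have "F (U *v p) = V *v ball_invol b 0" using eq[of 0] F0 by simp
  then have "1 - hinner (F (U *v ball_invol p z)) (F (U *v p)) =
      1 - hinner (ball_invol b (F z)) (ball_invol b 0)"
    unfolding eq[OF z] by (simp only: unitary_hinner[OF V])
  also have "\<dots> = (1 - hinner b b) / (1 - hinner (F z) b)"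
    using hinner_ball_invol[OF b_ball Fball[OF z], of 0] by simp
  finally show ?thesis using one_minus_hinner_neq_0[OF Fball[OF z] b_ball] by simp
qed

text \<open>On the line through \<open>p\<close> the identity becomes one between rational functions of one
  variable. It shows that \<open>1 - hinner (F (t p)) b\<close>, a polynomial in \<open>t\<close> whose nonconstant
  coefficients are nonpositive, has no root other than that of \<open>1 - t (norm p)\<^sup>2\<close>.\<close>

lemma a_at_p:
  shows "norm (a 1 p) = norm p" and "k \<noteq> 1 \<Longrightarrow> k \<le> d \<Longrightarrow> a k p = 0"
proof -
  define r where "r = (norm p)\<^sup>2"
  have r: "r > 0" "hinner p p = of_real r" "r < 1" unfolding r_def hinner_self using p by (auto simp: abs_square_less_1)
  define s where "s = complex_of_real (defect p)"
  have s: "1 + s \<noteq> 0" "s\<^sup>2 = 1 - of_real r"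
    using one_plus_defect_neq_0[OF p(1)] defect_square[OF p(1)] r(2) unfolding s_def by auto
  define h where "h k = (norm (a k p))\<^sup>2" for k
  define g where "g k = (norm (a k (U *v p)))\<^sup>2" for k
  have tp: "t *s p \<in> ball 0 1" if "norm t < 1" for t
    using scalar_mult_in_ball[OF p(1), of t] that by simp
  define H where "H = (1 - (\<Sum>k\<le>d. monom (of_real (h k)) k) :: complex poly)"
  have H: "1 - hinner (F (t *s p)) b = poly H t" if t: "norm t < 1" for t
  proof -
    have "hinner (F (t *s p)) b = (\<Sum>k\<le>d. hinner (a k (t *s p)) (a k p))"
      unfolding b sum[OF tp[OF t]] sum[OF p(1)] by (rule hinner_orthogonal_sums) (rule orth)
    also have "\<dots> = (\<Sum>k\<le>d. of_real (h k) * t ^ k)"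
      unfolding hom by (simp add: hinner_self h_def mult.commute)
    finally show ?thesis unfolding H_def by (simp add: poly_sum poly_monom)
  qed
  have m: "U *v ball_invol p (t *s p) = ((1 - t) / (1 - of_real r * t)) *s (U *v p)" for t
  proof -
    have "1 - of_real r = s\<^sup>2" using s(2) by simp
    then have "of_real r = (1 - s) * (1 + s)" by (simp add: algebra_simps power2_eq_square)
    then have e: "s + of_real r / (1 + s) = 1" using s(1) by simp
    have "ball_invol_num p (t *s p) = (1 - t * (s + of_real r / (1 + s))) *s p"
      unfolding ball_invol_num_def hinner_linear r(2) by (simp add: s_def vec_eq_iff algebra_simps)
    then have num: "ball_invol_num p (t *s p) = (1 - t) *s p" by (simp only: e mult_1_right)
    then show ?thesis
      by (simp only: ball_invol_def num hinner_linear r(2) vector_scalar_commute)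
         (simp add: vec_eq_iff divide_inverse algebra_simps)
  qed
  have rt: "1 - of_real r * t \<noteq> 0" if t: "norm t < 1" for t :: complex
    using one_minus_hinner_neq_0[OF tp[OF t] p(1)] by (simp add: r(2) mult.commute)
  define \<kappa> where "\<kappa> = 1 - hinner b b"
  have \<kappa>: "\<kappa> \<noteq> 0" unfolding \<kappa>_def by (rule one_minus_hinner_neq_0[OF b_ball b_ball])
  \<comment> \<open>the other factor of the identity, multiplied by the d-th power of the denominator\<close>
  define Q where "Q = ([:1, - of_real r:] ^ d -
      (\<Sum>k\<le>d. smult (of_real (g k)) ([:1, -1:] ^ k * [:1, - of_real r:] ^ (d - k))) :: complex poly)"
  have "Q * H = smult \<kappa> ([:1, - of_real r:] ^ d)"
  proof (rule poly_eq_on_unit_ball)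
    fix t :: complex assume t: "norm t < 1"
    let ?q = "1 - of_real r * t" and ?m = "(1 - t) / (1 - of_real r * t)"
    have Ub: "U *v ball_invol p z \<in> ball 0 1" if "z \<in> ball 0 1" for z
      using ball_invol_in_ball[OF p(1) that] unitary_norm[OF U] by simp
    have "hinner (F (U *v ball_invol p (t *s p))) (F (U *v p)) = (\<Sum>k\<le>d. hinner (a k (U *v ball_invol p (t *s p))) (a k (U *v p)))"
      using sum[OF Ub[OF tp[OF t]]] sum[OF Ub[of 0]] by (simp add: hinner_orthogonal_sums orth)
    also have "\<dots> = (\<Sum>k\<le>d. of_real (g k) * ?m ^ k)"
      unfolding m hom by (simp add: hinner_self g_def mult.commute)
    finally have "(1 - (\<Sum>k\<le>d. of_real (g k) * ?m ^ k)) * poly H t = \<kappa>"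
      using form_identity[OF tp[OF t]] H[OF t] unfolding \<kappa>_def by simp
    then have "?q ^ d * (1 - (\<Sum>k\<le>d. of_real (g k) * ?m ^ k)) * poly H t = \<kappa> * ?q ^ d" by (simp add: mult.assoc mult.commute)
    moreover have "?q ^ d * (1 - (\<Sum>k\<le>d. of_real (g k) * ?m ^ k)) = poly Q t"
    proof -
      have "?q ^ d * (of_real (g k) * ?m ^ k) = of_real (g k) * ((1 - t) ^ k * ?q ^ (d - k))" if "k \<le> d" for k
      proof -
        have "?q ^ d = ?q ^ (d - k) * ?q ^ k" using that by (simp flip: power_add)
        moreover have "?q ^ k \<noteq> 0" using rt[OF t] by simp
        ultimately show ?thesis using rt[OF t] by (simp add: power_divide)
      qed
      then have "?q ^ d * (\<Sum>k\<le>d. of_real (g k) * ?m ^ k) = (\<Sum>k\<le>d. of_real (g k) * ((1 - t) ^ k * ?q ^ (d - k)))"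
        unfolding sum_distrib_left by (intro sum.cong) auto
      then show ?thesis unfolding Q_def right_diff_distrib by (simp add: poly_sum mult.commute[of t])
    qed
    ultimately show "poly (Q * H) t = poly (smult \<kappa> ([:1, - of_real r:] ^ d)) t" by (simp add: mult.commute[of t])
  qed
  then have QH: "poly Q t * poly H t = \<kappa> * (1 - of_real r * t) ^ d" for t
    by (metis (no_types) poly_mult poly_smult poly_power poly_pCons poly_0 mult_zero_right add_0_right mult_minus_right uminus_add_conv_diff add.commute mult.commute)
  have "of_real r * t = 1" if "poly H t = 0" for t
  proof -
    have "(1 - of_real r * t) ^ d = 0" using QH[of t] that \<kappa> by simp
    then show ?thesis by simp
  qed
  moreover have coH: "coeff H k = (if k = 0 then 1 else 0) - (if k \<le> d then of_real (h k) else 0)" for k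
    unfolding H_def by (simp add: coeff_sum if_distrib cong: if_cong)
  moreover have "h 0 = 0" unfolding h_def by (simp add: a_0)
  ultimately have "H = 1 \<or> H = [:1, - of_real r:]"
    by (intro single_root_poly[OF r(1)]) (auto simp: h_def)
  moreover have "H \<noteq> 1"
  proof
    assume H1: "H = 1"
    have "a k p = 0" if "k \<le> d" for k
      using coH[of k] that a_0[of p] unfolding H1 by (cases "k = 0") (auto simp: h_def coeff_1)
    then have "F (t *s p) = 0" if "norm t < 1" for t unfolding sum[OF tp[OF that]] hom by simp
    then show False using nonconst by blast
  qed
  ultimately have H: "H = [:1, - of_real r:]" by blast
  have "1 \<le> d" "h 1 = r"
    using coH[of 1] r(1) unfolding H by (auto split: if_splits)
  then show "norm (a 1 p) = norm p" unfolding h_def r_def by (simp add: power2_eq_imp_eq)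
  show "a k p = 0" if "k \<noteq> 1" "k \<le> d"
  proof (cases "k = 0")
    case False
    then have "coeff H k = 0" using that unfolding H by (simp add: coeff_pCons split: nat.split)
    then show ?thesis using coH[of k] that False by (simp add: h_def)
  qed (simp add: a_0)
qed

lemma one_le_d: "1 \<le> d"
proof (rule ccontr)
  assume "\<not> 1 \<le> d"
  then have "d = 0" by simp
  then have "F (t *s p) = 0" if "norm t < 1" for t
    using sum[OF scalar_mult_in_ball[OF p(1), of t]] that by (simp add: a_0)
  then show False using nonconst by blast
qed

text \<open>The linear part is a contraction that preserves the norm of \<open>p\<close>, and it is the only part
  that pairs nontrivially with \<open>b = F p\<close>.\<close>

lemma a_1_linear: "\<exists>L. (\<forall>z. a 1 z = L *v z) \<and> (\<forall>z\<in>ball 0 1. hinner (F z) b = hinner z p)"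
proof -
  obtain L where L: "(a 1 has_derivative (\<lambda>v. L *v v)) (at 0)"
    using hol[of 1] unfolding holomorphic_map_on_def by blast
  have aL: "a 1 z = L *v z" for z
    by (rule homogeneous_degree_1_linear[OF L]) (simp add: hom scaleR_eq_scalar_mult)
  have "norm (L *v z) \<le> norm z" for z
    by (rule linear_in_ball_imp_contraction) (use inball[of _ 1] aL in metis)
  then have "hinner (L *v z) (L *v p) = hinner z p" for z
    by (rule contraction_norm_preserved) (use a_at_p(1) aL in metis)
  moreover have "hinner (F z) b = hinner (a 1 z) (a 1 p)" if z: "z \<in> ball 0 1" for z
  proof -
    have "hinner (F z) b = (\<Sum>k\<le>d. hinner (a k z) (a k p))"
      unfolding b sum[OF z] sum[OF p(1)] by (rule hinner_orthogonal_sums) (rule orth)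
    also have "\<dots> = hinner (a 1 z) (a 1 p)"
      using one_le_d a_at_p(2) by (subst sum.remove[of _ 1]) (auto intro!: sum.neutral)
    finally show ?thesis .
  qed
  ultimately show ?thesis using aL by metis
qed

text \<open>Clearing denominators in the symmetry by the top degree \<open>m\<close> gives an identity between
  entire functions on every complex line through the origin. At a point with
  \<open>hinner \<zeta> p = 1\<close>, which lies outside the ball, only the term of degree \<open>m\<close> survives on
  the left, while the right-hand side vanishes to order \<open>m - 1\<close>.\<close>

lemma top_part_vanishes_at_num:
  assumes m: "2 \<le> m" "m \<le> d" and top: "\<And>k z. m < k \<Longrightarrow> k \<le> d \<Longrightarrow> a k z = 0"
    and \<zeta>: "hinner \<zeta> p = 1"
  shows "a m (U *v ball_invol_num p \<zeta>) = 0"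
proof -
  have Fm: "F z = (\<Sum>k\<le>m. a k z)" if "z \<in> ball 0 1" for z
    unfolding sum[OF that] using m top by (intro sum.mono_neutral_right) auto
  have hb: "hinner (F z) b = hinner z p" if "z \<in> ball 0 1" for z using a_1_linear that by blast
  define y where "y = V *v b"
  define sb where "sb = complex_of_real (defect b)"
  \<comment> \<open>along the line, the numerator of the involution is affine\<close>
  define w where "w = - (of_real (defect p) *s (U *v \<zeta>)) - (1 / of_real (1 + defect p)) *s (U *v p)"
  have N: "U *v ball_invol_num p (t *s \<zeta>) = U *v p + t *s w" for t
    unfolding ball_invol_num_def w_def hinner_linear \<zeta>
    by (simp add: matrix_vector_mult_diff_distrib vector_scalar_commute vec_eq_iff algebra_simps)
  define lhs where "lhs u t = (\<Sum>k\<le>m. (1 - t) ^ (m - k) * hinner (a k (U *v p + t *s w)) u)" for u t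
  define rhs where "rhs u t = (1 - t) ^ (m - 1) * (hinner y u - sb * (\<Sum>k\<le>m. t ^ k * hinner (V *v a k \<zeta>) u)
      - t / of_real (1 + defect b) * hinner y u)" for u t
  have agree: "lhs u t = rhs u t" if t: "norm t * norm \<zeta> < 1" for u t
  proof -
    have z: "t *s \<zeta> \<in> ball 0 1" using t by simp
    have h: "hinner (t *s \<zeta>) p = t" by (simp add: \<zeta>)
    have q: "1 - t \<noteq> 0" using one_minus_hinner_neq_0[OF z p(1)] unfolding h .
    have Ub: "U *v ball_invol p (t *s \<zeta>) \<in> ball 0 1"
      using ball_invol_in_ball[OF p(1) z] unitary_norm[OF U] by simp
    have "F (U *v ball_invol p (t *s \<zeta>)) = (\<Sum>k\<le>m. inverse (1 - t) ^ k *s a k (U *v p + t *s w))"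
      unfolding Fm[OF Ub] unfolding ball_invol_def h vector_scalar_commute N hom ..
    moreover have "V *v ball_invol b (F (t *s \<zeta>)) = inverse (1 - t) *s (y - sb *s (\<Sum>k\<le>m. t ^ k *s (V *v a k \<zeta>))
        - (t / of_real (1 + defect b)) *s y)"
      unfolding ball_invol_def ball_invol_num_def hb[OF z] h unfolding Fm[OF z] hom y_def sb_def
      by (simp add: matrix_vector_mult_diff_distrib vector_scalar_commute
          linear_sum[OF bounded_linear.linear[OF bounded_linear_matrix]])
    ultimately have E: "(\<Sum>k\<le>m. inverse (1 - t) ^ k *s a k (U *v p + t *s w)) =
        inverse (1 - t) *s (y - sb *s (\<Sum>k\<le>m. t ^ k *s (V *v a k \<zeta>))
        - (t / of_real (1 + defect b)) *s y)" using eq[OF z] by simp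
    have "(\<Sum>k\<le>m. inverse (1 - t) ^ k * hinner (a k (U *v p + t *s w)) u) =
        inverse (1 - t) * (hinner y u - sb * (\<Sum>k\<le>m. t ^ k * hinner (V *v a k \<zeta>) u)
        - t / of_real (1 + defect b) * hinner y u)"
      using arg_cong[OF E, of "\<lambda>v. hinner v u"] by (simp only: hinner_sum_left hinner_linear)
    then have "(1 - t) ^ m * (\<Sum>k\<le>m. inverse (1 - t) ^ k * hinner (a k (U *v p + t *s w)) u) =
        (1 - t) ^ m * inverse (1 - t) * (hinner y u - sb * (\<Sum>k\<le>m. t ^ k * hinner (V *v a k \<zeta>) u)
        - t / of_real (1 + defect b) * hinner y u)" by (simp only: mult.assoc)
    moreover have e: "(1 - t) ^ m * inverse (1 - t) ^ k = (1 - t) ^ (m - k)" if "k \<le> m" for k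
      using that q by (simp add: power_diff power_inverse divide_inverse)
    moreover have "(1 - t) ^ m * inverse (1 - t) = (1 - t) ^ (m - 1)" using e[of 1] m by simp
    moreover have "(1 - t) ^ m * (\<Sum>k\<le>m. inverse (1 - t) ^ k * hinner (a k (U *v p + t *s w)) u) = lhs u t"
      unfolding lhs_def sum_distrib_left by (intro sum.cong refl) (simp add: e flip: mult.assoc)
    ultimately show ?thesis unfolding rhs_def by simp
  qed
  have "lhs u 1 = rhs u 1" for u
  proof (rule analytic_continuation_open[where f = "lhs u" and g = "rhs u" and s' = UNIV and
        s = "ball 0 (1 / (1 + norm \<zeta>))"])
    show "ball (0::complex) (1 / (1 + norm \<zeta>)) \<noteq> {}" using inverse_one_plus_norm(2)[of \<zeta>] by simp
    show "lhs u holomorphic_on UNIV" unfolding lhs_def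
      by (intro holomorphic_intros holomorphic_slice[OF hol]) auto
    show "rhs u holomorphic_on UNIV" unfolding rhs_def
      by (intro holomorphic_intros) (use one_plus_defect_neq_0[OF b_ball] in simp)
    fix t :: complex assume "t \<in> ball 0 (1 / (1 + norm \<zeta>))"
    then have "norm t * (1 + norm \<zeta>) < 1" by (simp add: pos_less_divide_eq add_pos_nonneg)
    then have "norm t * norm \<zeta> < 1" 
      unfolding distrib_left mult_1_right using norm_ge_zero[of t] by linarith
    then show "lhs u t = rhs u t" by (rule agree)
  qed auto
  moreover have "rhs u 1 = 0" for u unfolding rhs_def using m(1) by simp
  moreover have "lhs u 1 = hinner (a m (U *v p + 1 *s w)) u" for u
    unfolding lhs_def by (subst sum.remove[of _ m]) (auto intro!: sum.neutral)
  ultimately have "hinner (a m (U *v p + 1 *s w)) u = 0" for u by metis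
  from this[of "axis _ 1"] have "a m (U *v p + 1 *s w) = 0" by (simp add: vec_eq_iff)
  then show ?thesis using N[of 1] by simp
qed

text \<open>Up to scalars, the points \<open>U (ball_invol_num p \<zeta>)\<close> with \<open>hinner \<zeta> p = 1\<close> are all
  points off one hyperplane, and a homogeneous map that vanishes there vanishes everywhere.\<close>

lemma higher_parts_vanish:
  assumes "2 \<le> k" "k \<le> d" shows "a k z = 0"
proof (rule ccontr)
  assume "a k z \<noteq> 0"
  let ?K = "{k. 2 \<le> k \<and> k \<le> d \<and> (\<exists>z. a k z \<noteq> 0)}"
  have K: "finite ?K" "?K \<noteq> {}" using assms \<open>a k z \<noteq> 0\<close> by auto
  define m where "m = Max ?K"
  have m: "2 \<le> m" "m \<le> d" "\<exists>z. a m z \<noteq> 0" using Max_in[OF K] unfolding m_def by auto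
  have top: "a j x = 0" if "m < j" "j \<le> d" for j x
  proof (rule ccontr)
    assume "a j x \<noteq> 0"
    then have "j \<in> ?K" using that m by auto
    then show False using Max_ge[OF K(1)] that unfolding m_def by fastforce
  qed
  define s where "s = complex_of_real (defect p)"
  have s: "1 + s \<noteq> 0" "s \<noteq> 0" "s\<^sup>2 = 1 - hinner p p"
    using one_plus_defect_neq_0[OF p(1)] defect_square[OF p(1)] defect_pos[OF p(1)] unfolding s_def by auto
  have off: "a m (U *v x) = 0" if x: "hinner x p \<noteq> 0" for x
  proof -
    \<comment> \<open>chosen so that the numerator of the involution maps it to a multiple of x\<close>
    define \<zeta> where "\<zeta> = (1 / (1 + s)) *s p + (s / hinner x p) *s x"
    have pp: "hinner p p = (1 - s) * (1 + s)" using s(3) by (simp add: algebra_simps power2_eq_square)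
    have "hinner \<zeta> p = 1" unfolding \<zeta>_def using x s(1) by (simp add: pp)
    from top_part_vanishes_at_num[OF m(1,2) top this]
    have "a m (U *v ball_invol_num p \<zeta>) = 0" .
    moreover have "ball_invol_num p \<zeta> = (- s\<^sup>2 / hinner x p) *s x"
    proof -
      have "ball_invol_num p \<zeta> = (1 - s / (1 + s) - 1 / (1 + s)) *s p + (- s\<^sup>2 / hinner x p) *s x"
        unfolding ball_invol_num_def \<open>hinner \<zeta> p = 1\<close>
        by (simp add: \<zeta>_def s_def vec_eq_iff algebra_simps power2_eq_square)
      also have "1 - s / (1 + s) - 1 / (1 + s) = 0" using s(1) by (simp add: field_simps)
      finally show ?thesis by simp
    qed
    ultimately have "(- s\<^sup>2 / hinner x p) ^ m *s a m (U *v x) = 0"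
      by (simp only: vector_scalar_commute hom)
    then show ?thesis using s(2) x by simp
  qed
  have "a m (U *v x) = 0" for x
  proof (cases "hinner x p = 0")
    case True
    have "hinner (a m (U *v x + t *s (U *v p))) u = 0" if "t \<noteq> 0" for t u
    proof -
      have "hinner (x + t *s p) p \<noteq> 0" using True that p(2) by (simp add: hinner_self)
      from off[OF this] show ?thesis by (simp add: matrix_vector_right_distrib vector_scalar_commute)
    qed
    then have "((\<lambda>t. hinner (a m (U *v x + t *s (U *v p))) u) \<longlongrightarrow> 0) (at 0)" for u
      by (intro tendsto_eventually) (simp add: eventually_at_filter)
    moreover have "((\<lambda>t. hinner (a m (U *v x + t *s (U *v p))) u) \<longlongrightarrow>
        hinner (a m (U *v x + 0 *s (U *v p))) u) (at 0)" for u
      using holomorphic_on_imp_continuous_on[OF holomorphic_slice[OF hol open_UNIV UNIV_I]]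
      unfolding continuous_on_eq_continuous_at[OF open_UNIV] isCont_def by blast
    ultimately have "hinner (a m (U *v x + 0 *s (U *v p))) u = 0" for u using LIM_unique by metis
    from this[of "axis _ 1"] show ?thesis by (simp add: vec_eq_iff)
  qed (rule off)
  then have "a m z = 0" for z using unitary_adj_cancel(2)[OF U, of z] by metis
  then show False using m(3) by blast
qed

theorem moved_origin_imp_linear: "\<exists>L. \<forall>z\<in>ball 0 1. F z = L *v z"
proof -
  obtain L where L: "\<And>z. a 1 z = L *v z" using a_1_linear by blast
  have "F z = L *v z" if z: "z \<in> ball 0 1" for z
  proof -
    have "a k z = 0" if "k \<in> {..d} - {1}" for k
      using that a_0 higher_parts_vanish[of k z] by (cases "k = 0") auto
    then show ?thesis
      unfolding sum[OF z] using one_le_d by (subst sum.remove[of _ 1]) (auto simp: L[unfolded One_nat_def] intro!: sum.neutral)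
  qed
  then show ?thesis by blast
qed

end

section \<open>Noncompact symmetry groups\<close>

lemma linear_fractional_ball_invol:
  assumes c: "c \<in> ball 0 1" and L: "\<And>z. z \<in> ball 0 1 \<Longrightarrow> L *v z \<in> ball 0 1"
    and f: "\<And>z. z \<in> ball 0 1 \<Longrightarrow> f z = ball_invol c (L *v z)"
  shows "linear_fractional (f :: complex ^ 'n \<Rightarrow> complex ^ 'm)"
proof -
  let ?D = "\<lambda>v. - (of_real (defect c) *s (L *v v)) - (hinner (L *v v) c / of_real (1 + defect c)) *s c"
  have "bounded_linear ?D"
    unfolding divide_inverse
    by (intro bounded_linear_sub bounded_linear_minus
        bounded_linear_compose[OF bounded_bilinear.bounded_linear_right[OF bounded_bilinear_scalar_mult] bounded_linear_matrix]
        bounded_linear_compose[OF bounded_bilinear.bounded_linear_left[OF bounded_bilinear_scalar_mult]]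
        bounded_linear_compose[OF bounded_linear_mult_left]
        bounded_linear_compose[OF bounded_linear_hinner_left bounded_linear_matrix])
  moreover have "?D (k *s v) = k *s ?D v" for k v
    by (simp add: vector_scalar_commute vec_eq_iff algebra_simps)
  ultimately obtain A where A: "\<And>v. ?D v = A *v v" using complex_linear_matrix[of ?D] by blast
  let ?c = "- (adj L *v c)"
  have den: "(\<Sum>i\<in>UNIV. z $ i * cnj (?c $ i)) + 1 = 1 - hinner (L *v z) c" for z
    unfolding hinner_adj by (simp add: hinner_def sum_negf)
  have "f z = inverse (1 - hinner (L *v z) c) *s (A *v z + c)" if "z \<in> ball 0 1" for z
    unfolding f[OF that] ball_invol_def ball_invol_num_def A[symmetric] by (simp add: algebra_simps)
  moreover have "1 - hinner (L *v z) c \<noteq> 0" if "z \<in> ball 0 1" for z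
    by (rule one_minus_hinner_neq_0[OF L[OF that] c])
  ultimately show ?thesis
    unfolding linear_fractional_def
    by (intro exI[of _ A] exI[of _ c] exI[of _ ?c] exI[of _ 1]) (simp only: den, blast)
qed

text \<open>The fibres of a proper map are compact, so none contains a whole radius of the ball.\<close>

lemma proper_not_constant_on_disc:
  fixes f :: "complex ^ 'n \<Rightarrow> complex ^ 'm"
  assumes f: "proper_holomorphic_ball_map f" and p: "p \<noteq> 0" and y: "y \<in> ball 0 1"
    and const: "\<And>t. norm t * norm p < 1 \<Longrightarrow> f (t *s p) = y"
  shows False
proof -
  define K where "K = {x \<in> ball 0 1. f x = y}"
  have "compactin (top_of_set (ball 0 1)) K"
    using f y unfolding proper_holomorphic_ball_map_def proper_map_def K_def by simp
  then have "compact K" by (simp add: compactin_subtopology)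
  moreover have "0 \<in> K" using const[of 0] unfolding K_def by simp
  ultimately obtain x where x: "x \<in> K" "\<And>z. z \<in> K \<Longrightarrow> norm z \<le> norm x"
    using continuous_attains_sup[of K norm] continuous_on_norm[OF continuous_on_id] by blast
  define t where "t = complex_of_real ((1 + norm x) / 2 / norm p)"
  have "norm t = \<bar>(1 + norm x) / 2 / norm p\<bar>" unfolding t_def by (rule norm_of_real)
  then have n: "norm t * norm p = (1 + norm x) / 2" using p by (simp add: abs_of_nonneg)
  have "norm x < 1" using x(1) unfolding K_def by simp
  then have "t *s p \<in> K" using const[of t] n unfolding K_def by simp
  then have "norm (t *s p) \<le> norm x" by (rule x(2))
  then show False using n \<open>norm x < 1\<close> by simp
qed

lemma noncompact_linear_fractional:
  fixes f :: "complex ^ 'n \<Rightarrow> complex ^ 'm"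
  assumes pf: "proper_holomorphic_ball_map f" and c: "unitary_center \<subseteq> Gamma_of f"
    and nc: "\<not> compactin ball_aut_topology (Gamma_of f)"
  shows "linear_fractional f"
proof -
  have f: "holomorphic_ball_map f" using pf unfolding proper_holomorphic_ball_map_def by blast
  have f0: "f 0 \<in> ball 0 1" using f unfolding holomorphic_ball_map_def by (simp add: image_subset_iff)
  let ?F = "normalised f"
  obtain \<gamma> where \<gamma>: "\<gamma> \<in> Gamma_of f" "\<gamma> 0 \<noteq> 0" using compactin_Gamma_of_fixing_0[OF f] nc by blast
  then have ga: "\<gamma> \<in> ball_aut" unfolding Gamma_of_def by blast
  obtain p where p: "p \<in> ball 0 1" "\<gamma> p = 0" using ball_autD(3)[OF ga] by force
  have p0: "p \<noteq> 0" using p \<gamma> by auto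
  obtain U where U: "unitary_matrix U" "\<And>z. z \<in> ball 0 1 \<Longrightarrow> \<gamma> z = U *v ball_invol p z"
    using ball_aut_eq_unitary_ball_invol[OF ga p] by blast
  obtain \<psi> where \<psi>: "\<psi> \<in> ball_aut" "\<And>z. z \<in> ball 0 1 \<Longrightarrow> ?F (\<gamma> z) = \<psi> (?F z)"
    using Gamma_of_normalised[OF f \<gamma>(1)] by blast
  have "\<psi> (?F p) = 0" using \<psi>(2)[OF p(1)] p(2) normalised_0[OF f] by simp
  then obtain V where V: "unitary_matrix V" "\<And>z. z \<in> ball 0 1 \<Longrightarrow> \<psi> z = V *v ball_invol (?F p) z"
    using ball_aut_eq_unitary_ball_invol[OF \<psi>(1) normalised_in_ball[OF f p(1)]] by blast
  obtain d a where exp: "\<And>k c z. a k (c *s z) = c ^ k *s a k z" "\<And>k. holomorphic_map_on (a k) UNIV"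
    "\<And>k z. z \<in> ball 0 1 \<Longrightarrow> a k z \<in> ball 0 1"
    "\<And>j k z w. j \<noteq> k \<Longrightarrow> hinner (a j z) (a k w) = 0"
    "\<And>z. z \<in> ball 0 1 \<Longrightarrow> ?F z = (\<Sum>k\<le>d. a k z)"
    using rotation_equivariant_expansion[OF holomorphic_normalised[OF f] normalised_in_ball[OF f]
        rotation_Gamma_of[OF f c]] by metis
  have nonconst: "\<exists>t. norm t < 1 \<and> ?F (t *s p) \<noteq> 0"
  proof (rule ccontr)
    assume "\<nexists>t. norm t < 1 \<and> ?F (t *s p) \<noteq> 0"
    then have z: "(\<Sum>k\<le>d. a k (t *s p)) = 0" if "norm t < 1" for t
      using exp(5)[OF scalar_mult_in_ball[OF p(1), of t]] that by simp
    \<comment> \<open>vanishing on the smaller disc spreads to the whole disc through p in the ball\<close>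
    have "(\<Sum>k\<le>d. a k (t *s p)) $ i = 0" for t i
    proof -
      let ?P = "\<Sum>k\<le>d. monom (a k p $ i) k"
      have P: "(\<Sum>k\<le>d. a k (t *s p)) $ i = poly ?P t" for t
        by (simp add: exp(1) poly_sum poly_monom mult.commute)
      then have "?P = 0" using poly_eq_on_unit_ball[of ?P 0] z by (metis poly_0 zero_index)
      then show ?thesis unfolding P by simp
    qed
    then have "?F (t *s p) = 0" if "norm t * norm p < 1" for t
      using exp(5)[of "t *s p"] that by (simp add: vec_eq_iff)
    then have "f (t *s p) = f 0" if "norm t * norm p < 1" for t
      using ball_invol_normalised[OF f, of "t *s p"] that by simp
    then show False using proper_not_constant_on_disc[OF pf p0 f0] by blast
  qed
  interpret moved_origin ?F a d U V p "?F p"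
  proof
    show "?F (U *v ball_invol p z) = V *v ball_invol (?F p) (?F z)" if z: "z \<in> ball 0 1" for z
      using \<psi>(2)[OF z] U(2)[OF z] V(2)[OF normalised_in_ball[OF f z]] by simp
  qed (use exp normalised_0[OF f] normalised_in_ball[OF f] U V p p0 nonconst in auto)
  obtain L where L: "\<And>z. z \<in> ball 0 1 \<Longrightarrow> ?F z = L *v z" using moved_origin_imp_linear by blast
  show ?thesis
  proof (rule linear_fractional_ball_invol[OF f0])
    fix z :: "complex ^ 'n" assume z: "z \<in> ball 0 1"
    show "L *v z \<in> ball 0 1" using normalised_in_ball[OF f z] L[OF z] by simp
    show "f z = ball_invol (f 0) (L *v z)" using ball_invol_normalised[OF f z] L[OF z] by simp
  qed
qed

theorem corollary1p2:
  fixes f :: "complex ^ 'n \<Rightarrow> complex ^ 'm"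
  assumes "proper_holomorphic_ball_map f"
  shows "(diagonal_torus \<subseteq> Gamma_of f \<longrightarrow>
           (\<exists>g :: complex ^ 'n \<Rightarrow> complex ^ 'm. monomial_map g \<and> spherically_equivalent f g)) \<and>
         (unitary_group \<subseteq> Gamma_of f \<longrightarrow>
           (\<exists>g :: complex ^ 'n \<Rightarrow> complex ^ 'm.
              orthogonal_sum_of_tensor_products g \<and> spherically_equivalent f g)) \<and>
         (unitary_center \<subseteq> Gamma_of f \<and> \<not> compactin ball_aut_topology (Gamma_of f) \<longrightarrow>
           linear_fractional f)"
proof -
  have f: "holomorphic_ball_map f" using assms unfolding proper_holomorphic_ball_map_def by blast
  show ?thesis
    using torus_invariant_monomial[OF f] unitary_invariant_tensor_sum[OF f]
      noncompact_linear_fractional[OF assms] by blast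
qed

end
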